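(* Let $\mu\in\mathcal M_b(E)$ and let $f:E\times\mathbb R\to\mathbb R$ be a measurable function that is non-increasing with respect to the second variable. (i) If $R_\alpha(C_b(E))\subset C_b(E)$ for some $\alpha>0$, then there exists at most one renormalized solution $u\in L^1(E;m)$ to $-Au=f(\cdot,u)+\mu$. (ii) If $R_\alpha(\mathcal B_b(E))\subset C_b(E)$ for some $\alpha>0$, then there exists at most one renormalized solution to $-Au=f(\cdot,u)+\mu$. (Uniqueness is understood up to equality $m$-a.e.)
   Context: Setting. $E$ is a locally compact separable metric space, $m$ a Radon measure on $E$ with full support, $(\mathcal E,D(\mathcal E))$ a symmetric Dirichlet form on $L^2(E;m)$ which is regular and transient (there is a strictly positive $g$ on $E$ and $c>0$ with $\int_E|u|g\,dm\le c\sqrt{\mathcal E(u,u)}$ for $u\in D(\mathcal E)$). $D_e(\mathcal E)$ is the extended Dirichlet space (a Hilbert space with inner product $\mathcal E$). $(A,D(A))$ is the non-positive definite self-adjoint operator on $L^2(E;m)$ with $D(A)\subset D(\mathcal E)$ and $\mathcal E(u,v)=(-Au,v)$ for $u\in D(A)$, $v\in D(\mathcal E)$. $\mathcal B(E)$, $\mathcal B_b(E)$ are the Borel measurable, resp. bounded Borel measurable, functions on $E$; $C_b(E)$ the bounded continuous ones. Capacity: for open $U$, $\mathrm{Cap}(U)=\inf\{\mathcal E(u,u):u\in D(\mathcal E),u\ge\mathbf 1_U\ m\text{-a.e.}\}$, and $\mathrm{Cap}(B)=\inf\{\mathrm{Cap}(U):B\subset U,\ U\text{ open}\}$ for general $B$.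 A function $u$ is quasi-continuous if for every $\varepsilon>0$ there is a closed $F_\varepsilon$ with $\mathrm{Cap}(E\setminus F_\varepsilon)<\varepsilon$ and $u_{|F_\varepsilon}$ continuous. Every $u\in D_e(\mathcal E)$ has a quasi-continuous $m$-version, which is the one used in integrals against smooth measures. Measures: $\mathcal M_b(E)$ is the set of bounded signed Borel measures on $E$; $\langle\mu,\eta\rangle=\int_E\eta\,d\mu$. A Borel measure $\mu$ is smooth if $|\mu|(B)=0$ whenever $\mathrm{Cap}(B)=0$ and $\langle|\mu|,\eta\rangle<\infty$ for some strictly positive quasi-continuous $\eta$. $\mathcal M_{0,b}(E)$ is the set of bounded smooth (signed) measures. Each $\mu\in\mathcal M_b(E)$ has a unique decomposition $\mu=\mu_d+\mu_c$ with $\mu_d$ smooth and $\mu_c$ concentrated on a Borel set of zero capacity. Narrow convergence $\nu_k\to\mu_c$ means $\int_E\eta\,d\nu_k\to\int_E\eta\,d\mu_c$ for all $\eta\in C_b(E)$. Process: $\mathbb X=((X_t)_{t\ge0},(P_x)_{x\in E})$ is a Hunt process with lifetime $\zeta$ associated with $(\mathcal E,D(\mathcal E))$; functions on $E$ are extended by $0$ to the cemetery $\partial$. It is assumed that $\mathbb X$ satisfies the absolute continuity condition: there is a positive Borel $p(t,x,y)$ (symmetric and satisfying the Chapman–Kolmogorov equation) with $E_xh(X_t)=\int_Eh(y)p(t,x,y)\,m(dy)$ for all $x\in E$, $t>0$, $h\in\mathcal B(E)$, $h\ge0$. Put $R_\alpha h(x)=E_x\int_0^\zeta e^{-\alpha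 t}h(X_t)\,dt$. $T_k(u)=(u\wedge k)\vee(-k)$. Definition. $u\in\mathcal B(E)$ is a renormalized solution to $-Au=f(\cdot,u)+\mu$ if (i) $T_k(u)\in D_e(\mathcal E)$ for every $k\ge0$ and $f(\cdot,u)\in L^1(E;m)$; (ii) there is a family $(\nu_k)_{k>0}\subset\mathcal M_{0,b}(E)$ such that $\mathcal E(T_k(u),\eta)=\langle f(\cdot,u),\eta\rangle+\langle\mu_d,\eta\rangle+\langle\nu_k,\eta\rangle$ for all $\eta\in D_e(\mathcal E)\cap\mathcal B_b(E)$ and $k>0$, where $\langle f(\cdot,u),\eta\rangle=\int_Ef(x,u(x))\eta(x)\,m(dx)$; (iii) $\nu_k\to\mu_c$ in the narrow topology as $k\to\infty$. *)

theory Defs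
  imports "HOL-Probability.Probability"
begin

text \<open>
  The state space \<open>E\<close> is the whole type \<open>'a\<close>.  Elements of \<open>L\<^sup>2\<close>, \<open>D(\<E>)\<close>, \<open>D\<^sub>e(\<E>)\<close> are
  represented by Borel functions \<open>'a \<Rightarrow> real\<close>, not by equivalence classes; invariance under
  change on \<open>m\<close>-null sets is part of the definitions.
\<close>

section \<open>Function spaces and the reference measure\<close>

text \<open>On a locally compact separable metric space a Borel measure which is finite on compact
  sets is automatically inner and outer regular.\<close>

definition radon_measure :: "'a::metric_space measure \<Rightarrow> bool" where
  "radon_measure m \<longleftrightarrow> sets m = sets borel \<and> (\<forall>K. compact K \<longrightarrow> emeasure m K < \<infinity>)"

definition full_support :: "'a::topological_space measure \<Rightarrow> bool" where
  "full_support m \<longleftrightarrow> (\<forall>U. open U \<and> U \<noteq> {} \<longrightarrow> emeasure m U > 0)"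

definition bounded_borel :: "('a::topological_space \<Rightarrow> real) set" where
  "bounded_borel = {h \<in> borel_measurable borel. bounded (range h)}"

definition cont_compact_support :: "('a::topological_space \<Rightarrow> real) set" where
  "cont_compact_support = {h. continuous_on UNIV h \<and> compact (closure {x. h x \<noteq> 0})}"

definition L2 :: "'a measure \<Rightarrow> ('a \<Rightarrow> real) set" where
  "L2 m = {u \<in> borel_measurable m. integrable m (\<lambda>x. (u x)\<^sup>2)}"

definition l2_inner :: "'a measure \<Rightarrow> ('a \<Rightarrow> real) \<Rightarrow> ('a \<Rightarrow> real) \<Rightarrow> real" where
  "l2_inner m u v = (\<integral>x. u x * v x \<partial>m)"

definition l2_norm :: "'a measure \<Rightarrow> ('a \<Rightarrow> real) \<Rightarrow> real" where
  "l2_norm m u = sqrt (l2_inner m u u)"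


section \<open>Dirichlet forms\<close>

text \<open>The squared norm \<open>\<E>\<^sub>1(u,u)\<close>.\<close>

definition energy1 ::
    "'a measure \<Rightarrow> (('a \<Rightarrow> real) \<Rightarrow> ('a \<Rightarrow> real) \<Rightarrow> real) \<Rightarrow> ('a \<Rightarrow> real) \<Rightarrow> real" where
  "energy1 m \<E> u = \<E> u u + l2_inner m u u"

definition symmetric_form ::
    "'a measure \<Rightarrow> ('a \<Rightarrow> real) set \<Rightarrow> (('a \<Rightarrow> real) \<Rightarrow> ('a \<Rightarrow> real) \<Rightarrow> real) \<Rightarrow> bool" where
  "symmetric_form m D \<E> \<longleftrightarrow>
     D \<subseteq> L2 m \<and> (\<lambda>x. 0) \<in> D \<and>
     (\<forall>u\<in>D. \<forall>v\<in>D. \<forall>a b. (\<lambda>x. a * u x + b * v x) \<in> D) \<and>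
     (\<forall>u\<in>D. \<forall>v\<in>borel_measurable m. (AE x in m. u x = v x) \<longrightarrow>
        v \<in> D \<and> (\<forall>w\<in>D. \<E> u w = \<E> v w)) \<and>
     (\<forall>h\<in>L2 m. \<forall>e>0. \<exists>u\<in>D. l2_norm m (\<lambda>x. h x - u x) < e) \<and>
     (\<forall>u\<in>D. \<forall>v\<in>D. \<forall>w\<in>D. \<forall>a b. \<E> (\<lambda>x. a * u x + b * v x) w = a * \<E> u w + b * \<E> v w) \<and>
     (\<forall>u\<in>D. \<forall>v\<in>D. \<E> u v = \<E> v u) \<and>
     (\<forall>u\<in>D. \<E> u u \<ge> 0)"

definition closed_form ::
    "'a measure \<Rightarrow> ('a \<Rightarrow> real) set \<Rightarrow> (('a \<Rightarrow> real) \<Rightarrow> ('a \<Rightarrow> real) \<Rightarrow> real) \<Rightarrow> bool" where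
  "closed_form m D \<E> \<longleftrightarrow>
     (\<forall>us::nat \<Rightarrow> 'a \<Rightarrow> real. (\<forall>n. us n \<in> D) \<longrightarrow>
        (\<forall>e>0. \<exists>N. \<forall>i\<ge>N. \<forall>j\<ge>N. energy1 m \<E> (\<lambda>x. us i x - us j x) < e) \<longrightarrow>
        (\<exists>u\<in>D. (\<lambda>n. energy1 m \<E> (\<lambda>x. us n x - u x)) \<longlonglongrightarrow> 0))"

definition markovian_form ::
    "('a \<Rightarrow> real) set \<Rightarrow> (('a \<Rightarrow> real) \<Rightarrow> ('a \<Rightarrow> real) \<Rightarrow> real) \<Rightarrow> bool" where
  "markovian_form D \<E> \<longleftrightarrow>
     (\<forall>u\<in>D. (\<lambda>x. min (max (u x) 0) 1) \<in> D \<and>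
        \<E> (\<lambda>x. min (max (u x) 0) 1) (\<lambda>x. min (max (u x) 0) 1) \<le> \<E> u u)"

definition symmetric_dirichlet_form ::
    "'a measure \<Rightarrow> ('a \<Rightarrow> real) set \<Rightarrow> (('a \<Rightarrow> real) \<Rightarrow> ('a \<Rightarrow> real) \<Rightarrow> real) \<Rightarrow> bool" where
  "symmetric_dirichlet_form m D \<E> \<longleftrightarrow>
     symmetric_form m D \<E> \<and> closed_form m D \<E> \<and> markovian_form D \<E>"

definition regular_form ::
    "'a::topological_space measure \<Rightarrow> ('a \<Rightarrow> real) set \<Rightarrow>
     (('a \<Rightarrow> real) \<Rightarrow> ('a \<Rightarrow> real) \<Rightarrow> real) \<Rightarrow> bool" where
  "regular_form m D \<E> \<longleftrightarrow>
     (\<forall>u\<in>D. \<forall>e>0. \<exists>\<phi>\<in>D \<inter> cont_compact_support. energy1 m \<E> (\<lambda>x. u x - \<phi> x) < e) \<and>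
     (\<forall>h\<in>cont_compact_support. \<forall>e>0. \<exists>\<phi>\<in>D \<inter> cont_compact_support. \<forall>x. \<bar>h x - \<phi> x\<bar> < e)"

definition transient_form ::
    "'a measure \<Rightarrow> ('a \<Rightarrow> real) set \<Rightarrow> (('a \<Rightarrow> real) \<Rightarrow> ('a \<Rightarrow> real) \<Rightarrow> real) \<Rightarrow> bool" where
  "transient_form m D \<E> \<longleftrightarrow>
     (\<exists>g\<in>borel_measurable m. \<exists>c>0. (\<forall>x. g x > 0) \<and>
        (\<forall>u\<in>D. (\<integral>\<^sup>+x. ennreal (\<bar>u x\<bar> * g x) \<partial>m) \<le> ennreal (c * sqrt (\<E> u u))))"

text \<open>\<open>form_generator m D \<E> u w\<close> says that \<open>u \<in> D(A)\<close> and \<open>A u = w\<close>.\<close>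

definition form_generator ::
    "'a measure \<Rightarrow> ('a \<Rightarrow> real) set \<Rightarrow> (('a \<Rightarrow> real) \<Rightarrow> ('a \<Rightarrow> real) \<Rightarrow> real) \<Rightarrow>
     ('a \<Rightarrow> real) \<Rightarrow> ('a \<Rightarrow> real) \<Rightarrow> bool" where
  "form_generator m D \<E> u w \<longleftrightarrow>
     u \<in> D \<and> w \<in> L2 m \<and> (\<forall>v\<in>D. \<E> u v = l2_inner m (\<lambda>x. - w x) v)"

text \<open>\<open>T\<close> is the strongly continuous contraction semigroup on \<open>L\<^sup>2(E;m)\<close> whose generator
  (as a graph) is \<open>A\<close>.\<close>

definition generated_semigroup ::
    "'a measure \<Rightarrow> (('a \<Rightarrow> real) \<Rightarrow> ('a \<Rightarrow> real) \<Rightarrow> bool) \<Rightarrow>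
     (real \<Rightarrow> ('a \<Rightarrow> real) \<Rightarrow> ('a \<Rightarrow> real)) \<Rightarrow> bool" where
  "generated_semigroup m A T \<longleftrightarrow>
     (\<forall>t\<ge>0. \<forall>h\<in>L2 m. T t h \<in> L2 m \<and> l2_norm m (T t h) \<le> l2_norm m h) \<and>
     (\<forall>t\<ge>0. \<forall>h\<in>L2 m. \<forall>k\<in>L2 m. \<forall>a b.
        AE x in m. T t (\<lambda>y. a * h y + b * k y) x = a * T t h x + b * T t k x) \<and>
     (\<forall>h\<in>L2 m. AE x in m. T 0 h x = h x) \<and>
     (\<forall>s\<ge>0. \<forall>t\<ge>0. \<forall>h\<in>L2 m. AE x in m. T (s + t) h x = T s (T t h) x) \<and>
     (\<forall>h\<in>L2 m. ((\<lambda>t. l2_norm m (\<lambda>x. T t h x - h x)) \<longlongrightarrow> 0) (at_right 0)) \<and>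
     (\<forall>u\<in>L2 m. \<forall>w\<in>L2 m.
        A u w \<longleftrightarrow> ((\<lambda>t. l2_norm m (\<lambda>x. (T t u x - u x) / t - w x)) \<longlongrightarrow> 0) (at_right 0))"


section \<open>The extended Dirichlet space\<close>

definition approximating_seq ::
    "'a measure \<Rightarrow> ('a \<Rightarrow> real) set \<Rightarrow> (('a \<Rightarrow> real) \<Rightarrow> ('a \<Rightarrow> real) \<Rightarrow> real) \<Rightarrow>
     (nat \<Rightarrow> 'a \<Rightarrow> real) \<Rightarrow> ('a \<Rightarrow> real) \<Rightarrow> bool" where
  "approximating_seq m D \<E> us u \<longleftrightarrow>
     (\<forall>n. us n \<in> D) \<and>
     (\<forall>e>0. \<exists>N. \<forall>i\<ge>N. \<forall>j\<ge>N. \<E> (\<lambda>x. us i x - us j x) (\<lambda>x. us i x - us j x) < e) \<and>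
     (AE x in m. (\<lambda>n. us n x) \<longlonglongrightarrow> u x)"

definition ext_space ::
    "'a measure \<Rightarrow> ('a \<Rightarrow> real) set \<Rightarrow> (('a \<Rightarrow> real) \<Rightarrow> ('a \<Rightarrow> real) \<Rightarrow> real) \<Rightarrow> ('a \<Rightarrow> real) set" where
  "ext_space m D \<E> = {u \<in> borel_measurable m. \<exists>us. approximating_seq m D \<E> us u}"

text \<open>The extension of \<open>\<E>\<close> to \<open>D\<^sub>e(\<E>)\<close>, which does not depend on the approximating sequences.\<close>

definition ext_form ::
    "'a measure \<Rightarrow> ('a \<Rightarrow> real) set \<Rightarrow> (('a \<Rightarrow> real) \<Rightarrow> ('a \<Rightarrow> real) \<Rightarrow> real) \<Rightarrow>
     ('a \<Rightarrow> real) \<Rightarrow> ('a \<Rightarrow> real) \<Rightarrow> real" where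
  "ext_form m D \<E> u v =
     (THE c. \<forall>us vs. approximating_seq m D \<E> us u \<longrightarrow> approximating_seq m D \<E> vs v \<longrightarrow>
               (\<lambda>n. \<E> (us n) (vs n)) \<longlonglongrightarrow> c)"


section \<open>Capacity and quasi-continuity\<close>

definition cap_open ::
    "'a measure \<Rightarrow> ('a \<Rightarrow> real) set \<Rightarrow> (('a \<Rightarrow> real) \<Rightarrow> ('a \<Rightarrow> real) \<Rightarrow> real) \<Rightarrow> 'a set \<Rightarrow> ennreal" where
  "cap_open m D \<E> U =
     (INF u\<in>{u \<in> D. AE x in m. indicator U x \<le> u x}. ennreal (\<E> u u))"

definition capacity ::
    "'a::topological_space measure \<Rightarrow> ('a \<Rightarrow> real) set \<Rightarrow>
     (('a \<Rightarrow> real) \<Rightarrow> ('a \<Rightarrow> real) \<Rightarrow> real) \<Rightarrow> 'a set \<Rightarrow> ennreal" where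
  "capacity m D \<E> B = (INF U\<in>{U. open U \<and> B \<subseteq> U}. cap_open m D \<E> U)"

definition quasi_continuous ::
    "'a::topological_space measure \<Rightarrow> ('a \<Rightarrow> real) set \<Rightarrow>
     (('a \<Rightarrow> real) \<Rightarrow> ('a \<Rightarrow> real) \<Rightarrow> real) \<Rightarrow> ('a \<Rightarrow> real) \<Rightarrow> bool" where
  "quasi_continuous m D \<E> u \<longleftrightarrow>
     (\<forall>e>0. \<exists>F. closed F \<and> capacity m D \<E> (- F) < ennreal e \<and> continuous_on F u)"

text \<open>Borel measurability is required so that the version can be integrated; every
  quasi-continuous function agrees with a Borel one off a set of zero capacity.\<close>

definition qc_version ::
    "'a::topological_space measure \<Rightarrow> ('a \<Rightarrow> real) set \<Rightarrow>
     (('a \<Rightarrow> real) \<Rightarrow> ('a \<Rightarrow> real) \<Rightarrow> real) \<Rightarrow> ('a \<Rightarrow> real) \<Rightarrow> ('a \<Rightarrow> real) \<Rightarrow> bool" where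
  "qc_version m D \<E> u u' \<longleftrightarrow>
     u' \<in> borel_measurable borel \<and> quasi_continuous m D \<E> u' \<and> (AE x in m. u x = u' x)"


section \<open>Bounded signed Borel measures\<close>

text \<open>A bounded signed measure is a real-valued countably additive set function on the Borel
  sets; its values on other sets are irrelevant.\<close>

definition bounded_signed_measures :: "('a::topological_space set \<Rightarrow> real) set" where
  "bounded_signed_measures =
     {\<mu>. \<forall>B::nat \<Rightarrow> 'a set. range B \<subseteq> sets borel \<longrightarrow> disjoint_family B \<longrightarrow>
           (\<lambda>i. \<mu> (B i)) sums \<mu> (\<Union>i. B i)}"

text \<open>The Jordan decomposition.  Negative values of \<open>\<mu> A\<close> are cut off at \<open>0 = \<mu> {}\<close> by \<open>ennreal\<close>.\<close>

definition pos_part :: "('a::topological_space set \<Rightarrow> real) \<Rightarrow> 'a measure" where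
  "pos_part \<mu> = measure_of UNIV (sets borel) (\<lambda>B. SUP A\<in>{A \<in> sets borel. A \<subseteq> B}. ennreal (\<mu> A))"

definition neg_part :: "('a::topological_space set \<Rightarrow> real) \<Rightarrow> 'a measure" where
  "neg_part \<mu> = pos_part (\<lambda>A. - \<mu> A)"

definition total_variation :: "('a::topological_space set \<Rightarrow> real) \<Rightarrow> 'a measure" where
  "total_variation \<mu> =
     measure_of UNIV (sets borel) (\<lambda>B. emeasure (pos_part \<mu>) B + emeasure (neg_part \<mu>) B)"

definition signed_integral :: "('a::topological_space set \<Rightarrow> real) \<Rightarrow> ('a \<Rightarrow> real) \<Rightarrow> real" where
  "signed_integral \<mu> \<eta> = (\<integral>x. \<eta> x \<partial>pos_part \<mu>) - (\<integral>x. \<eta> x \<partial>neg_part \<mu>)"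

definition smooth_measure ::
    "'a::topological_space measure \<Rightarrow> ('a \<Rightarrow> real) set \<Rightarrow>
     (('a \<Rightarrow> real) \<Rightarrow> ('a \<Rightarrow> real) \<Rightarrow> real) \<Rightarrow> ('a set \<Rightarrow> real) \<Rightarrow> bool" where
  "smooth_measure m D \<E> \<mu> \<longleftrightarrow>
     (\<forall>B\<in>sets borel. capacity m D \<E> B = 0 \<longrightarrow> emeasure (total_variation \<mu>) B = 0) \<and>
     (\<exists>\<eta>\<in>borel_measurable borel. quasi_continuous m D \<E> \<eta> \<and> (\<forall>x. \<eta> x > 0) \<and>
        (\<integral>\<^sup>+x. ennreal (\<eta> x) \<partial>total_variation \<mu>) < \<infinity>)"

definition bounded_smooth_measures ::
    "'a::topological_space measure \<Rightarrow> ('a \<Rightarrow> real) set \<Rightarrow>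
     (('a \<Rightarrow> real) \<Rightarrow> ('a \<Rightarrow> real) \<Rightarrow> real) \<Rightarrow> ('a set \<Rightarrow> real) set" where
  "bounded_smooth_measures m D \<E> = {\<mu> \<in> bounded_signed_measures. smooth_measure m D \<E> \<mu>}"

text \<open>\<open>\<mu> = \<mu>\<^sub>d + \<mu>\<^sub>c\<close>; given \<open>\<mu>\<close>, the two parts are uniquely determined on Borel sets.\<close>

definition diffuse_concentrated_decomposition ::
    "'a::topological_space measure \<Rightarrow> ('a \<Rightarrow> real) set \<Rightarrow>
     (('a \<Rightarrow> real) \<Rightarrow> ('a \<Rightarrow> real) \<Rightarrow> real) \<Rightarrow>
     ('a set \<Rightarrow> real) \<Rightarrow> ('a set \<Rightarrow> real) \<Rightarrow> ('a set \<Rightarrow> real) \<Rightarrow> bool" where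
  "diffuse_concentrated_decomposition m D \<E> \<mu> \<mu>d \<mu>c \<longleftrightarrow>
     \<mu>d \<in> bounded_smooth_measures m D \<E> \<and> \<mu>c \<in> bounded_signed_measures \<and>
     (\<forall>B\<in>sets borel. \<mu> B = \<mu>d B + \<mu>c B) \<and>
     (\<exists>N\<in>sets borel. capacity m D \<E> N = 0 \<and> emeasure (total_variation \<mu>c) (- N) = 0)"

definition narrow_limit ::
    "(real \<Rightarrow> 'a::topological_space set \<Rightarrow> real) \<Rightarrow> ('a set \<Rightarrow> real) \<Rightarrow> bool" where
  "narrow_limit \<nu> \<mu> \<longleftrightarrow>
     (\<forall>\<eta>\<in>bcontfun. ((\<lambda>k. signed_integral (\<nu> k) \<eta>) \<longlongrightarrow> signed_integral \<mu> \<eta>) at_top)"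


section \<open>Hunt processes\<close>

text \<open>The state space with cemetery is the one-point compactification, realised on
  \<open>'a option\<close> with \<open>\<partial> = None\<close>; the cemetery is isolated if \<open>E\<close> is compact.\<close>

abbreviation E_bdry :: "'a::topological_space option topology" where
  "E_bdry \<equiv> Alexandroff_compactification euclidean"

definition borel_bdry :: "'a::topological_space option measure" where
  "borel_bdry = sigma UNIV {U. openin E_bdry U}"

definition zero_ext :: "('a \<Rightarrow> 'b::zero) \<Rightarrow> 'a option \<Rightarrow> 'b" where
  "zero_ext h = case_option 0 h"

definition lifetime :: "(ennreal \<Rightarrow> 'w \<Rightarrow> 'a option) \<Rightarrow> 'w \<Rightarrow> ennreal" where
  "lifetime X \<omega> = Inf {t. X t \<omega> = None}"

text \<open>Time runs through \<open>[0,\<infinity>]\<close>, with \<open>X\<^sub>\<infinity> = \<partial>\<close>.  \<open>F\<close> is a right-continuous filtration on the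
  measurable space of \<open>M\<close> (the measure carried by \<open>M\<close> and by the \<open>F t\<close> plays no role).\<close>

definition hunt_process ::
    "'w measure \<Rightarrow> (ennreal \<Rightarrow> 'w measure) \<Rightarrow> (ennreal \<Rightarrow> 'w \<Rightarrow> 'a::topological_space option) \<Rightarrow>
     ('a option \<Rightarrow> 'w measure) \<Rightarrow> bool" where
  "hunt_process M F X P \<longleftrightarrow>
     filtration (space M) F \<and> (\<forall>t. sets (F t) \<subseteq> sets M) \<and>
     (\<forall>t<\<infinity>. sets (F t) = (\<Inter>s\<in>{t<..}. sets (F s))) \<and>
     (\<forall>t. X t \<in> F t \<rightarrow>\<^sub>M borel_bdry) \<and>
     (\<forall>x. prob_space (P x) \<and> sets (P x) = sets M) \<and>
     (\<forall>t. \<forall>B\<in>sets borel_bdry.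
        (\<lambda>x. measure (P x) {\<omega> \<in> space M. X t \<omega> \<in> B}) \<in> borel_measurable borel_bdry) \<and>
     \<comment> \<open>normality and the cemetery\<close>
     (\<forall>x. AE \<omega> in P x. X 0 \<omega> = x) \<and>
     (\<forall>t. AE \<omega> in P None. X t \<omega> = None) \<and>
     (\<forall>\<omega>\<in>space M. X \<infinity> \<omega> = None) \<and>
     (\<forall>\<omega>\<in>space M. \<forall>t\<ge>lifetime X \<omega>. X t \<omega> = None) \<and>
     \<comment> \<open>shift operators\<close>
     (\<exists>\<theta>. \<forall>t. \<forall>\<omega>\<in>space M. \<theta> t \<omega> \<in> space M \<and> (\<forall>s. X s (\<theta> t \<omega>) = X (s + t) \<omega>)) \<and>
     \<comment> \<open>sample paths are right continuous with left limits\<close>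
     (\<forall>\<omega>\<in>space M. \<forall>t<\<infinity>. limitin E_bdry (\<lambda>s. X s \<omega>) (X t \<omega>) (at_right t)) \<and>
     (\<forall>\<omega>\<in>space M. \<forall>t. 0 < t \<and> t < \<infinity> \<longrightarrow> (\<exists>l. limitin E_bdry (\<lambda>s. X s \<omega>) l (at_left t))) \<and>
     \<comment> \<open>strong Markov property\<close>
     (\<forall>x \<sigma> s. \<forall>B\<in>sets borel_bdry. stopping_time F \<sigma> \<longrightarrow>
        (AE \<omega> in P x.
           real_cond_exp (P x) (filtration.pre_sigma (space M) F \<sigma>)
             (indicator {\<omega> \<in> space M. X (\<sigma> \<omega> + s) \<omega> \<in> B}) \<omega> =
           measure (P (X (\<sigma> \<omega>) \<omega>)) {\<omega>' \<in> space M. X s \<omega>' \<in> B})) \<and>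
     \<comment> \<open>quasi-left-continuity\<close>
     (\<forall>x \<sigma>s. (\<forall>n::nat. stopping_time F (\<sigma>s n)) \<longrightarrow>
        (\<forall>\<omega>\<in>space M. mono (\<lambda>n. \<sigma>s n \<omega>)) \<longrightarrow>
        (AE \<omega> in P x. (SUP n. \<sigma>s n \<omega>) < \<infinity> \<longrightarrow>
           limitin E_bdry (\<lambda>n. X (\<sigma>s n \<omega>) \<omega>) (X (SUP n. \<sigma>s n \<omega>) \<omega>) sequentially))"

text \<open>\<open>E\<^sub>x h(X\<^sub>t)\<close> is an \<open>m\<close>-version of \<open>T\<^sub>t h\<close>, where \<open>T\<^sub>t = exp(t A)\<close> on \<open>L\<^sup>2(E;m)\<close>.\<close>

definition associated_process ::
    "'a::topological_space measure \<Rightarrow> ('a \<Rightarrow> real) set \<Rightarrow>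
     (('a \<Rightarrow> real) \<Rightarrow> ('a \<Rightarrow> real) \<Rightarrow> real) \<Rightarrow>
     (ennreal \<Rightarrow> 'w \<Rightarrow> 'a option) \<Rightarrow> ('a option \<Rightarrow> 'w measure) \<Rightarrow> bool" where
  "associated_process m D \<E> X P \<longleftrightarrow>
     (\<exists>T. generated_semigroup m (form_generator m D \<E>) T \<and>
        (\<forall>t>0. \<forall>h\<in>L2 m \<inter> bounded_borel.
           AE x in m. (\<integral>\<omega>. zero_ext h (X (ennreal t) \<omega>) \<partial>P (Some x)) = T t h x))"

definition absolute_continuity ::
    "'a::topological_space measure \<Rightarrow> (ennreal \<Rightarrow> 'w \<Rightarrow> 'a option) \<Rightarrow>
     ('a option \<Rightarrow> 'w measure) \<Rightarrow> bool" where
  "absolute_continuity m X P \<longleftrightarrow>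
     (\<exists>p :: real \<Rightarrow> 'a \<Rightarrow> 'a \<Rightarrow> ennreal.
        (\<lambda>(t, x, y). p t x y) \<in> borel_measurable borel \<and>
        (\<forall>t>0. \<forall>x y. p t x y = p t y x) \<and>
        (\<forall>s>0. \<forall>t>0. \<forall>x y. p (s + t) x y = (\<integral>\<^sup>+z. p s x z * p t z y \<partial>m)) \<and>
        (\<forall>t>0. \<forall>x. \<forall>h :: 'a \<Rightarrow> ennreal. h \<in> borel_measurable borel \<longrightarrow>
           (\<integral>\<^sup>+\<omega>. zero_ext h (X (ennreal t) \<omega>) \<partial>P (Some x)) = (\<integral>\<^sup>+y. h y * p t x y \<partial>m)))"

definition resolvent ::
    "(ennreal \<Rightarrow> 'w \<Rightarrow> 'a option) \<Rightarrow> ('a option \<Rightarrow> 'w measure) \<Rightarrow> real \<Rightarrow> ('a \<Rightarrow> real) \<Rightarrow> 'a \<Rightarrow> real" where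
  "resolvent X P \<alpha> h x =
     (\<integral>\<omega>. (LINT t:{t. 0 \<le> t \<and> ennreal t < lifetime X \<omega>}|lborel.
              exp (- \<alpha> * t) * zero_ext h (X (ennreal t) \<omega>)) \<partial>P (Some x))"


section \<open>Renormalized solutions\<close>

definition truncation :: "real \<Rightarrow> ('a \<Rightarrow> real) \<Rightarrow> 'a \<Rightarrow> real" where
  "truncation k u x = max (min (u x) k) (- k)"

text \<open>In \<open>\<langle>\<mu>\<^sub>d, \<eta>\<rangle>\<close> and \<open>\<langle>\<nu>\<^sub>k, \<eta>\<rangle>\<close> the quasi-continuous version \<open>\<eta>'\<close> of \<open>\<eta>\<close> is used.  Two such
  versions differ only on a set of zero capacity, which smooth measures do not charge.\<close>

definition renormalized_solution ::
    "'a::topological_space measure \<Rightarrow> ('a \<Rightarrow> real) set \<Rightarrow>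
     (('a \<Rightarrow> real) \<Rightarrow> ('a \<Rightarrow> real) \<Rightarrow> real) \<Rightarrow>
     ('a \<Rightarrow> real \<Rightarrow> real) \<Rightarrow> ('a set \<Rightarrow> real) \<Rightarrow> ('a \<Rightarrow> real) \<Rightarrow> bool" where
  "renormalized_solution m D \<E> f \<mu> u \<longleftrightarrow>
     u \<in> borel_measurable borel \<and>
     (\<forall>k\<ge>0. truncation k u \<in> ext_space m D \<E>) \<and>
     integrable m (\<lambda>x. f x (u x)) \<and>
     (\<exists>\<mu>d \<mu>c \<nu>.
        diffuse_concentrated_decomposition m D \<E> \<mu> \<mu>d \<mu>c \<and>
        (\<forall>k>0. \<nu> k \<in> bounded_smooth_measures m D \<E>) \<and>
        (\<forall>k>0. \<forall>\<eta>\<in>ext_space m D \<E> \<inter> bounded_borel. \<forall>\<eta>'. qc_version m D \<E> \<eta> \<eta>' \<longrightarrow>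
           ext_form m D \<E> (truncation k u) \<eta> =
             (\<integral>x. f x (u x) * \<eta> x \<partial>m) + signed_integral \<mu>d \<eta>' + signed_integral (\<nu> k) \<eta>') \<and>
        narrow_limit \<nu> \<mu>c)"

end

theory Submission
  imports Defs
begin

text \<open>
  Let \<open>u\<close> and \<open>v\<close> be two renormalized solutions, \<open>w = u - v\<close> and \<open>G = f(\<cdot>,u) - f(\<cdot>,v)\<close>. For a continuous
  bounded test function \<open>\<eta>\<close> the terms with \<open>\<mu>\<^sub>d\<close> and \<open>\<nu>\<^sub>k\<close> converge, by narrow convergence, to the integral
  of \<open>\<eta>\<close> against \<open>\<mu>\<close> (\<open>renormalized_limit\<close>), and this integral cancels in the difference of the two
  equations. If \<open>\<eta>\<close> is the potential of a density \<open>q\<close>, that is, \<open>\<E>(\<eta>,\<cdot>) = (q,\<cdot>)\<close>, what remains is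
  \<open>(w, q) = (G, \<eta>)\<close>, a weak form of \<open>- A w = G\<close>.

  Formally one now tests with the truncation \<open>\<phi> = T\<^sub>1 w\<close> to get \<open>\<E>(\<phi>,\<phi>) \<le> (G,\<phi>) \<le> 0\<close>, the sign coming from
  the monotonicity of \<open>f\<close>. This is made rigorous by choosing for \<open>\<eta>\<close> a regularisation \<open>\<psi>\<close> of \<open>\<phi>\<close>: the
  minimiser of \<open>\<E>(\<psi>,\<psi>) + \<beta> \<integral>\<rho> (\<psi> - \<phi>)\<^sup>2\<close> for a weight \<open>\<rho>\<close>. It is the potential of \<open>q = \<beta> \<rho> (\<phi> - \<psi>)\<close>, and by
  the Markov property \<open>\<bar>\<psi>\<bar> \<le> 1\<close>. Therefore \<open>(w - \<phi>) (\<phi> - \<psi>) \<ge> 0\<close> pointwise, and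
  \<open>\<E>(\<psi>,\<psi>) + \<beta> \<integral>\<rho> (\<phi> - \<psi>)\<^sup>2 = (\<phi>, q) \<le> (w, q) = (G, \<psi>)\<close> (\<open>truncation_estimate\<close>). As \<open>\<beta>\<close> tends to infinity
  the bounded right-hand side forces \<open>\<psi>\<close> to converge to \<open>\<phi>\<close>, the energy of \<open>\<psi>\<close> is asymptotically at
  most \<open>(G, \<phi>) \<le> 0\<close>, and transience gives \<open>\<phi> = 0\<close> (\<open>vanishing_criterion\<close>).

  The two parts of the theorem differ in why \<open>\<psi>\<close> may be used as a test function. If \<open>u\<close> and \<open>v\<close> are
  integrable, \<open>\<rho> = 1\<close> is chosen and \<open>\<psi>\<close> is an \<open>\<alpha>\<close>-resolvent of a bounded function. It is approximated by
  resolvents of continuous functions, which are continuous by assumption; integrability of \<open>w\<close> and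
  \<open>G\<close> allows the passage to the limit (\<open>difference_equation_integrable\<close>). In general \<open>\<rho>\<close> is supported
  where \<open>u\<close> and \<open>v\<close> are bounded by a level which tends to infinity with \<open>\<beta>\<close>, so that no integrability is
  needed for \<open>(w, q)\<close>, and \<open>\<psi>\<close> agrees almost everywhere with \<open>R\<^sub>\<alpha>(q + \<alpha> \<psi>)\<close>
  (\<open>potential_eq_process_resolvent\<close>), which is continuous by the strong Feller property.

  These arguments rest on two general facts. The first is that the extended form is well defined
  and is given by \<open>\<E>(w, R\<^sub>\<alpha> h) = (w, h - \<alpha> R\<^sub>\<alpha> h)\<close> for bounded \<open>w\<close> in the extended
  space and bounded integrable \<open>h\<close>
  (\<open>ext_form_limit\<close>, \<open>bounded_limit_resolvent\<close>). The second is that the resolvent of the process is that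
  of the form (\<open>process_resolvent_AE\<close>): the paths are jointly measurable by right continuity, and the
  Laplace transform of the semigroup is computed by integrating the derivative of
  \<open>t \<mapsto> exp(-\<alpha> t) (T\<^sub>t \<psi>, \<kappa>)\<close> for \<open>\<psi>\<close> in the domain of the generator.
\<close>


section \<open>Nonnegative symmetric forms\<close>

text \<open>The forms below are only positive semidefinite, and functions are not identified almost
  everywhere. The instances are the Dirichlet form, the inner product of \<open>L\<^sup>2\<close>, and sums of the two with
  weights.\<close>

locale nonneg_form =
  fixes V :: "('a \<Rightarrow> real) set" and Q :: "('a \<Rightarrow> real) \<Rightarrow> ('a \<Rightarrow> real) \<Rightarrow> real"
  assumes zero_mem: "(\<lambda>x. 0) \<in> V"
    and comb_mem: "u \<in> V \<Longrightarrow> v \<in> V \<Longrightarrow> (\<lambda>x. a * u x + b * v x) \<in> V"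
    and comb_left: "u \<in> V \<Longrightarrow> v \<in> V \<Longrightarrow> w \<in> V \<Longrightarrow>
                      Q (\<lambda>x. a * u x + b * v x) w = a * Q u w + b * Q v w"
    and sym: "u \<in> V \<Longrightarrow> v \<in> V \<Longrightarrow> Q u v = Q v u"
    and nonneg: "u \<in> V \<Longrightarrow> 0 \<le> Q u u"
begin

abbreviation dist_sq :: "('a \<Rightarrow> real) \<Rightarrow> ('a \<Rightarrow> real) \<Rightarrow> real" where
  "dist_sq u v \<equiv> Q (\<lambda>x. u x - v x) (\<lambda>x. u x - v x)"

lemma add_mem: "u \<in> V \<Longrightarrow> v \<in> V \<Longrightarrow> (\<lambda>x. u x + v x) \<in> V"
  using comb_mem[of u v 1 1] by simp

lemma diff_mem: "u \<in> V \<Longrightarrow> v \<in> V \<Longrightarrow> (\<lambda>x. u x - v x) \<in> V"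
  using comb_mem[of u v 1 "-1"] by simp

lemma scale_mem: "u \<in> V \<Longrightarrow> (\<lambda>x. a * u x) \<in> V"
  using comb_mem[of u u a 0] by simp

lemma add_left: "u \<in> V \<Longrightarrow> v \<in> V \<Longrightarrow> w \<in> V \<Longrightarrow> Q (\<lambda>x. u x + v x) w = Q u w + Q v w"
  using comb_left[of u v w 1 1] by simp

lemma diff_left: "u \<in> V \<Longrightarrow> v \<in> V \<Longrightarrow> w \<in> V \<Longrightarrow> Q (\<lambda>x. u x - v x) w = Q u w - Q v w"
  using comb_left[of u v w 1 "-1"] by simp

lemma scale_left: "u \<in> V \<Longrightarrow> w \<in> V \<Longrightarrow> Q (\<lambda>x. a * u x) w = a * Q u w"
  using comb_left[of u u w a 0] by simp

lemma add_right: "u \<in> V \<Longrightarrow> v \<in> V \<Longrightarrow> w \<in> V \<Longrightarrow> Q w (\<lambda>x. u x + v x) = Q w u + Q w v"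
  using add_left[of u v w] sym add_mem by simp

lemma diff_right: "u \<in> V \<Longrightarrow> v \<in> V \<Longrightarrow> w \<in> V \<Longrightarrow> Q w (\<lambda>x. u x - v x) = Q w u - Q w v"
  using diff_left[of u v w] sym diff_mem by simp

lemma scale_right: "u \<in> V \<Longrightarrow> w \<in> V \<Longrightarrow> Q w (\<lambda>x. a * u x) = a * Q w u"
  using scale_left[of u w a] sym scale_mem by simp

lemma quad_comb:
  assumes "u \<in> V" "v \<in> V"
  shows "Q (\<lambda>x. a * u x + b * v x) (\<lambda>x. a * u x + b * v x)
           = a\<^sup>2 * Q u u + 2 * a * b * Q u v + b\<^sup>2 * Q v v"
proof -
  have *: "(\<lambda>x. a * u x) \<in> V" "(\<lambda>x. b * v x) \<in> V" using assms scale_mem by auto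
  show ?thesis
    using assms * add_mem[OF *] sym[OF assms]
    by (simp add: add_left add_right scale_left scale_right power2_eq_square algebra_simps)
qed

lemma quad_diff:
  assumes "u \<in> V" "v \<in> V"
  shows "dist_sq u v = Q u u - 2 * Q u v + Q v v"
  using quad_comb[OF assms, of 1 "-1"] by simp

lemma quad_add:
  assumes "u \<in> V" "v \<in> V"
  shows "Q (\<lambda>x. u x + v x) (\<lambda>x. u x + v x) = Q u u + 2 * Q u v + Q v v"
  using quad_comb[OF assms, of 1 1] by simp

lemma cauchy_schwarz:
  assumes u: "u \<in> V" and v: "v \<in> V"
  shows "\<bar>Q u v\<bar> \<le> sqrt (Q u u) * sqrt (Q v v)"
proof -
  have quad: "0 \<le> t\<^sup>2 * Q u u + 2 * t * Q u v + Q v v" for t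
    using nonneg[OF comb_mem[OF u v, of t 1]] quad_comb[OF u v, of t 1] by simp
  have "(Q u v)\<^sup>2 \<le> Q u u * Q v v"
  proof (cases "Q u u = 0")
    case True
    have "Q u v = 0"
    proof (rule ccontr)
      assume n: "Q u v \<noteq> 0"
      have "0 \<le> 2 * (- (Q v v + 1) / (2 * Q u v)) * Q u v + Q v v"
        using quad[of "- (Q v v + 1) / (2 * Q u v)"] True by simp
      then show False using n by (simp add: field_simps)
    qed
    then show ?thesis using True by simp
  next
    case False
    then have p: "0 < Q u u" using nonneg[OF u] by simp
    have "(- Q u v / Q u u)\<^sup>2 * Q u u + 2 * (- Q u v / Q u u) * Q u v = - (Q u v)\<^sup>2 / Q u u"
      using p by (simp add: field_simps power2_eq_square)
    with quad[of "- Q u v / Q u u"] have "(Q u v)\<^sup>2 / Q u u \<le> Q v v" by simp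
    then show ?thesis using p by (simp add: field_simps)
  qed
  then have "sqrt ((Q u v)\<^sup>2) \<le> sqrt (Q u u * Q v v)" by (rule real_sqrt_le_mono)
  then show ?thesis by (simp add: real_sqrt_mult)
qed

lemma quad_add_le:
  assumes "u \<in> V" "v \<in> V"
  shows "Q (\<lambda>x. u x + v x) (\<lambda>x. u x + v x) \<le> 2 * Q u u + 2 * Q v v"
  using quad_add[OF assms] nonneg[OF diff_mem[OF assms]] quad_diff[OF assms] by simp

lemma quad_diff_le:
  assumes "u \<in> V" "v \<in> V"
  shows "dist_sq u v \<le> 2 * Q u u + 2 * Q v v"
  using quad_add[OF assms] nonneg[OF add_mem[OF assms]] quad_diff[OF assms] by simp

definition cauchy_seq :: "(nat \<Rightarrow> 'a \<Rightarrow> real) \<Rightarrow> bool" where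
  "cauchy_seq us \<longleftrightarrow> (\<forall>n. us n \<in> V) \<and>
     (\<forall>e>0. \<exists>N. \<forall>i\<ge>N. \<forall>j\<ge>N. dist_sq (us i) (us j) < e)"

lemma cauchy_seqD:
  assumes "cauchy_seq us" "e > 0"
  obtains N where "\<And>i j. i \<ge> N \<Longrightarrow> j \<ge> N \<Longrightarrow>
     sqrt (dist_sq (us i) (us j)) < e"
proof -
  have "e\<^sup>2 > 0" using assms by simp
  then obtain N where N: "\<forall>i\<ge>N. \<forall>j\<ge>N. dist_sq (us i) (us j) < e\<^sup>2"
    using assms(1) unfolding cauchy_seq_def by blast
  show ?thesis
  proof (rule that[of N])
    fix i j assume "i \<ge> N" "j \<ge> N"
    then have "sqrt (dist_sq (us i) (us j)) < sqrt (e\<^sup>2)"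
      using N by (intro real_sqrt_less_mono) auto
    then show "sqrt (dist_sq (us i) (us j)) < e"
      using assms by simp
  qed
qed

lemma cauchy_seq_mem: "cauchy_seq us \<Longrightarrow> us n \<in> V"
  by (simp add: cauchy_seq_def)

lemma cauchy_seq_diff:
  assumes us: "cauchy_seq us" and vs: "cauchy_seq vs"
  shows "cauchy_seq (\<lambda>n x. us n x - vs n x)"
  unfolding cauchy_seq_def
proof (intro conjI allI impI)
  show "(\<lambda>x. us n x - vs n x) \<in> V" for n
    using us vs by (intro diff_mem) (auto simp: cauchy_seq_def)
  fix e :: real assume "e > 0"
  then have e: "e / 4 > 0" by simp
  obtain N1 where N1: "\<forall>i\<ge>N1. \<forall>j\<ge>N1. dist_sq (us i) (us j) < e / 4"
    using us e unfolding cauchy_seq_def by blast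
  obtain N2 where N2: "\<forall>i\<ge>N2. \<forall>j\<ge>N2. dist_sq (vs i) (vs j) < e / 4"
    using vs e unfolding cauchy_seq_def by blast
  show "\<exists>N. \<forall>i\<ge>N. \<forall>j\<ge>N. Q (\<lambda>x. us i x - vs i x - (us j x - vs j x))
                 (\<lambda>x. us i x - vs i x - (us j x - vs j x)) < e"
  proof (intro exI[of _ "max N1 N2"] allI impI)
    fix i j assume ij: "i \<ge> max N1 N2" "j \<ge> max N1 N2"
    have mem: "(\<lambda>x. us i x - us j x) \<in> V" "(\<lambda>x. vs i x - vs j x) \<in> V"
      using us vs by (auto intro!: diff_mem simp: cauchy_seq_def)
    have eq: "(\<lambda>x. us i x - vs i x - (us j x - vs j x)) =
              (\<lambda>x. (us i x - us j x) - (vs i x - vs j x))" by auto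
    show "Q (\<lambda>x. us i x - vs i x - (us j x - vs j x))
            (\<lambda>x. us i x - vs i x - (us j x - vs j x)) < e"
      unfolding eq using quad_diff_le[OF mem] N1[rule_format, of i j] N2[rule_format, of i j] ij
      by simp
  qed
qed

lemma cauchy_seq_subseq:
  assumes us: "cauchy_seq us" and r: "strict_mono r"
  shows "cauchy_seq (\<lambda>n. us (r n))"
  unfolding cauchy_seq_def
proof (intro conjI allI impI)
  show "us (r n) \<in> V" for n using us by (simp add: cauchy_seq_def)
  fix e :: real assume "e > 0"
  then obtain N where N: "\<forall>i\<ge>N. \<forall>j\<ge>N. dist_sq (us i) (us j) < e"
    using us unfolding cauchy_seq_def by blast
  have "n \<le> r n" for n using r by (rule seq_suble)
  then show "\<exists>N. \<forall>i\<ge>N. \<forall>j\<ge>N. dist_sq (us (r i)) (us (r j)) < e"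
    using N by (meson le_trans)
qed

lemma cauchy_seq_bounded:
  assumes us: "cauchy_seq us"
  obtains B where "B > 0" "\<And>n. sqrt (Q (us n) (us n)) \<le> B"
proof -
  have "(1::real) > 0" by simp
  then obtain N where N: "\<forall>i\<ge>N. \<forall>j\<ge>N. dist_sq (us i) (us j) < 1"
    using us unfolding cauchy_seq_def by blast
  have mem: "us n \<in> V" for n using us by (simp add: cauchy_seq_def)
  define S where "S = (\<Sum>i\<le>N. Q (us i) (us i))"
  have S: "Q (us n) (us n) \<le> 2 + 2 * S" for n
  proof (cases "n \<le> N")
    case True
    then have "Q (us n) (us n) \<le> S" unfolding S_def
      by (intro member_le_sum) (auto intro: nonneg mem)
    moreover have "0 \<le> Q (us n) (us n)" by (intro nonneg mem)
    ultimately show ?thesis by simp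
  next
    case False
    have "Q (us N) (us N) \<le> S" unfolding S_def
      by (intro member_le_sum) (auto intro: nonneg mem)
    moreover have "Q (us n) (us n) \<le> 2 * dist_sq (us n) (us N) + 2 * Q (us N) (us N)"
      using quad_add_le[OF diff_mem[OF mem mem] mem, of n N N] by simp
    moreover have "dist_sq (us n) (us N) < 1"
      using N False by simp
    ultimately show ?thesis by simp
  qed
  have "0 \<le> S" unfolding S_def by (intro sum_nonneg nonneg mem)
  then have "sqrt (2 + 2 * S) > 0" by simp
  then show ?thesis using that[of "sqrt (2 + 2 * S)"] S real_sqrt_le_mono by blast
qed

lemma cauchy_seq_pair_convergent:
  assumes us: "cauchy_seq us" and vs: "cauchy_seq vs"
  shows "convergent (\<lambda>n. Q (us n) (vs n))"
proof -
  have mu: "us n \<in> V" and mv: "vs n \<in> V" for n using us vs by (auto dest: cauchy_seq_mem)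
  obtain B where B: "B > 0" "\<And>n. sqrt (Q (vs n) (vs n)) \<le> B"
    using cauchy_seq_bounded[OF vs] by blast
  obtain B' where B': "B' > 0" "\<And>n. sqrt (Q (us n) (us n)) \<le> B'"
    using cauchy_seq_bounded[OF us] by blast
  have "Cauchy (\<lambda>n. Q (us n) (vs n))"
  proof (rule CauchyI)
    fix e :: real assume e: "0 < e"
    then have pos: "e / (2 * B) > 0" "e / (2 * B') > 0" using B B' by auto
    obtain N1 where N1: "\<And>i j. i \<ge> N1 \<Longrightarrow> j \<ge> N1 \<Longrightarrow>
         sqrt (dist_sq (us i) (us j)) < e / (2 * B)"
      using cauchy_seqD[OF us pos(1)] by blast
    obtain N2 where N2: "\<And>i j. i \<ge> N2 \<Longrightarrow> j \<ge> N2 \<Longrightarrow>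
         sqrt (dist_sq (vs i) (vs j)) < e / (2 * B')"
      using cauchy_seqD[OF vs pos(2)] by blast
    show "\<exists>M. \<forall>i\<ge>M. \<forall>j\<ge>M. norm (Q (us i) (vs i) - Q (us j) (vs j)) < e"
    proof (intro exI[of _ "max N1 N2"] allI impI)
      fix i j assume ij: "i \<ge> max N1 N2" "j \<ge> max N1 N2"
      have "\<bar>Q (\<lambda>x. us i x - us j x) (vs i)\<bar>
           \<le> sqrt (dist_sq (us i) (us j)) * sqrt (Q (vs i) (vs i))"
        by (intro cauchy_schwarz diff_mem mu mv)
      also have "\<dots> \<le> sqrt (dist_sq (us i) (us j)) * B"
        by (intro mult_left_mono B) (auto intro: nonneg diff_mem mu)
      also have "\<dots> < e / (2 * B) * B"
        using N1[of i j] ij B by (intro mult_strict_right_mono) auto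
      finally have 1: "\<bar>Q (\<lambda>x. us i x - us j x) (vs i)\<bar> < e / 2" using B by simp
      have "\<bar>Q (us j) (\<lambda>x. vs i x - vs j x)\<bar>
           \<le> sqrt (Q (us j) (us j)) * sqrt (dist_sq (vs i) (vs j))"
        by (intro cauchy_schwarz diff_mem mu mv)
      also have "\<dots> \<le> B' * sqrt (dist_sq (vs i) (vs j))"
        by (intro mult_right_mono B') (auto intro: nonneg diff_mem mv)
      also have "\<dots> < B' * (e / (2 * B'))"
        using N2[of i j] ij B' by (intro mult_strict_left_mono) auto
      finally have 2: "\<bar>Q (us j) (\<lambda>x. vs i x - vs j x)\<bar> < e / 2" using B' by simp
      have "Q (us i) (vs i) - Q (us j) (vs j)
          = Q (\<lambda>x. us i x - us j x) (vs i) + Q (us j) (\<lambda>x. vs i x - vs j x)"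
        using mu mv by (simp add: diff_left diff_right)
      with 1 2 show "norm (Q (us i) (vs i) - Q (us j) (vs j)) < e" by simp
    qed
  qed
  then show ?thesis by (simp add: Cauchy_convergent_iff)
qed

lemma const_cauchy_seq: "v \<in> V \<Longrightarrow> cauchy_seq (\<lambda>n. v)"
  using scale_left[of v v 0] scale_left[of v "\<lambda>x. 0" 0] zero_mem by (simp add: cauchy_seq_def)

text \<open>This evaluates the extended form at a function which is given only by a Cauchy sequence \<open>vs\<close> and
  the limits of \<open>Q (vs n)\<close> against fixed elements.\<close>

lemma cauchy_seq_diagonal_limit:
  assumes us: "cauchy_seq us" and vs: "cauchy_seq vs"
    and lim: "\<And>v. v \<in> V \<Longrightarrow> (\<lambda>n. Q (vs n) v) \<longlonglongrightarrow> L v"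
    and l: "(\<lambda>j. L (us j)) \<longlonglongrightarrow> c"
  shows "(\<lambda>n. Q (us n) (vs n)) \<longlonglongrightarrow> c"
proof (rule LIMSEQ_I)
  fix e :: real assume e: "0 < e"
  obtain B where B: "B > 0" "\<And>n. sqrt (Q (vs n) (vs n)) \<le> B"
    using cauchy_seq_bounded[OF vs] by blast
  obtain B' where B': "B' > 0" "\<And>n. sqrt (Q (us n) (us n)) \<le> B'"
    using cauchy_seq_bounded[OF us] by blast
  have mu: "us n \<in> V" for n using us by (rule cauchy_seq_mem)
  have mv: "vs n \<in> V" for n using vs by (rule cauchy_seq_mem)
  have "e / (4 * B) > 0" using e B by simp
  then obtain N1 where N1: "\<And>i j. i \<ge> N1 \<Longrightarrow> j \<ge> N1 \<Longrightarrow>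
     sqrt (dist_sq (us i) (us j)) < e / (4 * B)"
    using cauchy_seqD[OF us] by blast
  have "e / (4 * B') > 0" using e B' by simp
  then obtain N2 where N2: "\<And>i j. i \<ge> N2 \<Longrightarrow> j \<ge> N2 \<Longrightarrow>
     sqrt (dist_sq (vs i) (vs j)) < e / (4 * B')"
    using cauchy_seqD[OF vs] by blast
  have "e / 4 > 0" using e by simp
  then obtain N3 where N3: "\<And>j. j \<ge> N3 \<Longrightarrow> \<bar>L (us j) - c\<bar> < e / 4"
    using LIMSEQ_D[OF l] by (metis real_norm_def)
  define k where "k = max N1 (max N2 N3)"
  obtain N4 where N4: "\<And>n. n \<ge> N4 \<Longrightarrow> \<bar>Q (vs n) (us k) - L (us k)\<bar> < e / 4"
    using LIMSEQ_D[OF lim[OF mu[of k]] \<open>e / 4 > 0\<close>] by (metis real_norm_def)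
  define n0 where "n0 = max k N4"
  show "\<exists>no. \<forall>n\<ge>no. norm (Q (us n) (vs n) - c) < e"
  proof (intro exI[of _ k] allI impI)
    fix n assume n: "n \<ge> k"
    have 1: "\<bar>Q (us n) (vs n) - Q (us k) (vs n)\<bar> \<le> e / 4"
    proof -
      have "Q (us n) (vs n) - Q (us k) (vs n) = Q (\<lambda>x. us n x - us k x) (vs n)"
        using mu mv by (simp add: diff_left)
      also have "\<bar>\<dots>\<bar> \<le> sqrt (dist_sq (us n) (us k)) * sqrt (Q (vs n) (vs n))"
        by (intro cauchy_schwarz diff_mem mu mv)
      also have "\<dots> \<le> e / (4 * B) * B"
        using less_imp_le[OF N1[of n k]] n B e nonneg[OF mv, of n]
        by (intro mult_mono) (auto simp: k_def)
      finally show ?thesis using B by simp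
    qed
    have 2: "\<bar>Q (us k) (vs n) - Q (us k) (vs n0)\<bar> \<le> e / 4"
    proof -
      have "Q (us k) (vs n) - Q (us k) (vs n0) = Q (us k) (\<lambda>x. vs n x - vs n0 x)"
        using mu mv by (simp add: diff_right)
      also have "\<bar>\<dots>\<bar> \<le> sqrt (Q (us k) (us k)) * sqrt (dist_sq (vs n) (vs n0))"
        by (intro cauchy_schwarz diff_mem mu mv)
      also have "\<dots> \<le> B' * (e / (4 * B'))"
        using less_imp_le[OF N2[of n n0]] n B' e nonneg[OF diff_mem[OF mv mv], of n n0]
        by (intro mult_mono) (auto simp: k_def n0_def le_max_iff_disj)
      finally show ?thesis using B' by simp
    qed
    have 3: "\<bar>Q (us k) (vs n0) - L (us k)\<bar> < e / 4"
      using N4[of n0] sym[OF mu mv] by (simp add: n0_def)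
    have 4: "\<bar>L (us k) - c\<bar> < e / 4" using N3[of k] by (simp add: k_def)
    show "norm (Q (us n) (vs n) - c) < e" using 1 2 3 4 unfolding real_norm_def by linarith
  qed
qed

text \<open>A substitute for the Riesz representation theorem in a space that is not complete: the
  minimiser of \<open>Q v v - 2 L v\<close> is replaced by a minimising sequence, which is Cauchy by the
  parallelogram law. The constraint \<open>R\<close>, which can be met without raising the functional, will be a
  pointwise bound.\<close>

lemma minimizing_sequence:
  fixes L :: "('a \<Rightarrow> real) \<Rightarrow> real"
  defines "J \<equiv> \<lambda>v. Q v v - 2 * L v"
  assumes lin: "\<And>u v a b. u \<in> V \<Longrightarrow> v \<in> V \<Longrightarrow> L (\<lambda>x. a * u x + b * v x) = a * L u + b * L v"
    and below: "\<And>v. v \<in> V \<Longrightarrow> B \<le> Q v v - 2 * L v"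
    and improve: "\<And>v. v \<in> V \<Longrightarrow> \<exists>v'\<in>V. R v' \<and> Q v' v' - 2 * L v' \<le> Q v v - 2 * L v"
  obtains vs where "cauchy_seq vs" "\<And>n. R (vs n)"
    "\<And>v. v \<in> V \<Longrightarrow> (\<lambda>n. Q (vs n) v) \<longlonglongrightarrow> L v"
proof -
  define I where "I = Inf (J ` V)"
  have bdd: "bdd_below (J ` V)" using below by (auto simp: J_def intro!: bdd_belowI)
  have I_le: "I \<le> J v" if "v \<in> V" for v
    unfolding I_def using that bdd by (intro cInf_lower) auto
  have "\<exists>v. v \<in> V \<and> R v \<and> J v < I + 1 / real (Suc n)" for n
  proof -
    have "Inf (J ` V) < I + 1 / real (Suc n)" unfolding I_def[symmetric] by simp
    then obtain v where v: "v \<in> V" "J v < I + 1 / real (Suc n)"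
      using cInf_lessD[of "J ` V"] zero_mem by blast
    with improve[OF v(1)] obtain v' where "v' \<in> V" "R v'" "J v' \<le> J v"
      by (auto simp: J_def)
    with v show ?thesis by (intro exI[of _ v']) auto
  qed
  then obtain vs where vs: "\<And>n. vs n \<in> V" "\<And>n. R (vs n)"
      "\<And>n. J (vs n) < I + 1 / real (Suc n)" by metis
  have J_comb: "J (\<lambda>x. a * u x + b * v x) =
      a\<^sup>2 * Q u u + 2 * a * b * Q u v + b\<^sup>2 * Q v v - 2 * (a * L u + b * L v)"
    if "u \<in> V" "v \<in> V" for u v a b
    unfolding J_def quad_comb[OF that] lin[OF that] ..
  show ?thesis
  proof (rule that)
    show "R (vs n)" for n by (rule vs)
    have near: "dist_sq (vs i) (vs j)
             \<le> 2 * (1 / real (Suc i)) + 2 * (1 / real (Suc j))" for i j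
    proof -
      have "I \<le> J (\<lambda>x. (1/2) * vs i x + (1/2) * vs j x)" by (intro I_le comb_mem vs)
      then have "4 * I \<le> Q (vs i) (vs i) + 2 * Q (vs i) (vs j) + Q (vs j) (vs j)
                   - 4 * (L (vs i) + L (vs j))"
        unfolding J_comb[OF vs(1) vs(1)] by (simp add: power2_eq_square)
      then show ?thesis
        using vs(3)[of i] vs(3)[of j] unfolding quad_diff[OF vs(1) vs(1)] J_def
        by argo
    qed
    show "cauchy_seq vs" unfolding cauchy_seq_def
    proof (intro conjI allI impI)
      show "vs n \<in> V" for n by (rule vs)
      fix e :: real assume e: "e > 0"
      then obtain N where N: "1 / real (Suc N) < e / 4"
        using nat_approx_posE[of "e/4"] by (auto simp: field_simps)
      show "\<exists>N. \<forall>i\<ge>N. \<forall>j\<ge>N. dist_sq (vs i) (vs j) < e"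
      proof (intro exI[of _ N] allI impI)
        fix i j assume "i \<ge> N" "j \<ge> N"
        then have "1 / real (Suc i) \<le> 1 / real (Suc N)" "1 / real (Suc j) \<le> 1 / real (Suc N)"
          by (auto simp: field_simps)
        with near[of i j] N show "dist_sq (vs i) (vs j) < e"
          by linarith
      qed
    qed
    fix v assume v: "v \<in> V"
    define t where "t = (\<lambda>n. sqrt (1 / real (Suc n)))"
    have t0: "t n > 0" for n by (simp add: t_def)
    have t2: "(t n)\<^sup>2 = 1 / real (Suc n)" for n by (simp add: t_def)
    have est: "\<bar>Q (vs n) v - L v\<bar> \<le> t n * ((Q v v + 1) / 2)" for n
    proof -
      have *: "0 \<le> 2 * s * (Q (vs n) v - L v) + s\<^sup>2 * Q v v + (t n)\<^sup>2" for s
      proof -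
        have "I \<le> J (\<lambda>x. 1 * vs n x + s * v x)" by (intro I_le comb_mem vs v)
        then have "I \<le> Q (vs n) (vs n) + 2 * s * Q (vs n) v + s\<^sup>2 * Q v v - 2 * (L (vs n) + s * L v)"
          unfolding J_comb[OF vs(1) v] by simp
        then show ?thesis using vs(3)[of n] unfolding J_def t2 by (simp add: algebra_simps)
      qed
      have "t n * (- 2 * (Q (vs n) v - L v)) \<le> t n * (t n * (Q v v + 1))"
        using *[of "t n"] by (simp add: algebra_simps power2_eq_square)
      moreover have "t n * (2 * (Q (vs n) v - L v)) \<le> t n * (t n * (Q v v + 1))"
        using *[of "- t n"] by (simp add: algebra_simps power2_eq_square)
      ultimately have "- 2 * (Q (vs n) v - L v) \<le> t n * (Q v v + 1)"
          "2 * (Q (vs n) v - L v) \<le> t n * (Q v v + 1)"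
        using t0[of n] by (auto simp: mult_le_cancel_left_pos simp del: mult_minus_left)
      then show ?thesis by (simp add: abs_if)
    qed
    have "(\<lambda>n. 1 / real (Suc n)) \<longlonglongrightarrow> 0" using LIMSEQ_inverse_real_of_nat by (simp add: inverse_eq_divide)
    then have "t \<longlonglongrightarrow> sqrt 0" unfolding t_def by (intro tendsto_real_sqrt)
    then have "(\<lambda>n. t n * ((Q v v + 1) / 2)) \<longlonglongrightarrow> 0" by (auto intro!: tendsto_mult_left_zero)
    then have "(\<lambda>n. Q (vs n) v - L v) \<longlonglongrightarrow> 0"
      by (rule Lim_null_comparison[rotated]) (use est in auto)
    then show "(\<lambda>n. Q (vs n) v) \<longlonglongrightarrow> L v" by (simp add: LIM_zero_iff)
  qed
qed

end


section \<open>Square-integrable functions\<close>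

lemma L2_I: "u \<in> borel_measurable m \<Longrightarrow> integrable m (\<lambda>x. (u x)\<^sup>2) \<Longrightarrow> u \<in> L2 m"
  by (simp add: L2_def)

lemma L2_measurable [measurable_dest]: "u \<in> L2 m \<Longrightarrow> u \<in> borel_measurable m"
  by (simp add: L2_def)

lemma L2_integrable_square: "u \<in> L2 m \<Longrightarrow> integrable m (\<lambda>x. (u x)\<^sup>2)"
  by (simp add: L2_def)

lemma abs_mult_le_squares: "\<bar>a * b\<bar> \<le> a\<^sup>2 + (b::real)\<^sup>2"
proof -
  have "0 \<le> (\<bar>a\<bar> - \<bar>b\<bar>)\<^sup>2" by simp
  then have "2 * (\<bar>a\<bar> * \<bar>b\<bar>) \<le> a\<^sup>2 + b\<^sup>2" by (simp add: power2_diff)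
  then show ?thesis by (simp add: abs_mult) (smt (verit) mult_nonneg_nonneg abs_ge_zero)
qed

lemma L2_dominated:
  assumes "v \<in> L2 m" "u \<in> borel_measurable m" "AE x in m. \<bar>u x\<bar> \<le> \<bar>v x\<bar>"
  shows "u \<in> L2 m"
proof (rule L2_I)
  note [measurable] = assms(2) L2_measurable[OF assms(1)]
  show "u \<in> borel_measurable m" by fact
  show "integrable m (\<lambda>x. (u x)\<^sup>2)"
    by (rule Bochner_Integration.integrable_bound[OF L2_integrable_square[OF assms(1)]])
       (use assms(3) in \<open>auto simp: abs_le_square_iff\<close>)
qed

lemma L2_bounded_integrable:
  assumes "integrable m h" "\<And>x. \<bar>h x\<bar> \<le> K"
  shows "h \<in> L2 m"
proof (rule L2_I)
  have [measurable]: "h \<in> borel_measurable m" using assms(1) by auto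
  then show "h \<in> borel_measurable m" .
  have K: "0 \<le> K" using assms(2)[of undefined] by linarith
  show "integrable m (\<lambda>x. (h x)\<^sup>2)"
  proof (rule Bochner_Integration.integrable_bound[of m "\<lambda>x. K * h x"])
    show "integrable m (\<lambda>x. K * h x)" using assms by simp
    have "(h x)\<^sup>2 \<le> K * \<bar>h x\<bar>" for x
      using mult_right_mono[OF assms(2)[of x] abs_ge_zero[of "h x"]]
      by (simp add: power2_eq_square flip: abs_mult)
    then show "AE x in m. norm ((h x)\<^sup>2) \<le> norm (K * h x)" using K by (auto simp: abs_mult)
  qed simp
qed

lemma L2_mult_integrable:
  assumes "u \<in> L2 m" "v \<in> L2 m"
  shows "integrable m (\<lambda>x. u x * v x)"
proof (rule Bochner_Integration.integrable_bound)
  note [measurable] = assms[THEN L2_measurable]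
  show "integrable m (\<lambda>x. (u x)\<^sup>2 + (v x)\<^sup>2)"
    using assms by (intro Bochner_Integration.integrable_add L2_integrable_square)
  show "AE x in m. norm (u x * v x) \<le> norm ((u x)\<^sup>2 + (v x)\<^sup>2)"
    using abs_mult_le_squares[of "u _" "v _"] by (auto intro: order_trans)
qed (use assms in measurable)

lemma L2_comb:
  assumes "u \<in> L2 m" "v \<in> L2 m"
  shows "(\<lambda>x. a * u x + b * v x) \<in> L2 m"
proof (rule L2_I)
  note [measurable] = assms[THEN L2_measurable]
  show "(\<lambda>x. a * u x + b * v x) \<in> borel_measurable m" by measurable
  have "integrable m (\<lambda>x. a\<^sup>2 * (u x)\<^sup>2 + 2 * a * b * (u x * v x) + b\<^sup>2 * (v x)\<^sup>2)"
    using assms by (intro Bochner_Integration.integrable_add integrable_mult_right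
        L2_integrable_square L2_mult_integrable)
  moreover have "(a * u x + b * v x)\<^sup>2 = a\<^sup>2 * (u x)\<^sup>2 + 2 * a * b * (u x * v x) + b\<^sup>2 * (v x)\<^sup>2" for x
    by (simp add: power2_eq_square algebra_simps)
  ultimately show "integrable m (\<lambda>x. (a * u x + b * v x)\<^sup>2)" by simp
qed

lemma L2_zero: "(\<lambda>x. 0) \<in> L2 m"
  by (simp add: L2_def)

interpretation l2: nonneg_form "L2 m" "l2_inner m" for m
proof
  fix u v w :: "'a \<Rightarrow> real" and a b :: real
  assume u: "u \<in> L2 m" and v: "v \<in> L2 m" and w: "w \<in> L2 m"
  have "l2_inner m (\<lambda>x. a * u x + b * v x) w = (\<integral>x. a * (u x * w x) + b * (v x * w x) \<partial>m)"
    unfolding l2_inner_def by (simp add: algebra_simps)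
  also have "\<dots> = a * l2_inner m u w + b * l2_inner m v w"
    unfolding l2_inner_def using L2_mult_integrable[OF u w] L2_mult_integrable[OF v w] by simp
  finally show "l2_inner m (\<lambda>x. a * u x + b * v x) w = a * l2_inner m u w + b * l2_inner m v w" .
qed (auto simp: L2_zero L2_comb l2_inner_def mult.commute intro!: integral_nonneg_AE)

lemma l2_null:
  assumes "u \<in> L2 m" "l2_inner m u u \<le> 0"
  shows "AE x in m. u x = 0"
proof -
  have "l2_inner m u u = 0" using assms l2.nonneg[of u m] by simp
  then have "(\<integral>x. (u x)\<^sup>2 \<partial>m) = 0" by (simp add: l2_inner_def power2_eq_square)
  then have "AE x in m. (u x)\<^sup>2 = 0"
    by (subst (asm) integral_nonneg_eq_0_iff_AE) (auto intro: L2_integrable_square assms)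
  then show ?thesis by simp
qed

lemma l2_tendsto_zero_AE_subseq:
  assumes u: "\<And>n. u n \<in> L2 m" and lim: "(\<lambda>n. l2_inner m (u n) (u n)) \<longlonglongrightarrow> 0"
  obtains r where "strict_mono r" "AE x in m. (\<lambda>n. u (r n) x) \<longlonglongrightarrow> 0"
proof -
  have "\<exists>r::nat\<Rightarrow>nat. strict_mono r \<and> (AE x in m. (\<lambda>n. (u (r n) x)\<^sup>2) \<longlonglongrightarrow> 0)"
    by (rule tendsto_L1_AE_subseq)
       (use u lim in \<open>auto simp: l2_inner_def power2_eq_square intro: L2_mult_integrable\<close>)
  then obtain r where r: "strict_mono r" "AE x in m. (\<lambda>n. (u (r n) x)\<^sup>2) \<longlonglongrightarrow> 0" by blast
  have "AE x in m. (\<lambda>n. u (r n) x) \<longlonglongrightarrow> 0"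
    using r(2)
  proof eventually_elim
    case (elim x)
    then have "(\<lambda>n. sqrt ((u (r n) x)\<^sup>2)) \<longlonglongrightarrow> sqrt 0" by (intro tendsto_real_sqrt)
    then show ?case by (simp add: tendsto_rabs_zero_iff)
  qed
  with r(1) show ?thesis by (rule that)
qed

section \<open>Cut-offs in Dirichlet spaces\<close>

locale dirichlet_space = sigma_finite_measure m for m :: "'a measure" +
  fixes D :: "('a \<Rightarrow> real) set" and \<E> :: "('a \<Rightarrow> real) \<Rightarrow> ('a \<Rightarrow> real) \<Rightarrow> real"
  assumes dirichlet: "symmetric_dirichlet_form m D \<E>"
begin

lemma symmetric: "symmetric_form m D \<E>" and closed: "closed_form m D \<E>"
  and markov: "markovian_form D \<E>"
  using dirichlet by (auto simp: symmetric_dirichlet_form_def)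

sublocale form: nonneg_form D \<E>
  using symmetric unfolding symmetric_form_def by unfold_locales auto

lemma D_L2: "u \<in> D \<Longrightarrow> u \<in> L2 m"
  using symmetric unfolding symmetric_form_def by auto

lemma D_measurable: "u \<in> D \<Longrightarrow> u \<in> borel_measurable m"
  using D_L2 L2_measurable by blast

lemma D_AE_cong:
  assumes "u \<in> D" "v \<in> borel_measurable m" "AE x in m. u x = v x"
  shows "v \<in> D" "w \<in> D \<Longrightarrow> \<E> u w = \<E> v w" "w \<in> D \<Longrightarrow> \<E> w u = \<E> w v"
proof -
  have *: "v \<in> D \<and> (\<forall>w\<in>D. \<E> u w = \<E> v w)"
    using symmetric assms unfolding symmetric_form_def by blast
  then show "v \<in> D" "w \<in> D \<Longrightarrow> \<E> u w = \<E> v w" by auto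
  then show "w \<in> D \<Longrightarrow> \<E> w u = \<E> w v" using form.sym assms(1) by metis
qed

lemma clamp:
  assumes u: "u \<in> D" and K: "K > 0"
  shows "(\<lambda>x. min (max (u x) 0) K) \<in> D"
    "\<E> (\<lambda>x. min (max (u x) 0) K) (\<lambda>x. min (max (u x) 0) K) \<le> \<E> u u"
proof -
  define v where "v = (\<lambda>x. (1/K) * u x)"
  define z where "z = (\<lambda>x. min (max (v x) 0) 1)"
  have v: "v \<in> D" unfolding v_def by (intro form.scale_mem u)
  have z: "z \<in> D" "\<E> z z \<le> \<E> v v"
    using markov v unfolding markovian_form_def z_def by auto
  have eq: "(\<lambda>x. min (max (u x) 0) K) = (\<lambda>x. K * z x)"
    using K by (auto simp: z_def v_def min_def max_def field_simps)
  show "(\<lambda>x. min (max (u x) 0) K) \<in> D" unfolding eq by (intro form.scale_mem z)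
  have "\<E> (\<lambda>x. K * z x) (\<lambda>x. K * z x) = K\<^sup>2 * \<E> z z"
    using z by (simp add: form.scale_left form.scale_right form.scale_mem power2_eq_square)
  also have "\<dots> \<le> K\<^sup>2 * \<E> v v" using z by (intro mult_left_mono) auto
  also have "\<E> v v = (1/K)\<^sup>2 * \<E> u u" unfolding v_def
    using form.scale_left[OF u form.scale_mem[OF u], of "1/K" "1/K"] form.scale_right[OF u u, of "1/K"]
    by (simp add: power2_eq_square)
  finally show "\<E> (\<lambda>x. min (max (u x) 0) K) (\<lambda>x. min (max (u x) 0) K) \<le> \<E> u u"
    unfolding eq using K by (simp add: field_simps)
qed

text \<open>Since \<open>a\<close> is the cut-off at \<open>0\<close> and \<open>K\<close> of every \<open>a + s r\<close>, the energy of \<open>a + s r\<close> is smallest at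
  \<open>s = 0\<close>.\<close>

lemma energy_cut_direction:
  assumes a: "a \<in> D" and r: "r \<in> D" and K: "0 < K"
    and cut: "\<And>s x. 0 \<le> s \<Longrightarrow> min (max (a x + s * r x) 0) K = a x"
  shows "0 \<le> \<E> a r"
proof (rule ccontr)
  assume "\<not> 0 \<le> \<E> a r"
  then have neg: "\<E> a r < 0" by simp
  define s where "s = - \<E> a r / (\<E> r r + 1)"
  have rr: "0 \<le> \<E> r r" using r by (rule form.nonneg)
  then have s: "0 < s" unfolding s_def using neg by (intro divide_pos_pos) auto
  have m: "(\<lambda>x. 1 * a x + s * r x) \<in> D" by (intro form.comb_mem a r)
  have "\<E> a a \<le> \<E> (\<lambda>x. 1 * a x + s * r x) (\<lambda>x. 1 * a x + s * r x)"
    using clamp(2)[OF m K] cut[of s] s by simp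
  then have "0 \<le> s * (2 * \<E> a r + s * \<E> r r)"
    unfolding form.quad_comb[OF a r] by (simp add: power2_eq_square algebra_simps)
  then have "0 \<le> 2 * \<E> a r + s * \<E> r r" using s by (simp add: zero_le_mult_iff)
  moreover have "s * \<E> r r \<le> - \<E> a r"
  proof -
    have "s * \<E> r r \<le> s * (\<E> r r + 1)" using s by simp
    also have "\<dots> = - \<E> a r" using rr by (simp add: s_def)
    finally show ?thesis .
  qed
  ultimately show False using neg by simp
qed

text \<open>The Markov property concerns the cut-off at \<open>0\<close> and at one positive level. The two-sided cut-off
  \<open>z\<close> is a difference of two such functions \<open>a\<close> and \<open>b\<close>; what has been cut off, \<open>r = u - z\<close>, is positive
  only where \<open>a\<close> is maximal and negative only where \<open>b\<close> is, whence \<open>\<E> z r \<ge> 0\<close>.\<close>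

lemma cut:
  assumes u: "u \<in> D" and L: "0 \<le> L" and K: "0 \<le> K"
  shows "(\<lambda>x. max (min (u x) K) (- L)) \<in> D"
    "\<E> (\<lambda>x. max (min (u x) K) (- L)) (\<lambda>x. max (min (u x) K) (- L)) \<le> \<E> u u"
proof -
  have nu: "(\<lambda>x. -1 * u x) \<in> D" using u by (rule form.scale_mem)
  define a where "a = (\<lambda>x. min (max (u x) 0) K)"
  define b where "b = (\<lambda>x. min (max (-1 * u x) 0) L)"
  define z where "z = (\<lambda>x. a x - b x)"
  define r where "r = (\<lambda>x. u x - z x)"
  have zero: "(\<lambda>x. min (max (y x) 0) 0) = (\<lambda>x. 0)" for y :: "'a \<Rightarrow> real" by auto
  have a: "a \<in> D" using K clamp(1)[OF u, of K] form.zero_mem unfolding a_def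
    by (cases "K = 0") (auto simp: zero)
  have b: "b \<in> D" using L clamp(1)[OF nu, of L] form.zero_mem unfolding b_def
    by (cases "L = 0") (auto simp: zero)
  have z: "z \<in> D" unfolding z_def by (intro form.diff_mem a b)
  have r: "r \<in> D" unfolding r_def by (intro form.diff_mem u z)
  have nr: "(\<lambda>x. -1 * r x) \<in> D" using r by (rule form.scale_mem)
  have zz: "(\<lambda>x. max (min (u x) K) (- L)) = z"
    using L K by (auto simp: z_def a_def b_def min_def max_def fun_eq_iff)
  have null: "\<E> (\<lambda>x. 0) y = 0" if "y \<in> D" for y using form.scale_left[OF that that, of 0] by simp
  have ar: "0 \<le> \<E> a r"
  proof (cases "K = 0")
    case False
    show ?thesis
    proof (rule energy_cut_direction[OF a r])
      fix s :: real and y assume s: "0 \<le> s"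
      consider "K \<le> u y" | "u y \<le> 0" | "0 < u y" "u y < K" by linarith
      then show "min (max (a y + s * r y) 0) K = a y"
      proof cases
        case 1
        then have "a y = K" "0 \<le> r y" using K L by (auto simp: a_def b_def r_def z_def)
        then show ?thesis using s K by simp
      next
        case 2
        then have "a y = 0" "r y \<le> 0" using K L by (auto simp: a_def b_def r_def z_def)
        then show ?thesis using mult_nonneg_nonpos[OF s, of "r y"] K by simp
      next
        case 3
        then have "a y = u y" "r y = 0" using L by (auto simp: a_def b_def r_def z_def)
        then show ?thesis using 3 by simp
      qed
    qed (use K False in simp)
  qed (use null[OF r] in \<open>simp add: a_def zero\<close>)
  have br: "0 \<le> \<E> b (\<lambda>x. -1 * r x)"
  proof (cases "L = 0")
    case False
    show ?thesis
    proof (rule energy_cut_direction[OF b nr])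
      fix s :: real and y assume s: "0 \<le> s"
      consider "u y \<le> - L" | "0 \<le> u y" | "- L < u y" "u y < 0" by linarith
      then show "min (max (b y + s * (-1 * r y)) 0) L = b y"
      proof cases
        case 1
        then have "b y = L" "r y \<le> 0" using K L by (auto simp: a_def b_def r_def z_def)
        then show ?thesis using mult_nonneg_nonpos[OF s, of "r y"] L by simp
      next
        case 2
        then have "b y = 0" "0 \<le> r y" using K L by (auto simp: a_def b_def r_def z_def)
        then show ?thesis using s L by simp
      next
        case 3
        then have "b y = - u y" "r y = 0" using K by (auto simp: a_def b_def r_def z_def)
        then show ?thesis using 3 by simp
      qed
    qed (use L False in simp)
  qed (use null[OF nr] in \<open>simp add: b_def zero\<close>)
  have "0 \<le> \<E> z r"
    using ar br form.scale_right[OF r b, of "-1"] unfolding z_def form.diff_left[OF a b r] by simp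
  then have "\<E> z z \<le> \<E> z z + 2 * \<E> z r + \<E> r r" using form.nonneg[OF r] by simp
  also have "\<dots> = \<E> (\<lambda>x. z x + r x) (\<lambda>x. z x + r x)" by (rule form.quad_add[OF z r, symmetric])
  also have "(\<lambda>x. z x + r x) = u" by (simp add: r_def)
  finally show "\<E> (\<lambda>x. max (min (u x) K) (- L)) (\<lambda>x. max (min (u x) K) (- L)) \<le> \<E> u u"
    unfolding zz .
  show "(\<lambda>x. max (min (u x) K) (- L)) \<in> D" unfolding zz by (rule z)
qed

section \<open>Minimisers of weighted quadratic functionals\<close>

lemma weight_integrable:
  fixes u v :: "'a \<Rightarrow> real"
  assumes [measurable]: "\<rho> \<in> borel_measurable m" and \<rho>: "\<And>x. 0 \<le> \<rho> x" "\<And>x. \<rho> x \<le> 1"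
    and uv: "integrable m (\<lambda>x. u x * v x)"
  shows "integrable m (\<lambda>x. \<rho> x * (u x * v x))"
proof (rule Bochner_Integration.integrable_bound[OF uv])
  have [measurable]: "(\<lambda>x. u x * v x) \<in> borel_measurable m" using uv by auto
  show "(\<lambda>x. \<rho> x * (u x * v x)) \<in> borel_measurable m" by measurable
  have "\<bar>\<rho> x * y\<bar> \<le> \<bar>y\<bar>" for x y
    using \<rho>[of x] by (auto simp: abs_mult intro: mult_left_le_one_le)
  then show "AE x in m. norm (\<rho> x * (u x * v x)) \<le> norm (u x * v x)" by auto
qed

lemma weight_integrable_cross:
  assumes [measurable]: "\<rho> \<in> borel_measurable m" and \<rho>: "\<And>x. 0 \<le> \<rho> x" "\<And>x. \<rho> x \<le> 1"
    and [measurable]: "h \<in> borel_measurable m"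
    and \<rho>h: "integrable m (\<lambda>x. \<rho> x * (h x * h x))" and v: "v \<in> D"
  shows "integrable m (\<lambda>x. \<rho> x * (h x * v x))"
proof (rule Bochner_Integration.integrable_bound)
  have [measurable]: "v \<in> borel_measurable m" using v by (rule D_measurable)
  show "integrable m (\<lambda>x. \<rho> x * (h x * h x) + \<rho> x * (v x * v x))"
    using weight_integrable[of \<rho> v v] L2_mult_integrable[OF D_L2 D_L2, OF v v] \<rho>h \<rho> by simp
  show "(\<lambda>x. \<rho> x * (h x * v x)) \<in> borel_measurable m" by measurable
  have "\<bar>\<rho> x * (h x * v x)\<bar> \<le> \<bar>\<rho> x * (h x * h x) + \<rho> x * (v x * v x)\<bar>" for x
  proof -
    have "\<bar>\<rho> x * (h x * v x)\<bar> \<le> \<rho> x * (h x * h x) + \<rho> x * (v x * v x)"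
      using mult_left_mono[OF abs_mult_le_squares[of "h x" "v x"] \<rho>(1)[of x]] \<rho>(1)[of x]
      by (simp add: abs_mult power2_eq_square distrib_left)
    then show ?thesis by linarith
  qed
  then show "AE x in m. norm (\<rho> x * (h x * v x)) \<le> norm (\<rho> x * (h x * h x) + \<rho> x * (v x * v x))"
    by simp
qed

definition weighted :: "('a \<Rightarrow> real) \<Rightarrow> real \<Rightarrow> ('a \<Rightarrow> real) \<Rightarrow> ('a \<Rightarrow> real) \<Rightarrow> real" where
  "weighted \<rho> \<beta> u v = \<E> u v + \<beta> * (\<integral>x. \<rho> x * (u x * v x) \<partial>m)"

lemma weighted_form:
  assumes [measurable]: "\<rho> \<in> borel_measurable m" and \<rho>: "\<And>x. 0 \<le> \<rho> x" "\<And>x. \<rho> x \<le> 1"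
    and \<beta>: "0 \<le> \<beta>"
  shows "nonneg_form D (weighted \<rho> \<beta>)"
proof
  have int: "integrable m (\<lambda>x. \<rho> x * (u x * v x))" if "u \<in> D" "v \<in> D" for u v
    using \<rho> that by (intro weight_integrable L2_mult_integrable D_L2) auto
  show "(\<lambda>x. 0) \<in> D" by (rule form.zero_mem)
  fix u v :: "'a \<Rightarrow> real" and a b :: real assume u: "u \<in> D" and v: "v \<in> D"
  show "(\<lambda>x. a * u x + b * v x) \<in> D" using u v by (rule form.comb_mem)
  show "weighted \<rho> \<beta> u v = weighted \<rho> \<beta> v u"
    using form.sym[OF u v] by (simp add: weighted_def mult.commute)
  show "0 \<le> weighted \<rho> \<beta> u u"
    unfolding weighted_def using form.nonneg[OF u] \<beta> \<rho>
    by (intro add_nonneg_nonneg mult_nonneg_nonneg integral_nonneg_AE) auto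
  fix w assume w: "w \<in> D"
  have "(\<integral>x. \<rho> x * ((a * u x + b * v x) * w x) \<partial>m)
        = (\<integral>x. a * (\<rho> x * (u x * w x)) + b * (\<rho> x * (v x * w x)) \<partial>m)"
    by (simp add: algebra_simps)
  also have "\<dots> = a * (\<integral>x. \<rho> x * (u x * w x) \<partial>m) + b * (\<integral>x. \<rho> x * (v x * w x) \<partial>m)"
    using int[OF u w] int[OF v w] by simp
  finally show "weighted \<rho> \<beta> (\<lambda>x. a * u x + b * v x) w = a * weighted \<rho> \<beta> u w + b * weighted \<rho> \<beta> v w"
    unfolding weighted_def using form.comb_left[OF u v w] by (simp add: algebra_simps)
qed

text \<open>The sequence minimises \<open>\<E> v v + \<beta> \<integral>\<rho> (v - h)\<^sup>2\<close>.  Cutting \<open>v\<close> off at the bounds of \<open>h\<close> raises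
  neither term, so the minimising functions may be taken between the same bounds. This is how the
  maximum principle for resolvents enters.\<close>

lemma weighted_minimizer:
  assumes [measurable]: "\<rho> \<in> borel_measurable m" and \<rho>: "\<And>x. 0 \<le> \<rho> x" "\<And>x. \<rho> x \<le> 1"
    and \<beta>: "0 < \<beta>" and K: "0 \<le> L" "0 \<le> K"
    and [measurable]: "h \<in> borel_measurable m" and h: "\<And>x. - L \<le> h x" "\<And>x. h x \<le> K"
    and \<rho>h: "integrable m (\<lambda>x. \<rho> x * (h x * h x))"
  obtains vs where "nonneg_form.cauchy_seq D (weighted \<rho> \<beta>) vs"
    "\<And>n x. - L \<le> vs n x \<and> vs n x \<le> K"
    "\<And>v. v \<in> D \<Longrightarrow> (\<lambda>n. weighted \<rho> \<beta> (vs n) v) \<longlonglongrightarrow> \<beta> * (\<integral>x. \<rho> x * (h x * v x) \<partial>m)"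
proof -
  interpret Q: nonneg_form D "weighted \<rho> \<beta>" using \<rho> \<beta> by (intro weighted_form) auto
  have int: "integrable m (\<lambda>x. \<rho> x * (u x * v x))" if "u \<in> D" "v \<in> D" for u v
    using \<rho> that by (intro weight_integrable L2_mult_integrable D_L2) auto
  have inth: "integrable m (\<lambda>x. \<rho> x * (h x * v x))" if "v \<in> D" for v
    by (rule weight_integrable_cross[OF _ \<rho> _ \<rho>h that]) simp_all
  have intd: "integrable m (\<lambda>x. \<rho> x * (v x - h x)\<^sup>2)"
    and J: "weighted \<rho> \<beta> v v - 2 * (\<beta> * (\<integral>x. \<rho> x * (h x * v x) \<partial>m))
        = \<E> v v + \<beta> * (\<integral>x. \<rho> x * (v x - h x)\<^sup>2 \<partial>m) - \<beta> * (\<integral>x. \<rho> x * (h x * h x) \<partial>m)"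
    if v: "v \<in> D" for v
  proof -
    have eq: "\<rho> x * (v x - h x)\<^sup>2 = \<rho> x * (v x * v x) - 2 * (\<rho> x * (h x * v x)) + \<rho> x * (h x * h x)" for x
      by (simp add: power2_eq_square algebra_simps)
    show "integrable m (\<lambda>x. \<rho> x * (v x - h x)\<^sup>2)"
      unfolding eq using int[OF v v] inth[OF v] \<rho>h by simp
    show "weighted \<rho> \<beta> v v - 2 * (\<beta> * (\<integral>x. \<rho> x * (h x * v x) \<partial>m))
        = \<E> v v + \<beta> * (\<integral>x. \<rho> x * (v x - h x)\<^sup>2 \<partial>m) - \<beta> * (\<integral>x. \<rho> x * (h x * h x) \<partial>m)"
    proof -
      have "(\<integral>x. \<rho> x * (v x - h x)\<^sup>2 \<partial>m) = (\<integral>x. \<rho> x * (v x * v x) \<partial>m)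
            - 2 * (\<integral>x. \<rho> x * (h x * v x) \<partial>m) + (\<integral>x. \<rho> x * (h x * h x) \<partial>m)"
        unfolding eq using int[OF v v] inth[OF v] \<rho>h by simp
      note * = this
      show ?thesis unfolding weighted_def * by (simp add: distrib_left right_diff_distrib)
    qed
  qed
  show ?thesis
  proof (rule Q.minimizing_sequence[where L = "\<lambda>v. \<beta> * (\<integral>x. \<rho> x * (h x * v x) \<partial>m)"
        and B = "- \<beta> * (\<integral>x. \<rho> x * (h x * h x) \<partial>m)"
        and R = "\<lambda>v. \<forall>x. - L \<le> v x \<and> v x \<le> K"])
    fix u v :: "'a \<Rightarrow> real" and a b :: real assume u: "u \<in> D" and v: "v \<in> D"
    have "(\<integral>x. \<rho> x * (h x * (a * u x + b * v x)) \<partial>m)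
        = (\<integral>x. a * (\<rho> x * (h x * u x)) + b * (\<rho> x * (h x * v x)) \<partial>m)"
      by (simp add: algebra_simps)
    also have "\<dots> = a * (\<integral>x. \<rho> x * (h x * u x) \<partial>m) + b * (\<integral>x. \<rho> x * (h x * v x) \<partial>m)"
      using inth[OF u] inth[OF v] by simp
    finally show "\<beta> * (\<integral>x. \<rho> x * (h x * (a * u x + b * v x)) \<partial>m) =
        a * (\<beta> * (\<integral>x. \<rho> x * (h x * u x) \<partial>m)) + b * (\<beta> * (\<integral>x. \<rho> x * (h x * v x) \<partial>m))"
      by (simp add: algebra_simps)
  next
    fix v assume v: "v \<in> D"
    have "0 \<le> \<E> v v" "0 \<le> \<beta> * (\<integral>x. \<rho> x * (v x - h x)\<^sup>2 \<partial>m)"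
      using form.nonneg[OF v] \<beta> \<rho> by (auto intro!: mult_nonneg_nonneg integral_nonneg_AE)
    then show "- \<beta> * (\<integral>x. \<rho> x * (h x * h x) \<partial>m) \<le>
        weighted \<rho> \<beta> v v - 2 * (\<beta> * (\<integral>x. \<rho> x * (h x * v x) \<partial>m))"
      unfolding J[OF v] by simp
    let ?w = "\<lambda>x. max (min (v x) K) (- L)"
    note w = cut[OF v K]
    have "(\<integral>x. \<rho> x * (?w x - h x)\<^sup>2 \<partial>m) \<le> (\<integral>x. \<rho> x * (v x - h x)\<^sup>2 \<partial>m)"
    proof (intro integral_mono intd w v mult_left_mono \<rho>)
      fix x show "(?w x - h x)\<^sup>2 \<le> (v x - h x)\<^sup>2"
        using h[of x] K by (auto simp: abs_le_square_iff[symmetric] min_def max_def)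
    qed
    then have "\<beta> * (\<integral>x. \<rho> x * (?w x - h x)\<^sup>2 \<partial>m) \<le> \<beta> * (\<integral>x. \<rho> x * (v x - h x)\<^sup>2 \<partial>m)"
      using \<beta> by (intro mult_left_mono) auto
    then have "weighted \<rho> \<beta> ?w ?w - 2 * (\<beta> * (\<integral>x. \<rho> x * (h x * ?w x) \<partial>m)) \<le>
          weighted \<rho> \<beta> v v - 2 * (\<beta> * (\<integral>x. \<rho> x * (h x * v x) \<partial>m))"
      unfolding J[OF v] J[OF w(1)] using w(2) by simp
    then show "\<exists>v'\<in>D. (\<forall>x. - L \<le> v' x \<and> v' x \<le> K) \<and>
          weighted \<rho> \<beta> v' v' - 2 * (\<beta> * (\<integral>x. \<rho> x * (h x * v' x) \<partial>m)) \<le>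
          weighted \<rho> \<beta> v v - 2 * (\<beta> * (\<integral>x. \<rho> x * (h x * v x) \<partial>m))"
      using w(1) K by (intro bexI[of _ ?w]) auto
  next
    fix vs assume vs: "Q.cauchy_seq vs" "\<And>n. \<forall>x. - L \<le> vs n x \<and> vs n x \<le> K"
      "\<And>v. v \<in> D \<Longrightarrow> (\<lambda>n. weighted \<rho> \<beta> (vs n) v) \<longlonglongrightarrow> \<beta> * (\<integral>x. \<rho> x * (h x * v x) \<partial>m)"
    show ?thesis by (rule that[OF vs(1)]) (use vs in auto)
  qed
qed

section \<open>The resolvent of the form\<close>

text \<open>A relation and not a function, because the resolvent is determined up to null sets, and the
  process will single out a version of its own.\<close>

definition is_resolvent :: "real \<Rightarrow> ('a \<Rightarrow> real) \<Rightarrow> ('a \<Rightarrow> real) \<Rightarrow> bool" where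
  "is_resolvent \<alpha> h \<psi> \<longleftrightarrow>
     \<psi> \<in> D \<and> (\<forall>v\<in>D. \<E> \<psi> v + \<alpha> * l2_inner m \<psi> v = l2_inner m h v)"

lemma energy_limit:
  assumes us: "\<And>n. us n \<in> D"
    and cau: "\<And>e. e > 0 \<Longrightarrow> \<exists>N. \<forall>i\<ge>N. \<forall>j\<ge>N. energy1 m \<E> (\<lambda>x. us i x - us j x) < e"
  obtains u where "u \<in> D" "\<And>v. v \<in> D \<Longrightarrow> (\<lambda>n. \<E> (us n) v) \<longlonglongrightarrow> \<E> u v"
    "\<And>v. v \<in> L2 m \<Longrightarrow> (\<lambda>n. l2_inner m (us n) v) \<longlonglongrightarrow> l2_inner m u v"
    "(\<lambda>n. l2.dist_sq m (us n) u) \<longlonglongrightarrow> 0"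
proof -
  obtain u where u: "u \<in> D" and lim: "(\<lambda>n. energy1 m \<E> (\<lambda>x. us n x - u x)) \<longlonglongrightarrow> 0"
    using closed us cau unfolding closed_form_def by blast
  have d: "(\<lambda>x. us n x - u x) \<in> D" for n by (intro form.diff_mem us u)
  have limE: "(\<lambda>n. form.dist_sq (us n) u) \<longlonglongrightarrow> 0"
    by (rule Lim_null_comparison[OF _ lim])
       (use form.nonneg[OF d] l2.nonneg[OF D_L2[OF d]] in \<open>auto simp: energy1_def\<close>)
  have limL: "(\<lambda>n. l2.dist_sq m (us n) u) \<longlonglongrightarrow> 0"
    by (rule Lim_null_comparison[OF _ lim])
       (use form.nonneg[OF d] l2.nonneg[OF D_L2[OF d]] in \<open>auto simp: energy1_def\<close>)
  show ?thesis
  proof (rule that[OF u _ _ limL])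
    fix v assume v: "v \<in> D"
    have "(\<lambda>n. sqrt (form.dist_sq (us n) u) * sqrt (\<E> v v)) \<longlonglongrightarrow> 0"
      using tendsto_real_sqrt[OF limE] by (auto intro!: tendsto_mult_left_zero)
    then have "(\<lambda>n. \<E> (\<lambda>x. us n x - u x) v) \<longlonglongrightarrow> 0"
      by (rule Lim_null_comparison[rotated]) (use form.cauchy_schwarz[OF d v] in auto)
    then show "(\<lambda>n. \<E> (us n) v) \<longlonglongrightarrow> \<E> u v"
      using us u v by (simp add: form.diff_left LIM_zero_iff)
  next
    fix v assume v: "v \<in> L2 m"
    have "(\<lambda>n. sqrt (l2.dist_sq m (us n) u) * sqrt (l2_inner m v v)) \<longlonglongrightarrow> 0"
      using tendsto_real_sqrt[OF limL] by (auto intro!: tendsto_mult_left_zero)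
    then have "(\<lambda>n. l2_inner m (\<lambda>x. us n x - u x) v) \<longlonglongrightarrow> 0"
      by (rule Lim_null_comparison[rotated]) (use l2.cauchy_schwarz[OF D_L2[OF d] v] in auto)
    then show "(\<lambda>n. l2_inner m (us n) v) \<longlonglongrightarrow> l2_inner m u v"
      using us u v by (simp add: l2.diff_left D_L2 LIM_zero_iff)
  qed
qed

text \<open>For the constant weight the minimising sequence is Cauchy also in \<open>L\<^sup>2\<close>, so it has a limit in
  \<open>D\<close> by closedness.\<close>

lemma resolvent_exists_between:
  assumes \<alpha>: "\<alpha> > 0" and h: "h \<in> L2 m" "\<And>x. - L \<le> h x" "\<And>x. h x \<le> K"
    and K: "0 \<le> L" "0 \<le> K"
  obtains \<psi> where "is_resolvent \<alpha> h \<psi>" "\<And>x. - L / \<alpha> \<le> \<psi> x" "\<And>x. \<psi> x \<le> K / \<alpha>"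
proof -
  interpret Q: nonneg_form D "weighted (\<lambda>x. 1) \<alpha>" using \<alpha> by (intro weighted_form) auto
  have w: "weighted (\<lambda>x. 1) \<alpha> u v = \<E> u v + \<alpha> * l2_inner m u v" for u v
    by (simp add: weighted_def l2_inner_def)
  have [measurable]: "h \<in> borel_measurable m" using h(1) by (rule L2_measurable)
  have [simp]: "integrable m (\<lambda>x. h x * h x)" using h(1) by (intro L2_mult_integrable)
  obtain vs where vs: "Q.cauchy_seq vs" "\<And>n x. - (L / \<alpha>) \<le> vs n x \<and> vs n x \<le> K / \<alpha>"
    and lim: "\<And>v. v \<in> D \<Longrightarrow> (\<lambda>n. weighted (\<lambda>x. 1) \<alpha> (vs n) v)
                 \<longlonglongrightarrow> \<alpha> * (\<integral>x. 1 * (h x / \<alpha> * v x) \<partial>m)"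
  proof (rule weighted_minimizer[of "\<lambda>x. 1" \<alpha> "L / \<alpha>" "K / \<alpha>" "\<lambda>x. h x / \<alpha>"])
    show "- (L / \<alpha>) \<le> h x / \<alpha>" "h x / \<alpha> \<le> K / \<alpha>" for x
      using divide_right_mono[OF h(2), of \<alpha>] divide_right_mono[OF h(3), of \<alpha>] \<alpha> by auto
  qed (use \<alpha> K in auto)
  have mem: "vs n \<in> D" for n using vs(1) by (rule Q.cauchy_seq_mem)
  obtain u where u: "u \<in> D" "\<And>v. v \<in> D \<Longrightarrow> (\<lambda>n. \<E> (vs n) v) \<longlonglongrightarrow> \<E> u v"
    "\<And>v. v \<in> L2 m \<Longrightarrow> (\<lambda>n. l2_inner m (vs n) v) \<longlonglongrightarrow> l2_inner m u v"
    "(\<lambda>n. l2.dist_sq m (vs n) u) \<longlonglongrightarrow> 0"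
  proof (rule energy_limit[OF mem])
    fix e :: real assume e: "e > 0"
    then have "e * min 1 \<alpha> > 0" using \<alpha> by simp
    then obtain N where N: "\<forall>i\<ge>N. \<forall>j\<ge>N. weighted (\<lambda>x. 1) \<alpha> (\<lambda>x. vs i x - vs j x) (\<lambda>x. vs i x - vs j x) < e * min 1 \<alpha>"
      using vs(1) unfolding Q.cauchy_seq_def by blast
    show "\<exists>N. \<forall>i\<ge>N. \<forall>j\<ge>N. energy1 m \<E> (\<lambda>x. vs i x - vs j x) < e"
    proof (intro exI[of _ N] allI impI)
      fix i j assume ij: "i \<ge> N" "j \<ge> N"
      let ?d = "\<lambda>x. vs i x - vs j x"
      have d: "?d \<in> D" by (intro form.diff_mem mem)
      have "min 1 \<alpha> * energy1 m \<E> ?d = min 1 \<alpha> * \<E> ?d ?d + min 1 \<alpha> * l2_inner m ?d ?d"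
        by (simp add: energy1_def distrib_left)
      also have "\<dots> \<le> 1 * \<E> ?d ?d + \<alpha> * l2_inner m ?d ?d"
        by (intro add_mono mult_right_mono form.nonneg l2.nonneg d D_L2) auto
      also have "\<dots> = weighted (\<lambda>x. 1) \<alpha> ?d ?d" by (simp add: w)
      also have "\<dots> < e * min 1 \<alpha>" using N ij by blast
      finally show "energy1 m \<E> ?d < e" using \<alpha> by (simp add: mult.commute)
    qed
  qed auto
  have eq: "\<E> u v + \<alpha> * l2_inner m u v = l2_inner m h v" if v: "v \<in> D" for v
  proof (rule LIMSEQ_unique)
    show "(\<lambda>n. \<E> (vs n) v + \<alpha> * l2_inner m (vs n) v) \<longlonglongrightarrow> \<E> u v + \<alpha> * l2_inner m u v"
      by (intro tendsto_intros u D_L2 v)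
    have "\<alpha> * (\<integral>x. 1 * (h x / \<alpha> * v x) \<partial>m) = l2_inner m h v"
      using \<alpha> by (simp add: l2_inner_def)
    then show "(\<lambda>n. \<E> (vs n) v + \<alpha> * l2_inner m (vs n) v) \<longlonglongrightarrow> l2_inner m h v"
      using lim[OF v] unfolding w by metis
  qed
  have "\<And>n. (\<lambda>x. vs n x - u x) \<in> L2 m" by (intro D_L2 form.diff_mem mem u)
  then obtain r where r: "strict_mono r" "AE x in m. (\<lambda>n. vs (r n) x - u x) \<longlonglongrightarrow> 0"
    using l2_tendsto_zero_AE_subseq[OF _ u(4)] by blast
  have bd: "AE x in m. - (L / \<alpha>) \<le> u x \<and> u x \<le> K / \<alpha>"
    using r(2)
  proof eventually_elim
    case (elim x)
    then have "(\<lambda>n. vs (r n) x) \<longlonglongrightarrow> u x" by (simp add: LIM_zero_iff)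
    then show ?case using vs(2)
      by (blast intro: LIMSEQ_le_const LIMSEQ_le_const2)
  qed
  define \<psi> where "\<psi> = (\<lambda>x. max (min (u x) (K / \<alpha>)) (- (L / \<alpha>)))"
  have ae: "AE x in m. u x = \<psi> x" using bd by eventually_elim (auto simp: \<psi>_def)
  have [measurable]: "u \<in> borel_measurable m" using u(1) by (rule D_measurable)
  have [measurable]: "\<psi> \<in> borel_measurable m" unfolding \<psi>_def by measurable
  note c = D_AE_cong[OF u(1) _ ae]
  have "l2_inner m u v = l2_inner m \<psi> v" if [measurable]: "v \<in> borel_measurable m" for v
    unfolding l2_inner_def by (rule integral_cong_AE) (use ae in auto)
  then have "is_resolvent \<alpha> h \<psi>"
    unfolding is_resolvent_def using c eq D_measurable by auto
  then show ?thesis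
  proof (rule that)
    have "0 \<le> L / \<alpha>" "0 \<le> K / \<alpha>" using K \<alpha> by auto
    then show "- L / \<alpha> \<le> \<psi> x" "\<psi> x \<le> K / \<alpha>" for x by (auto simp: \<psi>_def)
  qed
qed

lemma resolvent_comb:
  assumes "h1 \<in> L2 m" "h2 \<in> L2 m" "is_resolvent \<alpha> h1 \<psi>1" "is_resolvent \<alpha> h2 \<psi>2"
  shows "is_resolvent \<alpha> (\<lambda>x. a * h1 x + b * h2 x) (\<lambda>x. a * \<psi>1 x + b * \<psi>2 x)"
proof -
  have 1: "\<psi>1 \<in> D" "\<psi>2 \<in> D" using assms by (auto simp: is_resolvent_def)
  show ?thesis unfolding is_resolvent_def
  proof (intro conjI ballI)
    show "(\<lambda>x. a * \<psi>1 x + b * \<psi>2 x) \<in> D" by (intro form.comb_mem 1)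
    fix v assume v: "v \<in> D"
    have eq: "l2_inner m h1 v = \<E> \<psi>1 v + \<alpha> * l2_inner m \<psi>1 v"
         "l2_inner m h2 v = \<E> \<psi>2 v + \<alpha> * l2_inner m \<psi>2 v"
      using assms v by (auto simp: is_resolvent_def)
    show "\<E> (\<lambda>x. a * \<psi>1 x + b * \<psi>2 x) v + \<alpha> * l2_inner m (\<lambda>x. a * \<psi>1 x + b * \<psi>2 x) v =
            l2_inner m (\<lambda>x. a * h1 x + b * h2 x) v"
      unfolding form.comb_left[OF 1 v] l2.comb_left[OF D_L2 D_L2 D_L2, OF 1 v]
        l2.comb_left[OF assms(1,2) D_L2[OF v]] eq
      by (simp add: algebra_simps)
  qed
qed

lemma resolvent_diff:
  assumes "h1 \<in> L2 m" "h2 \<in> L2 m" "is_resolvent \<alpha> h1 \<psi>1" "is_resolvent \<alpha> h2 \<psi>2"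
  shows "is_resolvent \<alpha> (\<lambda>x. h1 x - h2 x) (\<lambda>x. \<psi>1 x - \<psi>2 x)"
  using resolvent_comb[OF assms, of 1 "-1"] by simp

lemma resolvent_sym:
  assumes "h1 \<in> L2 m" "h2 \<in> L2 m" "is_resolvent \<alpha> h1 \<psi>1" "is_resolvent \<alpha> h2 \<psi>2"
  shows "l2_inner m h1 \<psi>2 = l2_inner m \<psi>1 h2"
proof -
  have 1: "\<psi>1 \<in> D" "\<psi>2 \<in> D" using assms by (auto simp: is_resolvent_def)
  have "\<E> \<psi>1 \<psi>2 + \<alpha> * l2_inner m \<psi>1 \<psi>2 = l2_inner m h1 \<psi>2"
       "\<E> \<psi>2 \<psi>1 + \<alpha> * l2_inner m \<psi>2 \<psi>1 = l2_inner m h2 \<psi>1"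
    using assms 1 by (auto simp: is_resolvent_def)
  then show ?thesis
    using form.sym[OF 1] l2.sym[OF D_L2 D_L2, OF 1] l2.sym[OF assms(2) D_L2[OF 1(1)]] by simp
qed

lemma resolvent_norm_le:
  assumes \<alpha>: "\<alpha> > 0" and h: "h \<in> L2 m" and r: "is_resolvent \<alpha> h \<psi>"
  shows "\<alpha> * sqrt (l2_inner m \<psi> \<psi>) \<le> sqrt (l2_inner m h h)"
    and "\<E> \<psi> \<psi> \<le> l2_inner m h h / \<alpha>"
proof -
  have D: "\<psi> \<in> D" and eq: "\<E> \<psi> \<psi> + \<alpha> * l2_inner m \<psi> \<psi> = l2_inner m h \<psi>"
    using r by (auto simp: is_resolvent_def)
  define a where "a = sqrt (l2_inner m \<psi> \<psi>)"
  define b where "b = sqrt (l2_inner m h h)"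
  have ab: "0 \<le> a" "0 \<le> b" "l2_inner m \<psi> \<psi> = a\<^sup>2" "l2_inner m h h = b\<^sup>2"
    using l2.nonneg[OF D_L2[OF D]] l2.nonneg[OF h] by (auto simp: a_def b_def)
  have cs: "l2_inner m h \<psi> \<le> b * a"
    using l2.cauchy_schwarz[OF h D_L2[OF D]] by (simp add: a_def b_def)
  have E: "0 \<le> \<E> \<psi> \<psi>" using D by (rule form.nonneg)
  have "\<alpha> * a * a \<le> b * a" using eq cs E ab by (simp add: power2_eq_square)
  then have *: "\<alpha> * a \<le> b" using ab by (cases "a = 0") auto
  then show "\<alpha> * sqrt (l2_inner m \<psi> \<psi>) \<le> sqrt (l2_inner m h h)" by (simp add: a_def b_def)
  have "0 \<le> \<alpha> * a\<^sup>2" using \<alpha> by simp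
  then have "\<E> \<psi> \<psi> \<le> b * a" using eq cs unfolding ab(3) by linarith
  also have "\<dots> \<le> b * (b / \<alpha>)" using * ab \<alpha> by (intro mult_left_mono) (auto simp: field_simps)
  finally show "\<E> \<psi> \<psi> \<le> l2_inner m h h / \<alpha>" using ab by (simp add: power2_eq_square)
qed

lemma resolvent_unique:
  assumes \<alpha>: "\<alpha> > 0" and h: "h \<in> L2 m" and r: "is_resolvent \<alpha> h \<psi>1" "is_resolvent \<alpha> h \<psi>2"
  shows "AE x in m. \<psi>1 x = \<psi>2 x"
proof -
  have "is_resolvent \<alpha> (\<lambda>x. h x - h x) (\<lambda>x. \<psi>1 x - \<psi>2 x)" by (intro resolvent_diff h r)
  then have "is_resolvent \<alpha> (\<lambda>x. 0) (\<lambda>x. \<psi>1 x - \<psi>2 x)" by simp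
  from resolvent_norm_le(1)[OF \<alpha> L2_zero this]
  have "sqrt (l2.dist_sq m \<psi>1 \<psi>2) \<le> 0"
    using \<alpha> by (simp add: l2_inner_def mult_le_0_iff)
  moreover have "(\<lambda>x. \<psi>1 x - \<psi>2 x) \<in> L2 m"
    using r by (intro D_L2 form.diff_mem) (auto simp: is_resolvent_def)
  ultimately have "AE x in m. \<psi>1 x - \<psi>2 x = 0" by (intro l2_null) auto
  then show ?thesis by simp
qed

lemma resolvent_nonneg:
  assumes "\<alpha> > 0" "h \<in> L2 m" "\<And>x. 0 \<le> h x" "\<And>x. h x \<le> K" "is_resolvent \<alpha> h \<psi>"
  shows "AE x in m. 0 \<le> \<psi> x"
proof -
  have K: "0 \<le> K" using assms(3,4)[of undefined] by simp
  have 0: "- 0 \<le> h x" for x using assms(3) by simp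
  obtain \<psi>' where "is_resolvent \<alpha> h \<psi>'" and *: "\<And>x. - 0 / \<alpha> \<le> \<psi>' x"
    by (rule resolvent_exists_between[OF assms(1,2) 0 assms(4) order_refl K]) blast
  from resolvent_unique[OF assms(1,2) this(1) assms(5)] show ?thesis
    by eventually_elim (use * in \<open>metis div_0 minus_zero\<close>)
qed

lemma resolvent_exists:
  assumes \<alpha>: "\<alpha> > 0" and h: "h \<in> L2 m" "\<And>x. \<bar>h x\<bar> \<le> K"
  obtains \<psi> where "is_resolvent \<alpha> h \<psi>" "\<And>x. \<bar>\<psi> x\<bar> \<le> K / \<alpha>"
proof -
  have b: "0 \<le> K" "- K \<le> h x" "h x \<le> K" for x using h(2)[of x] by auto
  obtain \<psi> where "is_resolvent \<alpha> h \<psi>" "\<And>x. - K / \<alpha> \<le> \<psi> x" "\<And>x. \<psi> x \<le> K / \<alpha>"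
    by (rule resolvent_exists_between[OF \<alpha> h(1) b(2,3,1,1)]) blast
  then show ?thesis
    by (intro that[of \<psi>]) (simp_all add: abs_le_iff, simp add: minus_le_iff)
qed

lemma resolvent_bounded:
  assumes "\<alpha> > 0" "h \<in> L2 m" "\<And>x. \<bar>h x\<bar> \<le> K" "is_resolvent \<alpha> h \<psi>"
  shows "AE x in m. \<bar>\<psi> x\<bar> \<le> K / \<alpha>"
proof -
  obtain \<psi>' where "is_resolvent \<alpha> h \<psi>'" and *: "\<And>x. \<bar>\<psi>' x\<bar> \<le> K / \<alpha>"
    using resolvent_exists[OF assms(1-3)] by blast
  from resolvent_unique[OF assms(1,2) this(1) assms(4)] show ?thesis
    by eventually_elim (use * in metis)
qed

text \<open>The resolvent is symmetric and contracts the supremum norm, so by duality it contracts the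
  \<open>L\<^sup>1\<close> norm.\<close>

lemma resolvent_integrable:
  assumes \<alpha>: "\<alpha> > 0" and h: "integrable m h" "\<And>x. \<bar>h x\<bar> \<le> K" and r: "is_resolvent \<alpha> h \<psi>"
  shows "integrable m \<psi>"
proof -
  have hL: "h \<in> L2 m" using h by (rule L2_bounded_integrable)
  have \<psi>D: "\<psi> \<in> D" using r by (simp add: is_resolvent_def)
  note [measurable] = D_measurable[OF \<psi>D]
  have [measurable]: "h \<in> borel_measurable m" using h by auto
  obtain A :: "nat \<Rightarrow> 'a set" where A: "range A \<subseteq> sets m" "(\<Union>i. A i) = space m"
      "\<And>i. emeasure m (A i) \<noteq> \<infinity>" "incseq A"
    using sigma_finite_incseq by metis
  have [measurable]: "A i \<in> sets m" for i using A by auto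
  have bound: "(\<integral>\<^sup>+x. ennreal \<bar>\<psi> x\<bar> * indicator (A i) x \<partial>m) \<le> ennreal ((\<integral>x. \<bar>h x\<bar> \<partial>m) / \<alpha>)" for i
  proof -
    define s where "s = (\<lambda>x. indicator (A i) x * sgn (\<psi> x))"
    have [measurable]: "s \<in> borel_measurable m" by (simp add: s_def)
    have sb: "\<bar>s x\<bar> \<le> 1" for x by (auto simp: s_def indicator_def abs_sgn_eq)
    have "integrable m (\<lambda>x. indicator (A i) x :: real)"
      using A(3)[of i] by (simp add: top.not_eq_extremum)
    then have si: "integrable m s"
      by (rule Bochner_Integration.integrable_bound) (auto simp: s_def indicator_def abs_sgn_eq)
    then have sL: "s \<in> L2 m" using sb by (rule L2_bounded_integrable)
    obtain \<sigma> where \<sigma>: "is_resolvent \<alpha> s \<sigma>" "\<And>x. \<bar>\<sigma> x\<bar> \<le> 1 / \<alpha>"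
      using resolvent_exists[OF \<alpha> sL sb] by blast
    have \<sigma>D: "\<sigma> \<in> D" using \<sigma>(1) by (simp add: is_resolvent_def)
    have "l2_inner m s \<psi> = l2_inner m \<sigma> h" by (rule resolvent_sym[OF sL hL \<sigma>(1) r])
    also have "\<dots> \<le> (\<integral>x. \<bar>h x\<bar> / \<alpha> \<partial>m)"
      unfolding l2_inner_def
    proof (rule integral_mono)
      show "integrable m (\<lambda>x. \<sigma> x * h x)" by (intro L2_mult_integrable hL D_L2 \<sigma>D)
      show "integrable m (\<lambda>x. \<bar>h x\<bar> / \<alpha>)" using h by simp
      fix x
      have "\<sigma> x * h x \<le> \<bar>\<sigma> x\<bar> * \<bar>h x\<bar>" by (metis abs_ge_self abs_mult)
      also have "\<dots> \<le> 1 / \<alpha> * \<bar>h x\<bar>" by (intro mult_right_mono \<sigma>) auto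
      finally show "\<sigma> x * h x \<le> \<bar>h x\<bar> / \<alpha>" by simp
    qed
    finally have le: "l2_inner m s \<psi> \<le> (\<integral>x. \<bar>h x\<bar> \<partial>m) / \<alpha>" by simp
    have "(\<integral>\<^sup>+x. ennreal \<bar>\<psi> x\<bar> * indicator (A i) x \<partial>m) = (\<integral>\<^sup>+x. ennreal (s x * \<psi> x) \<partial>m)"
      by (intro nn_integral_cong) (auto simp: s_def indicator_def abs_sgn mult.commute)
    also have "\<dots> = ennreal (l2_inner m s \<psi>)"
      unfolding l2_inner_def using sL D_L2[OF \<psi>D]
      by (intro nn_integral_eq_integral L2_mult_integrable)
         (auto simp: s_def indicator_def sgn_mult_self_eq mult.commute sgn_if)
    finally show ?thesis using le by (simp add: ennreal_leI)
  qed
  have "(\<integral>\<^sup>+x. ennreal \<bar>\<psi> x\<bar> \<partial>m) = (\<integral>\<^sup>+x. (SUP i. ennreal \<bar>\<psi> x\<bar> * indicator (A i) x) \<partial>m)"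
  proof (rule nn_integral_cong)
    fix x assume "x \<in> space m"
    then obtain i where i: "x \<in> A i" using A(2) by blast
    show "ennreal \<bar>\<psi> x\<bar> = (SUP i. ennreal \<bar>\<psi> x\<bar> * indicator (A i) x)"
      by (rule antisym) (use i in \<open>auto intro!: SUP_upper2[of i] SUP_least simp: indicator_def\<close>)
  qed
  also have "\<dots> = (SUP i. \<integral>\<^sup>+x. ennreal \<bar>\<psi> x\<bar> * indicator (A i) x \<partial>m)"
    using A(4) by (intro nn_integral_monotone_convergence_SUP)
      (auto simp: incseq_def le_fun_def indicator_def)
  also have "\<dots> \<le> ennreal ((\<integral>x. \<bar>h x\<bar> \<partial>m) / \<alpha>)" by (intro SUP_least bound)
  finally have "(\<integral>\<^sup>+x. ennreal (norm (\<psi> x)) \<partial>m) < \<infinity>"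
    by (simp add: le_less_trans[OF _ ennreal_less_top])
  then show ?thesis by (intro integrableI_bounded) auto
qed

end


section \<open>Weights of finite energy\<close>

lemma nn_integral_Fatou_bound:
  fixes f :: "nat \<Rightarrow> 'a \<Rightarrow> real"
  assumes [measurable]: "\<And>n. f n \<in> borel_measurable M" "f' \<in> borel_measurable M"
    and lim: "AE x in M. (\<lambda>n. f n x) \<longlonglongrightarrow> f' x"
    and bound: "\<forall>\<^sub>F n in sequentially. (\<integral>\<^sup>+x. ennreal \<bar>f n x\<bar> \<partial>M) \<le> B"
  shows "(\<integral>\<^sup>+x. ennreal \<bar>f' x\<bar> \<partial>M) \<le> B"
proof -
  have "(\<integral>\<^sup>+x. ennreal \<bar>f' x\<bar> \<partial>M) = (\<integral>\<^sup>+x. liminf (\<lambda>n. ennreal \<bar>f n x\<bar>) \<partial>M)"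
  proof (rule nn_integral_cong_AE)
    show "AE x in M. ennreal \<bar>f' x\<bar> = liminf (\<lambda>n. ennreal \<bar>f n x\<bar>)"
      using lim
    proof eventually_elim
      case (elim x)
      then have "(\<lambda>n. ennreal \<bar>f n x\<bar>) \<longlonglongrightarrow> ennreal \<bar>f' x\<bar>"
        by (intro tendsto_intros)
      then show ?case by (rule lim_imp_Liminf[OF sequentially_bot, symmetric])
    qed
  qed
  also have "\<dots> \<le> liminf (\<lambda>n. \<integral>\<^sup>+x. ennreal \<bar>f n x\<bar> \<partial>M)"
    by (rule nn_integral_liminf) simp
  also have "\<dots> \<le> limsup (\<lambda>n. \<integral>\<^sup>+x. ennreal \<bar>f n x\<bar> \<partial>M)"
    by (rule Liminf_le_Limsup) simp
  also have "\<dots> \<le> B" by (rule Limsup_bounded[OF bound])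
  finally show ?thesis .
qed

text \<open>The reference function of a transient form may be decreased, so \<open>g \<le> 1\<close> is no restriction.\<close>

locale transient_dirichlet_space = dirichlet_space m D \<E>
  for m :: "'a measure" and D :: "('a \<Rightarrow> real) set" and \<E> +
  fixes g :: "'a \<Rightarrow> real" and c :: real
  assumes g_measurable [measurable]: "g \<in> borel_measurable m"
    and g_pos: "0 < g x" and g_le_1: "g x \<le> 1" and c_pos: "0 < c"
    and transient: "u \<in> D \<Longrightarrow> (\<integral>\<^sup>+x. ennreal \<bar>u x * g x\<bar> \<partial>m) \<le> ennreal (c * sqrt (\<E> u u))"
begin

text \<open>Integration against \<open>\<theta>\<close> is bounded by the energy norm, that is, \<open>\<bar>\<theta>\<bar> m\<close> is a measure of finite
  energy integral.\<close>

definition finite_energy :: "('a \<Rightarrow> real) \<Rightarrow> bool" where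
  "finite_energy \<theta> \<longleftrightarrow> \<theta> \<in> borel_measurable m \<and>
     (\<exists>C\<ge>0. \<forall>u\<in>D. (\<integral>\<^sup>+x. ennreal \<bar>u x * \<theta> x\<bar> \<partial>m) \<le> ennreal (C * sqrt (\<E> u u)))"

lemma finite_energy_g: "finite_energy g"
  unfolding finite_energy_def using transient c_pos by (auto intro!: exI[of _ c])

lemma finite_energy_dominated:
  assumes \<theta>: "finite_energy \<theta>" and [measurable]: "\<theta>' \<in> borel_measurable m"
    and le: "AE x in m. \<bar>\<theta>' x\<bar> \<le> B * \<bar>\<theta> x\<bar>" and B: "0 \<le> B"
  shows "finite_energy \<theta>'"
proof -
  have [measurable]: "\<theta> \<in> borel_measurable m" using \<theta> by (simp add: finite_energy_def)
  obtain C where C: "C \<ge> 0" "\<And>u. u \<in> D \<Longrightarrow> (\<integral>\<^sup>+x. ennreal \<bar>u x * \<theta> x\<bar> \<partial>m) \<le> ennreal (C * sqrt (\<E> u u))"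
    using \<theta> unfolding finite_energy_def by blast
  have "(\<integral>\<^sup>+x. ennreal \<bar>u x * \<theta>' x\<bar> \<partial>m) \<le> ennreal ((B * C) * sqrt (\<E> u u))" if u: "u \<in> D" for u
  proof -
    note [measurable] = D_measurable[OF u]
    have "(\<integral>\<^sup>+x. ennreal \<bar>u x * \<theta>' x\<bar> \<partial>m) \<le> (\<integral>\<^sup>+x. ennreal B * ennreal \<bar>u x * \<theta> x\<bar> \<partial>m)"
    proof (rule nn_integral_mono_AE)
      show "AE x in m. ennreal \<bar>u x * \<theta>' x\<bar> \<le> ennreal B * ennreal \<bar>u x * \<theta> x\<bar>"
        using le
      proof eventually_elim
        case (elim x)
        then have "\<bar>u x\<bar> * \<bar>\<theta>' x\<bar> \<le> \<bar>u x\<bar> * (B * \<bar>\<theta> x\<bar>)" by (intro mult_left_mono) auto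
        then show ?case using B by (simp add: abs_mult ac_simps flip: ennreal_mult')
      qed
    qed
    also have "\<dots> = ennreal B * (\<integral>\<^sup>+x. ennreal \<bar>u x * \<theta> x\<bar> \<partial>m)" by (simp add: nn_integral_cmult)
    also have "\<dots> \<le> ennreal B * ennreal (C * sqrt (\<E> u u))" by (intro mult_left_mono C u) simp
    also have "\<dots> = ennreal ((B * C) * sqrt (\<E> u u))" using B by (simp add: ac_simps flip: ennreal_mult')
    finally show ?thesis .
  qed
  then show ?thesis unfolding finite_energy_def using B C(1) by (intro conjI exI[of _ "B * C"]) auto
qed

lemma finite_energy_integrable:
  assumes \<theta>: "finite_energy \<theta>" and u: "u \<in> D"
  shows "integrable m (\<lambda>x. u x * \<theta> x)"
proof (rule integrableI_bounded)
  have [measurable]: "\<theta> \<in> borel_measurable m" using \<theta> by (simp add: finite_energy_def)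
  note [measurable] = D_measurable[OF u]
  show "(\<lambda>x. u x * \<theta> x) \<in> borel_measurable m" by measurable
  show "(\<integral>\<^sup>+x. ennreal (norm (u x * \<theta> x)) \<partial>m) < \<infinity>"
    using \<theta> u unfolding finite_energy_def
    by (auto intro: le_less_trans[OF _ ennreal_less_top])
qed

text \<open>Convergence in energy is convergence in \<open>L\<^sup>1(\<theta>)\<close>; the limit is then identified through
  Fatou's lemma.\<close>

lemma finite_energy_limit:
  assumes \<theta>: "finite_energy \<theta>" and us: "form.cauchy_seq us"
    and [measurable]: "u \<in> borel_measurable m" and lim: "AE x in m. (\<lambda>n. us n x) \<longlonglongrightarrow> u x"
  shows "integrable m (\<lambda>x. u x * \<theta> x)"
    and "(\<lambda>n. \<integral>x. us n x * \<theta> x \<partial>m) \<longlonglongrightarrow> (\<integral>x. u x * \<theta> x \<partial>m)"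
proof -
  have mem: "us n \<in> D" for n using us by (rule form.cauchy_seq_mem)
  note [measurable] = D_measurable[OF mem]
  have [measurable]: "\<theta> \<in> borel_measurable m" using \<theta> by (simp add: finite_energy_def)
  obtain C where C: "C \<ge> 0" "\<And>u. u \<in> D \<Longrightarrow> (\<integral>\<^sup>+x. ennreal \<bar>u x * \<theta> x\<bar> \<partial>m) \<le> ennreal (C * sqrt (\<E> u u))"
    using \<theta> unfolding finite_energy_def by blast
  have L1: "\<exists>N. \<forall>n\<ge>N. (\<integral>\<^sup>+x. ennreal \<bar>(us n x - u x) * \<theta> x\<bar> \<partial>m) \<le> ennreal e" if e: "e > 0" for e
  proof -
    have "e / (C + 1) > 0" using e C by simp
    then obtain N where N: "\<And>i j. i \<ge> N \<Longrightarrow> j \<ge> N \<Longrightarrow>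
        sqrt (form.dist_sq (us i) (us j)) < e / (C + 1)"
      using form.cauchy_seqD[OF us] by blast
    have "(\<integral>\<^sup>+x. ennreal \<bar>(us n x - u x) * \<theta> x\<bar> \<partial>m) \<le> ennreal e" if n: "n \<ge> N" for n
    proof (rule nn_integral_Fatou_bound[of "\<lambda>k x. (us n x - us k x) * \<theta> x"])
      show "AE x in m. (\<lambda>k. (us n x - us k x) * \<theta> x) \<longlonglongrightarrow> (us n x - u x) * \<theta> x"
        using lim by eventually_elim (intro tendsto_intros)
      have "(\<integral>\<^sup>+x. ennreal \<bar>(us n x - us k x) * \<theta> x\<bar> \<partial>m) \<le> ennreal e" if k: "k \<ge> N" for k
      proof -
        have "(\<integral>\<^sup>+x. ennreal \<bar>(us n x - us k x) * \<theta> x\<bar> \<partial>m)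
             \<le> ennreal (C * sqrt (form.dist_sq (us n) (us k)))"
          by (intro C form.diff_mem mem)
        also have "C * sqrt (form.dist_sq (us n) (us k)) \<le> C * (e / (C + 1))"
          using N[OF n k] C by (intro mult_left_mono) auto
        also have "C * (e / (C + 1)) \<le> e" using C e by (simp add: field_simps)
        finally show ?thesis by (simp add: ennreal_leI)
      qed
      then show "\<forall>\<^sub>F k in sequentially. (\<integral>\<^sup>+x. ennreal \<bar>(us n x - us k x) * \<theta> x\<bar> \<partial>m) \<le> ennreal e"
        by (auto simp: eventually_sequentially)
    qed auto
    then show ?thesis by blast
  qed
  have int: "integrable m (\<lambda>x. us n x * \<theta> x)" for n by (intro finite_energy_integrable \<theta> mem)
  show iu: "integrable m (\<lambda>x. u x * \<theta> x)"
  proof -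
    obtain N where N: "(\<integral>\<^sup>+x. ennreal \<bar>(us N x - u x) * \<theta> x\<bar> \<partial>m) \<le> ennreal 1"
      using L1[of 1] by auto
    have "(\<integral>\<^sup>+x. ennreal (norm ((us N x - u x) * \<theta> x)) \<partial>m) < \<infinity>"
      using le_less_trans[OF N ennreal_less_top] by simp
    then have "integrable m (\<lambda>x. (us N x - u x) * \<theta> x)" by (intro integrableI_bounded) auto
    from Bochner_Integration.integrable_diff[OF int[of N] this] show ?thesis
      by (simp add: algebra_simps)
  qed
  show "(\<lambda>n. \<integral>x. us n x * \<theta> x \<partial>m) \<longlonglongrightarrow> (\<integral>x. u x * \<theta> x \<partial>m)"
  proof (rule LIMSEQ_I)
    fix e :: real assume e: "0 < e"
    then have "e / 2 > 0" by simp
    then obtain N where N: "\<forall>n\<ge>N. (\<integral>\<^sup>+x. ennreal \<bar>(us n x - u x) * \<theta> x\<bar> \<partial>m) \<le> ennreal (e / 2)"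
      using L1 by blast
    show "\<exists>no. \<forall>n\<ge>no. norm ((\<integral>x. us n x * \<theta> x \<partial>m) - (\<integral>x. u x * \<theta> x \<partial>m)) < e"
    proof (intro exI[of _ N] allI impI)
      fix n assume n: "n \<ge> N"
      have i: "integrable m (\<lambda>x. (us n x - u x) * \<theta> x)"
        using Bochner_Integration.integrable_diff[OF int[of n] iu] by (simp add: algebra_simps)
      have "(\<integral>x. us n x * \<theta> x \<partial>m) - (\<integral>x. u x * \<theta> x \<partial>m) = (\<integral>x. (us n x - u x) * \<theta> x \<partial>m)"
        using int[of n] iu by (simp add: left_diff_distrib)
      also have "ennreal (norm (\<integral>x. (us n x - u x) * \<theta> x \<partial>m))
            \<le> (\<integral>\<^sup>+x. ennreal (norm ((us n x - u x) * \<theta> x)) \<partial>m)"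
        by (rule integral_norm_bound_ennreal[OF i])
      also have "\<dots> \<le> ennreal (e / 2)" using N n by simp
      finally show "norm ((\<integral>x. us n x * \<theta> x \<partial>m) - (\<integral>x. u x * \<theta> x \<partial>m)) < e"
        using e by (simp add: ennreal_le_iff)
    qed
  qed
qed

text \<open>Testing the resolvent equation of \<open>\<psi>\<close> with a cut-off of \<open>u\<close> bounds the integral of \<open>u\<^sup>+ \<psi>\<close> by
  the energy of \<open>u\<close>.\<close>

lemma finite_energy_resolvent_nonneg:
  assumes \<alpha>: "\<alpha> > 0" and k: "k \<in> L2 m" "\<And>x. 0 \<le> k x" "\<And>x. k x \<le> K" and \<theta>: "finite_energy k"
    and r: "is_resolvent \<alpha> k \<psi>"
  shows "finite_energy \<psi>"
proof -
  have \<psi>D: "\<psi> \<in> D" using r by (simp add: is_resolvent_def)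
  note [measurable] = D_measurable[OF \<psi>D] L2_measurable[OF k(1)]
  obtain C where C: "C \<ge> 0" "\<And>u. u \<in> D \<Longrightarrow> (\<integral>\<^sup>+x. ennreal \<bar>u x * k x\<bar> \<partial>m) \<le> ennreal (C * sqrt (\<E> u u))"
    using \<theta> unfolding finite_energy_def by blast
  have \<psi>0: "AE x in m. 0 \<le> \<psi> x" by (rule resolvent_nonneg[OF \<alpha> k r])
  define B where "B = (C + sqrt (\<E> \<psi> \<psi>)) / \<alpha>"
  have B: "0 \<le> B" using C \<alpha> form.nonneg[OF \<psi>D] by (simp add: B_def)
  have pos: "(\<integral>\<^sup>+x. ennreal \<bar>max (u x) 0 * \<psi> x\<bar> \<partial>m) \<le> ennreal (B * sqrt (\<E> u u))" if u: "u \<in> D" for u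
  proof (rule nn_integral_Fatou_bound)
    note [measurable] = D_measurable[OF u]
    define z where "z = (\<lambda>n x. min (max (u x) 0) (real (Suc n)))"
    have z: "z n \<in> D" "\<E> (z n) (z n) \<le> \<E> u u" "\<And>x. 0 \<le> z n x" "\<And>x. z n x \<le> \<bar>u x\<bar>" for n
      using clamp[OF u, of "real (Suc n)"] by (auto simp: z_def)
    note [measurable] = D_measurable[OF z(1)]
    show "(\<lambda>x. z n x * \<psi> x) \<in> borel_measurable m" for n by measurable
    show "(\<lambda>x. max (u x) 0 * \<psi> x) \<in> borel_measurable m" by measurable
    show "AE x in m. (\<lambda>n. z n x * \<psi> x) \<longlonglongrightarrow> max (u x) 0 * \<psi> x"
    proof (rule AE_I2)
      fix x
      obtain N where N: "max (u x) 0 \<le> real N" using real_arch_simple by blast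
      have "z n x = max (u x) 0" if "n \<ge> N" for n
      proof -
        have "max (u x) 0 \<le> real (Suc n)" using N that by linarith
        then show ?thesis unfolding z_def by (rule min_absorb1)
      qed
      then have "\<forall>\<^sub>F n in sequentially. z n x * \<psi> x = max (u x) 0 * \<psi> x"
        by (auto simp: eventually_sequentially)
      then show "(\<lambda>n. z n x * \<psi> x) \<longlonglongrightarrow> max (u x) 0 * \<psi> x" by (rule tendsto_eventually)
    qed
    have "(\<integral>\<^sup>+x. ennreal \<bar>z n x * \<psi> x\<bar> \<partial>m) \<le> ennreal (B * sqrt (\<E> u u))" for n
    proof -
      have ip: "integrable m (\<lambda>x. z n x * \<psi> x)" by (intro L2_mult_integrable D_L2 z \<psi>D)
      have ik: "integrable m (\<lambda>x. k x * z n x)" by (intro L2_mult_integrable D_L2 z k)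
      have iu: "integrable m (\<lambda>x. u x * k x)" by (rule finite_energy_integrable[OF \<theta> u])
      have "l2_inner m k (z n) \<le> (\<integral>x. \<bar>u x * k x\<bar> \<partial>m)"
        unfolding l2_inner_def
      proof (rule integral_mono[OF ik])
        fix x show "k x * z n x \<le> \<bar>u x * k x\<bar>"
          using mult_left_mono[OF z(4)[of n x] k(2)[of x]] k(2)[of x] by (simp add: abs_mult mult.commute)
      qed (use iu in simp)
      also have "\<dots> \<le> C * sqrt (\<E> u u)"
      proof -
        have "ennreal (\<integral>x. \<bar>u x * k x\<bar> \<partial>m) = (\<integral>\<^sup>+x. ennreal \<bar>u x * k x\<bar> \<partial>m)"
          using iu by (intro nn_integral_eq_integral[symmetric]) auto
        also have "\<dots> \<le> ennreal (C * sqrt (\<E> u u))" by (rule C(2)[OF u])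
        finally show ?thesis using C(1) form.nonneg[OF u] by (subst (asm) ennreal_le_iff) auto
      qed
      finally have 1: "l2_inner m k (z n) \<le> C * sqrt (\<E> u u)" .
      have "\<bar>\<E> \<psi> (z n)\<bar> \<le> sqrt (\<E> \<psi> \<psi>) * sqrt (\<E> (z n) (z n))"
        by (intro form.cauchy_schwarz \<psi>D z)
      also have "\<dots> \<le> sqrt (\<E> \<psi> \<psi>) * sqrt (\<E> u u)"
        using z(2)[of n] form.nonneg[OF \<psi>D] by (intro mult_left_mono) auto
      finally have 2: "- \<E> \<psi> (z n) \<le> sqrt (\<E> \<psi> \<psi>) * sqrt (\<E> u u)" by linarith
      have "\<E> \<psi> (z n) + \<alpha> * l2_inner m \<psi> (z n) = l2_inner m k (z n)"
        using r z(1) by (auto simp: is_resolvent_def)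
      then have "\<alpha> * l2_inner m \<psi> (z n) \<le> (C + sqrt (\<E> \<psi> \<psi>)) * sqrt (\<E> u u)"
        using 1 2 by (simp add: distrib_right)
      then have le: "l2_inner m \<psi> (z n) \<le> B * sqrt (\<E> u u)"
        using \<alpha> by (simp add: B_def field_simps)
      have "(\<integral>\<^sup>+x. ennreal \<bar>z n x * \<psi> x\<bar> \<partial>m) = ennreal (\<integral>x. \<bar>z n x * \<psi> x\<bar> \<partial>m)"
        using ip by (intro nn_integral_eq_integral) auto
      also have "(\<integral>x. \<bar>z n x * \<psi> x\<bar> \<partial>m) = l2_inner m \<psi> (z n)"
        unfolding l2_inner_def
        by (rule integral_cong_AE) (use \<psi>0 z(3) in \<open>auto simp: abs_mult\<close>)
      finally show ?thesis using le by (simp add: ennreal_leI)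
    qed
    then show "\<forall>\<^sub>F n in sequentially. (\<integral>\<^sup>+x. ennreal \<bar>z n x * \<psi> x\<bar> \<partial>m) \<le> ennreal (B * sqrt (\<E> u u))"
      by simp
  qed
  have "(\<integral>\<^sup>+x. ennreal \<bar>u x * \<psi> x\<bar> \<partial>m) \<le> ennreal ((2 * B) * sqrt (\<E> u u))" if u: "u \<in> D" for u
  proof -
    note [measurable] = D_measurable[OF u]
    have nu: "(\<lambda>x. -1 * u x) \<in> D" by (intro form.scale_mem u)
    have E: "\<E> (\<lambda>x. -1 * u x) (\<lambda>x. -1 * u x) = \<E> u u"
      using form.scale_left[OF u nu, of "-1"] form.scale_right[OF u u, of "-1"] by simp
    have "(\<integral>\<^sup>+x. ennreal \<bar>u x * \<psi> x\<bar> \<partial>m)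
        = (\<integral>\<^sup>+x. ennreal \<bar>max (u x) 0 * \<psi> x\<bar> + ennreal \<bar>max (-1 * u x) 0 * \<psi> x\<bar> \<partial>m)"
      by (intro nn_integral_cong) (auto simp: max_def abs_mult simp flip: ennreal_plus)
    also have "\<dots> = (\<integral>\<^sup>+x. ennreal \<bar>max (u x) 0 * \<psi> x\<bar> \<partial>m) + (\<integral>\<^sup>+x. ennreal \<bar>max (-1 * u x) 0 * \<psi> x\<bar> \<partial>m)"
      by (intro nn_integral_add) auto
    also have "\<dots> \<le> ennreal (B * sqrt (\<E> u u)) + ennreal (B * sqrt (\<E> u u))"
      using pos[OF u] pos[OF nu] unfolding E by (rule add_mono)
    also have "\<dots> = ennreal ((2 * B) * sqrt (\<E> u u))"
      using B form.nonneg[OF u] by (simp flip: ennreal_plus)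
    finally show ?thesis .
  qed
  then show ?thesis unfolding finite_energy_def using B by (intro conjI exI[of _ "2 * B"]) auto
qed

text \<open>The resolvent of \<open>\<bar>k\<bar>\<close> dominates the one of \<open>k\<close>.\<close>

lemma finite_energy_resolvent:
  assumes \<alpha>: "\<alpha> > 0" and k: "k \<in> L2 m" "\<And>x. \<bar>k x\<bar> \<le> K" and \<theta>: "finite_energy k"
    and r: "is_resolvent \<alpha> k \<psi>"
  shows "finite_energy \<psi>"
proof -
  note [measurable] = L2_measurable[OF k(1)]
  have a: "(\<lambda>x. \<bar>k x\<bar>) \<in> L2 m" by (rule L2_dominated[OF k(1)]) auto
  have ab: "\<bar>\<bar>k x\<bar>\<bar> \<le> K" for x using k(2) by simp
  have s: "0 \<le> 1 * \<bar>k x\<bar> + e * k x" "1 * \<bar>k x\<bar> + e * k x \<le> 2 * K" if "e = 1 \<or> e = -1" for x e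
    using k(2)[of x] that by auto
  obtain \<sigma> where \<sigma>: "is_resolvent \<alpha> (\<lambda>x. \<bar>k x\<bar>) \<sigma>" using resolvent_exists[OF \<alpha> a ab] by blast
  have pm: "AE x in m. 0 \<le> 1 * \<sigma> x + e * \<psi> x" if "e = 1 \<or> e = -1" for e
    by (rule resolvent_nonneg[OF \<alpha> l2.comb_mem[OF a k(1)] s[OF that] resolvent_comb[OF a k(1) \<sigma> r]])
  have \<sigma>e: "finite_energy \<sigma>"
    by (rule finite_energy_resolvent_nonneg[OF \<alpha> a _ k(2) finite_energy_dominated[OF \<theta>, of _ 1] \<sigma>]) auto
  show ?thesis
  proof (rule finite_energy_dominated[OF \<sigma>e, of _ 1])
    show "AE x in m. \<bar>\<psi> x\<bar> \<le> 1 * \<bar>\<sigma> x\<bar>"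
      using pm[of 1, simplified] pm[of "-1", simplified] by eventually_elim simp
    show "\<psi> \<in> borel_measurable m" using r by (auto simp: is_resolvent_def intro: D_measurable)
  qed simp
qed

section \<open>The extended form\<close>

text \<open>The limits \<open>L v\<close> of \<open>\<E> (us n) v\<close> form a functional that is bounded in energy, so some \<open>y \<in> D\<close>
  represents it through \<open>\<E> + (\<cdot>,\<cdot>)\<close>. It vanishes on the \<open>1\<close>-resolvent of every \<open>k\<close> between \<open>0\<close> and \<open>g\<close>,
  because such a \<open>k\<close> and its resolvent are weights of finite energy; but there its value is \<open>(k, y)\<close>.
  Hence \<open>y = 0\<close> and \<open>L = 0\<close>, and a Cauchy sequence with zero weak limit tends to zero in energy.\<close>

lemma zero_limit_energy:
  assumes us: "form.cauchy_seq us" and lim: "AE x in m. (\<lambda>n. us n x) \<longlonglongrightarrow> 0"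
  shows "(\<lambda>n. \<E> (us n) (us n)) \<longlonglongrightarrow> 0"
proof -
  have mem: "us n \<in> D" for n using us by (rule form.cauchy_seq_mem)
  define L where "L = (\<lambda>v. lim (\<lambda>n. \<E> (us n) v))"
  have L: "(\<lambda>n. \<E> (us n) v) \<longlonglongrightarrow> L v" if "v \<in> D" for v
    using form.cauchy_seq_pair_convergent[OF us form.const_cauchy_seq[OF that]]
    unfolding L_def by (simp add: convergent_LIMSEQ_iff)
  obtain B where B: "B > 0" "\<And>n. sqrt (\<E> (us n) (us n)) \<le> B"
    using form.cauchy_seq_bounded[OF us] by blast
  have LB: "\<bar>L v\<bar> \<le> B * sqrt (\<E> v v)" if v: "v \<in> D" for v
  proof (rule LIMSEQ_le_const2[OF tendsto_rabs[OF L[OF v]]])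
    have "\<bar>\<E> (us n) v\<bar> \<le> B * sqrt (\<E> v v)" for n
      using form.cauchy_schwarz[OF mem v, of n] mult_right_mono[OF B(2)[of n], of "sqrt (\<E> v v)"]
        form.nonneg[OF v] by auto
    then show "\<exists>N. \<forall>n\<ge>N. \<bar>\<E> (us n) v\<bar> \<le> B * sqrt (\<E> v v)" by blast
  qed
  define Q where "Q = weighted (\<lambda>x. 1) 1"
  interpret Q: nonneg_form D Q unfolding Q_def by (rule weighted_form) auto
  have Q: "Q u v = \<E> u v + l2_inner m u v" for u v by (simp add: Q_def weighted_def l2_inner_def)
  obtain vs where vs: "Q.cauchy_seq vs" "\<And>v. v \<in> D \<Longrightarrow> (\<lambda>n. Q (vs n) v) \<longlonglongrightarrow> L v"
  proof (rule Q.minimizing_sequence[of L "- B\<^sup>2" "\<lambda>_. True"])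
    fix u v :: "'a \<Rightarrow> real" and a b :: real assume u: "u \<in> D" and v: "v \<in> D"
    show "L (\<lambda>x. a * u x + b * v x) = a * L u + b * L v"
    proof (rule LIMSEQ_unique[OF L[OF form.comb_mem[OF u v]]])
      have "\<E> (us n) (\<lambda>x. a * u x + b * v x) = a * \<E> (us n) u + b * \<E> (us n) v" for n
        using form.sym[OF mem form.comb_mem[OF u v]] form.comb_left[OF u v mem]
          form.sym[OF u mem] form.sym[OF v mem] by simp
      then show "(\<lambda>n. \<E> (us n) (\<lambda>x. a * u x + b * v x)) \<longlonglongrightarrow> a * L u + b * L v"
        using L[OF u] L[OF v] by (auto intro!: tendsto_intros)
    qed
  next
    fix v assume v: "v \<in> D"
    define s where "s = sqrt (\<E> v v)"
    have s: "\<E> v v = s\<^sup>2" using form.nonneg[OF v] by (simp add: s_def)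
    have "0 \<le> s\<^sup>2 - 2 * (B * s) + B\<^sup>2"
      using zero_le_power2[of "s - B"] by (simp add: power2_eq_square algebra_simps)
    moreover have "L v \<le> B * s" using LB[OF v] by (simp add: s_def)
    ultimately show "- B\<^sup>2 \<le> Q v v - 2 * L v"
      using l2.nonneg[OF D_L2[OF v]] unfolding Q s by linarith
    show "\<exists>v'\<in>D. True \<and> Q v' v' - 2 * L v' \<le> Q v v - 2 * L v" using v by blast
  qed (use that in blast)
  have vmem: "vs n \<in> D" for n using vs(1) by (rule Q.cauchy_seq_mem)
  obtain y where y: "y \<in> D" "\<And>v. v \<in> D \<Longrightarrow> (\<lambda>n. \<E> (vs n) v) \<longlonglongrightarrow> \<E> y v"
    "\<And>v. v \<in> L2 m \<Longrightarrow> (\<lambda>n. l2_inner m (vs n) v) \<longlonglongrightarrow> l2_inner m y v"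
  proof (rule energy_limit[OF vmem])
    fix e :: real assume "e > 0"
    then show "\<exists>N. \<forall>i\<ge>N. \<forall>j\<ge>N. energy1 m \<E> (\<lambda>x. vs i x - vs j x) < e"
      using vs(1) unfolding Q.cauchy_seq_def energy1_def Q by blast
  qed blast
  have Ly: "\<E> y v + l2_inner m y v = L v" if v: "v \<in> D" for v
  proof (rule LIMSEQ_unique)
    show "(\<lambda>n. Q (vs n) v) \<longlonglongrightarrow> L v" by (rule vs(2)[OF v])
    show "(\<lambda>n. Q (vs n) v) \<longlonglongrightarrow> \<E> y v + l2_inner m y v"
      unfolding Q by (intro tendsto_intros y D_L2 v)
  qed
  note [measurable] = D_measurable[OF y(1)]
  have test: "l2_inner m k y = 0" if k: "k \<in> L2 m" "\<And>x. 0 \<le> k x" "\<And>x. k x \<le> g x" for k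
  proof -
    have k1: "k x \<le> 1" for x using k(3)[of x] g_le_1[of x] by linarith
    have [measurable]: "k \<in> borel_measurable m" using k(1) by (rule L2_measurable)
    have \<theta>: "finite_energy k"
      by (rule finite_energy_dominated[OF finite_energy_g, of _ 1])
         (use k g_pos in \<open>auto simp: less_imp_le\<close>)
    obtain \<psi> where \<psi>: "is_resolvent 1 k \<psi>"
      by (rule resolvent_exists[OF zero_less_one k(1)]) (use k(2) k1 in auto)
    have \<psi>D: "\<psi> \<in> D" and \<psi>eq: "\<And>v. v \<in> D \<Longrightarrow> \<E> \<psi> v + l2_inner m \<psi> v = l2_inner m k v"
      using \<psi> by (auto simp: is_resolvent_def)
    have \<theta>': "finite_energy \<psi>" by (rule finite_energy_resolvent_nonneg[OF _ k(1,2) k1 \<theta> \<psi>]) simp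
    have z: "(\<lambda>x. 0) \<in> borel_measurable m" by simp
    have "\<E> (us n) \<psi> = (\<integral>x. us n x * k x \<partial>m) - (\<integral>x. us n x * \<psi> x \<partial>m)" for n
      using \<psi>eq[OF mem[of n]] form.sym[OF \<psi>D mem[of n]] by (simp add: l2_inner_def mult.commute)
    then have "(\<lambda>n. \<E> (us n) \<psi>) \<longlonglongrightarrow> (\<integral>x. 0 * k x \<partial>m) - (\<integral>x. 0 * \<psi> x \<partial>m)"
      using tendsto_diff[OF finite_energy_limit(2)[OF \<theta> us z lim] finite_energy_limit(2)[OF \<theta>' us z lim]]
      by (simp only:)
    then have "L \<psi> = 0" using LIMSEQ_unique[OF L[OF \<psi>D]] by simp
    moreover have "l2_inner m k y = L \<psi>"
      using \<psi>eq[OF y(1)] Ly[OF \<psi>D] form.sym[OF \<psi>D y(1)] l2.sym[OF D_L2[OF \<psi>D] D_L2[OF y(1)]] by simp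
    ultimately show ?thesis by simp
  qed
  have half: "AE x in m. s * y x \<le> 0" if s: "s = 1 \<or> s = -1" for s
  proof -
    define k where "k = (\<lambda>x. min (max (s * y x) 0) (g x))"
    have [measurable]: "k \<in> borel_measurable m" by (simp add: k_def)
    have k: "k \<in> L2 m"
      by (rule L2_dominated[OF D_L2[OF y(1)]]) (use g_pos s in \<open>auto simp: k_def min_def max_def less_imp_le\<close>)
    have "l2_inner m k y = 0" using g_pos by (intro test k) (auto simp: k_def less_imp_le)
    then have "(\<integral>x. s * (k x * y x) \<partial>m) = 0" by (simp add: l2_inner_def)
    moreover have "0 \<le> s * (k x * y x)" for x
    proof (cases "s * y x \<le> 0")
      case False
      moreover have "0 \<le> k x" using g_pos[of x] by (simp add: k_def less_imp_le)
      ultimately have "0 \<le> k x * (s * y x)" by (intro mult_nonneg_nonneg[of "k x"]) linarith+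
      then show ?thesis by (simp only: mult.left_commute)
    qed (auto simp: k_def g_pos less_imp_le)
    ultimately have "AE x in m. s * (k x * y x) = 0"
      using L2_mult_integrable[OF k D_L2[OF y(1)]]
      by (subst (asm) integral_nonneg_eq_0_iff_AE) auto
    then show ?thesis
    proof eventually_elim
      case (elim x)
      then show ?case using g_pos[of x] s by (auto simp: k_def min_def max_def split: if_splits)
    qed
  qed
  have y0: "AE x in m. y x = 0"
    using half[of 1] half[of "-1"] by (auto elim: AE_mp)
  have L0: "L v = 0" if v: "v \<in> D" for v
  proof -
    have "\<E> y v = \<E> (\<lambda>x. 0) v" by (rule D_AE_cong(2)[OF y(1) _ y0 v]) simp
    also have "\<dots> = 0" using form.scale_left[OF v v, of 0] by simp
    finally have "\<E> y v = 0" .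
    moreover have "l2_inner m y v = 0"
      unfolding l2_inner_def by (rule integral_eq_zero_AE) (use y0 in auto)
    ultimately show ?thesis using Ly[OF v] by simp
  qed
  show ?thesis
    by (rule form.cauchy_seq_diagonal_limit[OF us us, of "\<lambda>v. 0"]) (use L L0 in auto)
qed

lemma approximating_seq_iff:
  "approximating_seq m D \<E> us u \<longleftrightarrow> form.cauchy_seq us \<and> (AE x in m. (\<lambda>n. us n x) \<longlonglongrightarrow> u x)"
  by (auto simp: approximating_seq_def form.cauchy_seq_def)

text \<open>Two approximating sequences of one function differ by a sequence of vanishing energy, so the
  limit in the definition of the extended form exists and is unique.\<close>

lemma ext_form_limit:
  assumes us: "approximating_seq m D \<E> us u" and vs: "approximating_seq m D \<E> vs v"
  shows "(\<lambda>n. \<E> (us n) (vs n)) \<longlonglongrightarrow> ext_form m D \<E> u v"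
proof -
  have cu: "form.cauchy_seq us" and cv: "form.cauchy_seq vs"
    using us vs by (auto simp: approximating_seq_iff)
  obtain l where l: "(\<lambda>n. \<E> (us n) (vs n)) \<longlonglongrightarrow> l"
    using form.cauchy_seq_pair_convergent[OF cu cv] by (auto simp: convergent_def)
  have null: "(\<lambda>n. form.dist_sq (ws n) (ws' n)) \<longlonglongrightarrow> 0"
    if "approximating_seq m D \<E> ws w" "approximating_seq m D \<E> ws' w" for ws ws' w
  proof (rule zero_limit_energy)
    show "form.cauchy_seq (\<lambda>n x. ws n x - ws' n x)"
      using that by (intro form.cauchy_seq_diff) (auto simp: approximating_seq_iff)
    show "AE x in m. (\<lambda>n. ws n x - ws' n x) \<longlonglongrightarrow> 0"
    proof -
      have "AE x in m. (\<lambda>n. ws n x) \<longlonglongrightarrow> w x" "AE x in m. (\<lambda>n. ws' n x) \<longlonglongrightarrow> w x"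
        using that by (auto simp: approximating_seq_iff)
      then show ?thesis
      proof eventually_elim
        case (elim x)
        then show ?case using tendsto_diff[OF elim] by simp
      qed
    qed
  qed
  have "(\<lambda>n. \<E> (us' n) (vs' n)) \<longlonglongrightarrow> l"
    if us': "approximating_seq m D \<E> us' u" and vs': "approximating_seq m D \<E> vs' v" for us' vs'
  proof -
    have cu': "form.cauchy_seq us'" and cv': "form.cauchy_seq vs'"
      using us' vs' by (auto simp: approximating_seq_iff)
    note mem = form.cauchy_seq_mem[OF cu] form.cauchy_seq_mem[OF cv]
      form.cauchy_seq_mem[OF cu'] form.cauchy_seq_mem[OF cv']
    obtain B where B: "B > 0" "\<And>n. sqrt (\<E> (vs n) (vs n)) \<le> B"
      using form.cauchy_seq_bounded[OF cv] by blast
    obtain B' where B': "B' > 0" "\<And>n. sqrt (\<E> (us' n) (us' n)) \<le> B'"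
      using form.cauchy_seq_bounded[OF cu'] by blast
    have lim1: "(\<lambda>n. \<E> (\<lambda>x. us' n x - us n x) (vs n)) \<longlonglongrightarrow> 0"
    proof (rule Lim_null_comparison)
      show "\<forall>\<^sub>F n in sequentially. norm (\<E> (\<lambda>x. us' n x - us n x) (vs n))
          \<le> sqrt (form.dist_sq (us' n) (us n)) * B"
      proof (rule always_eventually, rule allI)
        fix n
        have d: "(\<lambda>x. us' n x - us n x) \<in> D" by (intro form.diff_mem mem)
        show "norm (\<E> (\<lambda>x. us' n x - us n x) (vs n))
          \<le> sqrt (form.dist_sq (us' n) (us n)) * B"
          using form.cauchy_schwarz[OF d mem(2)[of n]]
            mult_left_mono[OF B(2)[of n], of "sqrt (form.dist_sq (us' n) (us n))"]
            form.nonneg[OF d] by auto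
      qed
      show "(\<lambda>n. sqrt (form.dist_sq (us' n) (us n)) * B) \<longlonglongrightarrow> 0"
        using tendsto_real_sqrt[OF null[OF us' us]] by (auto intro!: tendsto_mult_left_zero)
    qed
    have lim2: "(\<lambda>n. \<E> (us' n) (\<lambda>x. vs' n x - vs n x)) \<longlonglongrightarrow> 0"
    proof (rule Lim_null_comparison)
      show "\<forall>\<^sub>F n in sequentially. norm (\<E> (us' n) (\<lambda>x. vs' n x - vs n x))
          \<le> B' * sqrt (form.dist_sq (vs' n) (vs n))"
      proof (rule always_eventually, rule allI)
        fix n
        have d: "(\<lambda>x. vs' n x - vs n x) \<in> D" by (intro form.diff_mem mem)
        show "norm (\<E> (us' n) (\<lambda>x. vs' n x - vs n x))
          \<le> B' * sqrt (form.dist_sq (vs' n) (vs n))"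
          using form.cauchy_schwarz[OF mem(3)[of n] d]
            mult_right_mono[OF B'(2)[of n], of "sqrt (form.dist_sq (vs' n) (vs n))"]
            form.nonneg[OF d] by auto
      qed
      show "(\<lambda>n. B' * sqrt (form.dist_sq (vs' n) (vs n))) \<longlonglongrightarrow> 0"
        using tendsto_real_sqrt[OF null[OF vs' vs]] by (auto intro!: tendsto_mult_right_zero)
    qed
    have "(\<lambda>n. \<E> (us n) (vs n) + (\<E> (\<lambda>x. us' n x - us n x) (vs n) + \<E> (us' n) (\<lambda>x. vs' n x - vs n x)))
        \<longlonglongrightarrow> l + (0 + 0)"
      by (intro tendsto_add l lim1 lim2)
    then show ?thesis using mem by (simp add: form.diff_left form.diff_right)
  qed
  then have "ext_form m D \<E> u v = l"
    unfolding ext_form_def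
  proof (intro the_equality allI impI)
    fix k assume "\<forall>us vs. approximating_seq m D \<E> us u \<longrightarrow> approximating_seq m D \<E> vs v \<longrightarrow>
                    (\<lambda>n. \<E> (us n) (vs n)) \<longlonglongrightarrow> k"
    then have "(\<lambda>n. \<E> (us n) (vs n)) \<longlonglongrightarrow> k" using us vs by blast
    then show "k = l" using l by (rule LIMSEQ_unique)
  qed
  with l show ?thesis by simp
qed

text \<open>The sequence \<open>us\<close> need not converge in \<open>L\<^sup>1(h m)\<close>, but its truncations do, by boundedness.
  Both give the same limit against resolvents of functions dominated by a multiple of \<open>g\<close>, and such
  functions are dense in \<open>L\<^sup>2\<close>.\<close>

lemma bounded_limit_resolvent:
  assumes us: "form.cauchy_seq us" and lim: "AE x in m. (\<lambda>n. us n x) \<longlonglongrightarrow> w x"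
    and [measurable]: "w \<in> borel_measurable m" and w: "\<And>x. \<bar>w x\<bar> \<le> K" and K: "0 < K"
    and \<alpha>: "\<alpha> > 0" and h: "integrable m h" "\<And>x. \<bar>h x\<bar> \<le> H"
    and r: "is_resolvent \<alpha> h \<psi>"
  shows "(\<lambda>n. \<E> (us n) \<psi>) \<longlonglongrightarrow> (\<integral>x. w x * (h x - \<alpha> * \<psi> x) \<partial>m)"
proof -
  have mem: "us n \<in> D" for n using us by (rule form.cauchy_seq_mem)
  note [measurable] = D_measurable[OF mem]
  have [measurable]: "h \<in> borel_measurable m" using h(1) by auto
  obtain B where B: "B > 0" "\<And>n. sqrt (\<E> (us n) (us n)) \<le> B"
    using form.cauchy_seq_bounded[OF us] by blast
  define zs where "zs = (\<lambda>n x. max (min (us n x) K) (- K))"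
  have zmem: "zs n \<in> D" and zE: "\<E> (zs n) (zs n) \<le> \<E> (us n) (us n)" for n
    unfolding zs_def using cut[OF mem, of K K] K by auto
  note [measurable] = D_measurable[OF zmem]
  have zK: "\<bar>zs n x\<bar> \<le> K" for n x using K by (auto simp: zs_def)
  have zlim: "AE x in m. (\<lambda>n. zs n x) \<longlonglongrightarrow> w x"
    using lim
  proof eventually_elim
    case (elim x)
    have "(\<lambda>n. zs n x) \<longlonglongrightarrow> max (min (w x) K) (- K)"
      unfolding zs_def by (intro tendsto_intros elim)
    also have "max (min (w x) K) (- K) = w x" using w[of x] K by auto
    finally show ?case .
  qed
  define ys where "ys = (\<lambda>n x. us n x - zs n x)"
  have ymem: "ys n \<in> D" for n unfolding ys_def by (intro form.diff_mem mem zmem)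
  have yE: "sqrt (\<E> (ys n) (ys n)) \<le> 2 * B" for n
  proof -
    have "\<E> (ys n) (ys n) \<le> 2 * \<E> (us n) (us n) + 2 * \<E> (zs n) (zs n)"
      unfolding ys_def by (intro form.quad_diff_le mem zmem)
    also have "\<dots> \<le> 4 * \<E> (us n) (us n)" using zE[of n] by linarith
    finally have "sqrt (\<E> (ys n) (ys n)) \<le> sqrt (4 * \<E> (us n) (us n))" by (rule real_sqrt_le_mono)
    also have "\<dots> = 2 * sqrt (\<E> (us n) (us n))" by (simp add: real_sqrt_mult)
    finally show ?thesis using B(2)[of n] by linarith
  qed
  have zconv: "(\<lambda>n. \<E> (zs n) \<sigma>) \<longlonglongrightarrow> (\<integral>x. w x * (k x - \<alpha> * \<sigma> x) \<partial>m)"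
    if k: "integrable m k" "\<And>x. \<bar>k x\<bar> \<le> H'" and \<sigma>: "is_resolvent \<alpha> k \<sigma>" for k \<sigma> H'
  proof -
    have kL: "k \<in> L2 m" using k by (rule L2_bounded_integrable)
    have \<sigma>D: "\<sigma> \<in> D" and eq: "\<And>v. v \<in> D \<Longrightarrow> \<E> \<sigma> v + \<alpha> * l2_inner m \<sigma> v = l2_inner m k v"
      using \<sigma> by (auto simp: is_resolvent_def)
    have \<sigma>i: "integrable m \<sigma>" by (rule resolvent_integrable[OF \<alpha> k \<sigma>])
    have qi: "integrable m (\<lambda>x. k x - \<alpha> * \<sigma> x)" using k \<sigma>i by simp
    have [measurable]: "k \<in> borel_measurable m" "\<sigma> \<in> borel_measurable m" using k \<sigma>i by auto
    have e: "\<E> (zs n) \<sigma> = (\<integral>x. zs n x * (k x - \<alpha> * \<sigma> x) \<partial>m)" for n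
    proof -
      have "(\<integral>x. zs n x * (k x - \<alpha> * \<sigma> x) \<partial>m) = (\<integral>x. k x * zs n x - \<alpha> * (\<sigma> x * zs n x) \<partial>m)"
        by (simp add: algebra_simps)
      also have "\<dots> = l2_inner m k (zs n) - \<alpha> * l2_inner m \<sigma> (zs n)"
        unfolding l2_inner_def
        using L2_mult_integrable[OF kL D_L2[OF zmem]] L2_mult_integrable[OF D_L2[OF \<sigma>D] D_L2[OF zmem]]
        by simp
      finally show ?thesis using eq[OF zmem[of n]] form.sym[OF zmem \<sigma>D, of n] by simp
    qed
    show ?thesis unfolding e
    proof (rule integral_dominated_convergence)
      show "integrable m (\<lambda>x. K * \<bar>k x - \<alpha> * \<sigma> x\<bar>)" using qi by simp
      show "AE x in m. norm (zs n x * (k x - \<alpha> * \<sigma> x)) \<le> K * \<bar>k x - \<alpha> * \<sigma> x\<bar>" for n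
        using zK by (auto simp: abs_mult intro!: AE_I2 mult_right_mono)
      show "AE x in m. (\<lambda>n. zs n x * (k x - \<alpha> * \<sigma> x)) \<longlonglongrightarrow> w x * (k x - \<alpha> * \<sigma> x)"
        using zlim by eventually_elim (intro tendsto_intros)
    qed measurable
  qed
  have uconv: "(\<lambda>n. \<E> (us n) \<sigma>) \<longlonglongrightarrow> (\<integral>x. w x * (k x - \<alpha> * \<sigma> x) \<partial>m)"
    if k: "k \<in> L2 m" "\<And>x. \<bar>k x\<bar> \<le> H'" "finite_energy k" and \<sigma>: "is_resolvent \<alpha> k \<sigma>" for k \<sigma> H'
  proof -
    have \<sigma>D: "\<sigma> \<in> D" and eq: "\<And>v. v \<in> D \<Longrightarrow> \<E> \<sigma> v + \<alpha> * l2_inner m \<sigma> v = l2_inner m k v"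
      using \<sigma> by (auto simp: is_resolvent_def)
    have \<sigma>e: "finite_energy \<sigma>" by (rule finite_energy_resolvent[OF \<alpha> k \<sigma>])
    note limk = finite_energy_limit[OF k(3) us _ lim] and lims = finite_energy_limit[OF \<sigma>e us _ lim]
    have e: "\<E> (us n) \<sigma> = (\<integral>x. us n x * k x \<partial>m) - \<alpha> * (\<integral>x. us n x * \<sigma> x \<partial>m)" for n
      using eq[OF mem[of n]] form.sym[OF mem \<sigma>D, of n] by (simp add: l2_inner_def mult.commute)
    have "(\<lambda>n. \<E> (us n) \<sigma>) \<longlonglongrightarrow> (\<integral>x. w x * k x \<partial>m) - \<alpha> * (\<integral>x. w x * \<sigma> x \<partial>m)"
      unfolding e using limk lims by (intro tendsto_intros) auto
    also have "(\<integral>x. w x * k x \<partial>m) - \<alpha> * (\<integral>x. w x * \<sigma> x \<partial>m) = (\<integral>x. w x * k x - \<alpha> * (w x * \<sigma> x) \<partial>m)"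
      using limk lims by simp
    also have "\<dots> = (\<integral>x. w x * (k x - \<alpha> * \<sigma> x) \<partial>m)" by (simp add: algebra_simps)
    finally show ?thesis .
  qed
  have hL: "h \<in> L2 m" using h by (rule L2_bounded_integrable)
  have \<psi>D: "\<psi> \<in> D" using r by (simp add: is_resolvent_def)
  define k where "k = (\<lambda>j x. max (min (h x) (real j * g x)) (- (real j * g x)))"
  have jg: "0 \<le> real j * g x" for j x using g_pos[of x] by simp
  have k: "\<bar>k j x\<bar> \<le> \<bar>h x\<bar>" "\<bar>k j x\<bar> \<le> H" "\<bar>k j x\<bar> \<le> real j * g x"
      "\<bar>h x - k j x\<bar> \<le> \<bar>h x\<bar>" for j x
    using h(2)[of x] jg[of j x] by (auto simp: k_def min_def max_def)
  have [measurable]: "k j \<in> borel_measurable m" for j by (simp add: k_def)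
  have ki: "integrable m (k j)" for j
    by (rule Bochner_Integration.integrable_bound[OF h(1)]) (use k(1) in auto)
  have kL: "k j \<in> L2 m" for j using ki k(2) by (rule L2_bounded_integrable)
  have ke: "finite_energy (k j)" for j
    by (rule finite_energy_dominated[OF finite_energy_g, of _ "real j"])
       (use k(3) g_pos in \<open>auto simp: less_imp_le\<close>)
  have "\<exists>\<sigma>. is_resolvent \<alpha> (k j) \<sigma>" for j using resolvent_exists[OF \<alpha> kL k(2)] by metis
  then obtain \<sigma> where \<sigma>: "\<And>j. is_resolvent \<alpha> (k j) (\<sigma> j)" by metis
  have \<sigma>D: "\<sigma> j \<in> D" for j using \<sigma> by (simp add: is_resolvent_def)
  have "(\<lambda>j. \<integral>x. (h x - k j x) * (h x - k j x) \<partial>m) \<longlonglongrightarrow> (\<integral>x. 0 \<partial>m)"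
  proof (rule integral_dominated_convergence)
    show "integrable m (\<lambda>x. h x * h x)" by (intro L2_mult_integrable hL)
    show "AE x in m. norm ((h x - k j x) * (h x - k j x)) \<le> h x * h x" for j
      using k(4) by (simp add: abs_le_square_iff flip: power2_eq_square)
    show "AE x in m. (\<lambda>j. (h x - k j x) * (h x - k j x)) \<longlonglongrightarrow> 0"
    proof (rule AE_I2)
      fix x
      obtain N where "\<bar>h x\<bar> / g x \<le> real N" using real_arch_simple by blast
      then have N: "\<bar>h x\<bar> \<le> real N * g x" using g_pos[of x] by (simp add: field_simps)
      have "k j x = h x" if "j \<ge> N" for j
      proof -
        have "real N * g x \<le> real j * g x" using that g_pos[of x] by (intro mult_right_mono) auto
        then show ?thesis using N by (auto simp: k_def)
      qed
      then have "\<forall>\<^sub>F j in sequentially. (h x - k j x) * (h x - k j x) = 0"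
        by (intro eventually_sequentiallyI[of N]) simp
      then show "(\<lambda>j. (h x - k j x) * (h x - k j x)) \<longlonglongrightarrow> 0" by (rule tendsto_eventually)
    qed
  qed auto
  then have dist0: "(\<lambda>j. l2.dist_sq m h (k j)) \<longlonglongrightarrow> 0"
    by (simp add: l2_inner_def)
  have ylim: "(\<lambda>n. \<E> (ys n) \<psi>) \<longlonglongrightarrow> 0"
  proof (rule LIMSEQ_I)
    fix e :: real assume e: "0 < e"
    have "(\<lambda>j. 2 * B * sqrt (l2.dist_sq m h (k j) / \<alpha>)) \<longlonglongrightarrow> 2 * B * sqrt (0 / \<alpha>)"
      by (intro tendsto_intros dist0) (use \<alpha> in auto)
    then have "\<forall>\<^sub>F j in sequentially.
        2 * B * sqrt (l2.dist_sq m h (k j) / \<alpha>) < e / 2"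
      by (rule order_tendstoD) (use e in simp)
    then obtain j where
      j: "2 * B * sqrt (l2.dist_sq m h (k j) / \<alpha>) < e / 2"
      by (auto simp: eventually_sequentially)
    have "(\<lambda>n. \<E> (us n) (\<sigma> j) - \<E> (zs n) (\<sigma> j)) \<longlonglongrightarrow>
       (\<integral>x. w x * (k j x - \<alpha> * \<sigma> j x) \<partial>m) - (\<integral>x. w x * (k j x - \<alpha> * \<sigma> j x) \<partial>m)"
      by (intro tendsto_diff uconv[OF kL k(2) ke \<sigma>] zconv[OF ki k(2) \<sigma>])
    then have "(\<lambda>n. \<E> (ys n) (\<sigma> j)) \<longlonglongrightarrow> 0"
      unfolding ys_def using mem zmem \<sigma>D by (simp add: form.diff_left)
    from LIMSEQ_D[OF this, of "e/2"] obtain N where N: "\<And>n. n \<ge> N \<Longrightarrow> \<bar>\<E> (ys n) (\<sigma> j)\<bar> < e / 2"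
      using e by auto
    show "\<exists>no. \<forall>n\<ge>no. norm (\<E> (ys n) \<psi> - 0) < e"
    proof (intro exI[of _ N] allI impI)
      fix n assume n: "n \<ge> N"
      let ?d = "\<lambda>x. \<psi> x - \<sigma> j x"
      have d: "?d \<in> D" by (intro form.diff_mem \<psi>D \<sigma>D)
      have hk: "(\<lambda>x. h x - k j x) \<in> L2 m" by (intro l2.diff_mem hL kL)
      have "\<E> ?d ?d \<le> l2.dist_sq m h (k j) / \<alpha>"
        by (rule resolvent_norm_le(2)[OF \<alpha> hk resolvent_diff[OF hL kL r \<sigma>]])
      then have sq: "sqrt (\<E> ?d ?d) \<le> sqrt (l2.dist_sq m h (k j) / \<alpha>)"
        by (rule real_sqrt_le_mono)
      have "\<bar>\<E> (ys n) ?d\<bar> \<le> sqrt (\<E> (ys n) (ys n)) * sqrt (\<E> ?d ?d)"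
        by (intro form.cauchy_schwarz ymem d)
      also have "\<dots> \<le> (2 * B) * sqrt (l2.dist_sq m h (k j) / \<alpha>)"
        using B(1) form.nonneg[OF d] by (intro mult_mono yE sq) auto
      finally have "\<bar>\<E> (ys n) ?d\<bar> < e / 2" using j by simp
      moreover have "\<E> (ys n) \<psi> = \<E> (ys n) ?d + \<E> (ys n) (\<sigma> j)"
        using ymem \<psi>D \<sigma>D by (simp add: form.diff_right)
      ultimately show "norm (\<E> (ys n) \<psi> - 0) < e" using N[OF n] by simp
    qed
  qed
  have "(\<lambda>n. \<E> (ys n) \<psi> + \<E> (zs n) \<psi>) \<longlonglongrightarrow> 0 + (\<integral>x. w x * (h x - \<alpha> * \<psi> x) \<partial>m)"
    by (intro tendsto_add ylim zconv[OF h r])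
  then show ?thesis unfolding ys_def using mem zmem \<psi>D by (simp add: form.diff_left)
qed

section \<open>Potentials\<close>

text \<open>The limit \<open>\<psi>\<close> is the potential of the density \<open>q\<close>. It belongs to the extended space, in general
  not to \<open>D\<close>; the sequence is recorded because the energy identities for \<open>\<psi>\<close> are limits along it.\<close>

definition potential_seq :: "(nat \<Rightarrow> 'a \<Rightarrow> real) \<Rightarrow> ('a \<Rightarrow> real) \<Rightarrow> ('a \<Rightarrow> real) \<Rightarrow> bool" where
  "potential_seq vs q \<psi> \<longleftrightarrow> approximating_seq m D \<E> vs \<psi> \<and> \<psi> \<in> borel_measurable m \<and>
     finite_energy q \<and> (\<forall>v\<in>D. (\<lambda>n. \<E> (vs n) v) \<longlonglongrightarrow> (\<integral>x. v x * q x \<partial>m))"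

lemma potential_ext_form:
  assumes vs: "potential_seq vs q \<psi>" and us: "approximating_seq m D \<E> us u"
    and [measurable]: "u \<in> borel_measurable m"
  shows "integrable m (\<lambda>x. u x * q x)" "ext_form m D \<E> u \<psi> = (\<integral>x. u x * q x \<partial>m)"
proof -
  have cu: "form.cauchy_seq us" and lim: "AE x in m. (\<lambda>n. us n x) \<longlonglongrightarrow> u x"
    using us by (auto simp: approximating_seq_iff)
  have cv: "form.cauchy_seq vs" and av: "approximating_seq m D \<E> vs \<psi>" and q: "finite_energy q"
    using vs by (auto simp: approximating_seq_iff potential_seq_def)
  note l = finite_energy_limit[OF q cu _ lim]
  show "integrable m (\<lambda>x. u x * q x)" by (rule l(1)) simp
  have "(\<lambda>n. \<E> (us n) (vs n)) \<longlonglongrightarrow> (\<integral>x. u x * q x \<partial>m)"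
    by (rule form.cauchy_seq_diagonal_limit[OF cu cv _ l(2)]) (use vs in \<open>auto simp: potential_seq_def\<close>)
  then show "ext_form m D \<E> u \<psi> = (\<integral>x. u x * q x \<partial>m)"
    using ext_form_limit[OF us av] by (blast intro: LIMSEQ_unique)
qed

lemma potential_energy:
  assumes vs: "potential_seq vs q \<psi>"
  shows "0 \<le> (\<integral>x. \<psi> x * q x \<partial>m)"
    and "(\<integral>\<^sup>+x. ennreal \<bar>\<psi> x * g x\<bar> \<partial>m) \<le> ennreal (c * sqrt (\<integral>x. \<psi> x * q x \<partial>m))"
proof -
  have cv: "form.cauchy_seq vs" and lim: "AE x in m. (\<lambda>n. vs n x) \<longlonglongrightarrow> \<psi> x" and q: "finite_energy q"
    and [measurable]: "\<psi> \<in> borel_measurable m"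
    using vs by (auto simp: approximating_seq_iff potential_seq_def)
  have mem: "vs n \<in> D" for n using cv by (rule form.cauchy_seq_mem)
  note [measurable] = D_measurable[OF mem]
  have E: "(\<lambda>n. \<E> (vs n) (vs n)) \<longlonglongrightarrow> (\<integral>x. \<psi> x * q x \<partial>m)"
    by (rule form.cauchy_seq_diagonal_limit[OF cv cv _ finite_energy_limit(2)[OF q cv _ lim]])
       (use vs in \<open>auto simp: potential_seq_def\<close>)
  show "0 \<le> (\<integral>x. \<psi> x * q x \<partial>m)"
    by (rule LIMSEQ_le_const[OF E]) (auto intro: form.nonneg mem)
  show "(\<integral>\<^sup>+x. ennreal \<bar>\<psi> x * g x\<bar> \<partial>m) \<le> ennreal (c * sqrt (\<integral>x. \<psi> x * q x \<partial>m))"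
  proof (rule ennreal_le_epsilon)
    fix e :: real assume e: "0 < e"
    have "(\<lambda>n. c * sqrt (\<E> (vs n) (vs n))) \<longlonglongrightarrow> c * sqrt (\<integral>x. \<psi> x * q x \<partial>m)"
      by (intro tendsto_intros E)
    then have ev: "\<forall>\<^sub>F n in sequentially. c * sqrt (\<E> (vs n) (vs n)) < c * sqrt (\<integral>x. \<psi> x * q x \<partial>m) + e"
      by (rule order_tendstoD) (use e in simp)
    have "(\<integral>\<^sup>+x. ennreal \<bar>\<psi> x * g x\<bar> \<partial>m) \<le> ennreal (c * sqrt (\<integral>x. \<psi> x * q x \<partial>m) + e)"
    proof (rule nn_integral_Fatou_bound)
      show "AE x in m. (\<lambda>n. vs n x * g x) \<longlonglongrightarrow> \<psi> x * g x"
        using lim by eventually_elim (intro tendsto_intros)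
      show "\<forall>\<^sub>F n in sequentially. (\<integral>\<^sup>+x. ennreal \<bar>vs n x * g x\<bar> \<partial>m)
             \<le> ennreal (c * sqrt (\<integral>x. \<psi> x * q x \<partial>m) + e)"
        using ev by eventually_elim (intro order_trans[OF transient[OF mem]] ennreal_leI less_imp_le)
    qed auto
    then show "(\<integral>\<^sup>+x. ennreal \<bar>\<psi> x * g x\<bar> \<partial>m) \<le> ennreal (c * sqrt (\<integral>x. \<psi> x * q x \<partial>m)) + ennreal e"
      using e c_pos \<open>0 \<le> (\<integral>x. \<psi> x * q x \<partial>m)\<close> by (simp add: ennreal_plus)
  qed
qed

lemma potential_resolvent:
  assumes vs: "potential_seq vs q \<psi>" and \<psi>: "\<And>x. \<bar>\<psi> x\<bar> \<le> K" and K: "0 < K"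
    and \<alpha>: "\<alpha> > 0" and h: "integrable m h" "\<And>x. \<bar>h x\<bar> \<le> H"
    and r: "is_resolvent \<alpha> h \<sigma>"
  shows "(\<integral>x. \<psi> x * (h x - \<alpha> * \<sigma> x) \<partial>m) = (\<integral>x. \<sigma> x * q x \<partial>m)"
proof (rule LIMSEQ_unique)
  show "(\<lambda>n. \<E> (vs n) \<sigma>) \<longlonglongrightarrow> (\<integral>x. \<psi> x * (h x - \<alpha> * \<sigma> x) \<partial>m)"
    by (rule bounded_limit_resolvent[OF _ _ _ \<psi> K \<alpha> h r])
       (use vs in \<open>auto simp: approximating_seq_iff potential_seq_def\<close>)
  show "(\<lambda>n. \<E> (vs n) \<sigma>) \<longlonglongrightarrow> (\<integral>x. \<sigma> x * q x \<partial>m)"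
    using vs r by (auto simp: potential_seq_def is_resolvent_def)
qed

text \<open>The function \<open>\<psi>\<close> is \<open>\<beta>\<close> times the \<open>\<beta>\<close>-resolvent of \<open>h\<close> for the form considered on \<open>L\<^sup>2(\<rho> m)\<close>
  (a time change of the process). Its density vanishes where \<open>\<rho>\<close> does, while its bound is
  that of \<open>h\<close> for every \<open>\<beta>\<close>.\<close>

lemma weighted_potential_exists:
  assumes [measurable]: "\<rho> \<in> borel_measurable m" and \<rho>: "\<And>x. 0 \<le> \<rho> x" "\<And>x. \<rho> x \<le> g x"
    and \<rho>i: "integrable m \<rho>" and \<beta>: "0 < \<beta>" and K: "0 < K"
    and [measurable]: "h \<in> borel_measurable m" and h: "\<And>x. \<bar>h x\<bar> \<le> K"
  obtains vs \<psi> where "potential_seq vs (\<lambda>x. \<beta> * (\<rho> x * (h x - \<psi> x))) \<psi>" "\<And>x. \<bar>\<psi> x\<bar> \<le> K"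
proof -
  have \<rho>1: "\<rho> x \<le> 1" for x using \<rho>(2)[of x] g_le_1[of x] by linarith
  have i: "integrable m (\<lambda>x. \<rho> x * (h x * h x))"
  proof (rule Bochner_Integration.integrable_bound)
    show "integrable m (\<lambda>x. (K * K) * \<rho> x)" using \<rho>i by simp
    have "\<rho> x * \<bar>h x * h x\<bar> \<le> \<rho> x * (K * K)" for x
      unfolding abs_mult by (intro mult_left_mono mult_mono h \<rho>) (use K in auto)
    then show "AE x in m. norm (\<rho> x * (h x * h x)) \<le> norm (K * K * \<rho> x)"
      using \<rho>(1) K by (auto simp: abs_mult mult.commute mult.left_commute)
  qed measurable
  interpret Q: nonneg_form D "weighted \<rho> \<beta>" using \<rho> \<rho>1 \<beta> by (intro weighted_form) auto
  obtain us where us: "Q.cauchy_seq us" "\<And>n x. \<bar>us n x\<bar> \<le> K"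
    and lim: "\<And>v. v \<in> D \<Longrightarrow> (\<lambda>n. weighted \<rho> \<beta> (us n) v) \<longlonglongrightarrow> \<beta> * (\<integral>x. \<rho> x * (h x * v x) \<partial>m)"
  proof (rule weighted_minimizer[of \<rho> \<beta> K K h])
    show "- K \<le> h x" "h x \<le> K" for x using h[of x] by auto
  qed (use \<rho>(1) \<rho>1 \<beta> K i in \<open>auto simp: abs_le_iff minus_le_iff\<close>)
  have mem: "us n \<in> D" for n using us(1) by (rule Q.cauchy_seq_mem)
  note [measurable] = D_measurable[OF mem]
  have cu: "form.cauchy_seq us"
    unfolding form.cauchy_seq_def
  proof (intro conjI allI impI mem)
    fix e :: real assume "e > 0"
    then obtain N where N: "\<forall>i\<ge>N. \<forall>j\<ge>N. weighted \<rho> \<beta> (\<lambda>x. us i x - us j x) (\<lambda>x. us i x - us j x) < e"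
      using us(1) unfolding Q.cauchy_seq_def by blast
    have "\<E> v v \<le> weighted \<rho> \<beta> v v" for v
      unfolding weighted_def using \<beta> \<rho> by (auto intro!: mult_nonneg_nonneg integral_nonneg_AE)
    then show "\<exists>N. \<forall>i\<ge>N. \<forall>j\<ge>N. form.dist_sq (us i) (us j) < e"
      using N by (meson le_less_trans)
  qed
  obtain r where r: "strict_mono r" "AE x in m. Cauchy (\<lambda>n. us (r n) x * g x)"
  proof (rule cauchy_L1_AE_cauchy_subseq[of m "\<lambda>n x. us n x * g x"])
    show "integrable m (\<lambda>x. us n x * g x)" for n by (intro finite_energy_integrable finite_energy_g mem)
    fix e :: real assume e: "e > 0"
    then have "e / c > 0" using c_pos by simp
    then obtain N where N: "\<And>i j. i \<ge> N \<Longrightarrow> j \<ge> N \<Longrightarrow>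
         sqrt (form.dist_sq (us i) (us j)) < e / c"
      using form.cauchy_seqD[OF cu] by blast
    show "\<exists>N. \<forall>i\<ge>N. \<forall>j\<ge>N. (\<integral>x. norm (us i x * g x - us j x * g x) \<partial>m) < e"
    proof (intro exI[of _ N] allI impI)
      fix i j assume ij: "i \<ge> N" "j \<ge> N"
      have d: "(\<lambda>x. us i x - us j x) \<in> D" by (intro form.diff_mem mem)
      have "ennreal (\<integral>x. \<bar>(us i x - us j x) * g x\<bar> \<partial>m) = (\<integral>\<^sup>+x. ennreal \<bar>(us i x - us j x) * g x\<bar> \<partial>m)"
        using finite_energy_integrable[OF finite_energy_g d]
        by (intro nn_integral_eq_integral[symmetric]) auto
      also have "\<dots> \<le> ennreal (c * sqrt (form.dist_sq (us i) (us j)))"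
        by (rule transient[OF d])
      finally have "(\<integral>x. \<bar>(us i x - us j x) * g x\<bar> \<partial>m) \<le> c * sqrt (form.dist_sq (us i) (us j))"
        using c_pos form.nonneg[OF d] by (subst (asm) ennreal_le_iff) auto
      also have "\<dots> < e" using N[OF ij] c_pos by (simp add: field_simps)
      finally show "(\<integral>x. norm (us i x * g x - us j x * g x) \<partial>m) < e"
        by (simp add: left_diff_distrib)
    qed
  qed
  define vs where "vs = (\<lambda>n. us (r n))"
  define \<psi> where "\<psi> = (\<lambda>x. max (min (lim (\<lambda>n. us (r n) x)) K) (- K))"
  have [measurable]: "\<psi> \<in> borel_measurable m" unfolding \<psi>_def by measurable
  have \<psi>K: "\<bar>\<psi> x\<bar> \<le> K" for x using K by (auto simp: \<psi>_def)
  have cv: "form.cauchy_seq vs" unfolding vs_def by (rule form.cauchy_seq_subseq[OF cu r(1)])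
  have vlim: "AE x in m. (\<lambda>n. vs n x) \<longlonglongrightarrow> \<psi> x"
    using r(2)
  proof eventually_elim
    case (elim x)
    then obtain l where l: "(\<lambda>n. us (r n) x * g x) \<longlonglongrightarrow> l"
      by (auto simp: Cauchy_convergent_iff convergent_def)
    have "(\<lambda>n. us (r n) x * g x / g x) \<longlonglongrightarrow> l / g x"
      by (intro tendsto_intros l) (use g_pos[of x] in auto)
    then have l': "(\<lambda>n. us (r n) x) \<longlonglongrightarrow> l / g x" using g_pos[of x] by simp
    then have "lim (\<lambda>n. us (r n) x) = l / g x" by (rule limI)
    moreover have "l / g x \<le> K" "- K \<le> l / g x"
      using us(2) by (auto intro!: LIMSEQ_le_const[OF l'] LIMSEQ_le_const2[OF l'] simp: abs_le_iff minus_le_iff)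
    ultimately have "\<psi> x = l / g x" by (simp add: \<psi>_def)
    then show ?case using l' by (simp add: vs_def)
  qed
  show ?thesis
  proof (rule that[OF _ \<psi>K], unfold potential_seq_def, intro conjI ballI)
    show "approximating_seq m D \<E> vs \<psi>" using cv vlim by (simp add: approximating_seq_iff)
    show "\<psi> \<in> borel_measurable m" by measurable
    show "finite_energy (\<lambda>x. \<beta> * (\<rho> x * (h x - \<psi> x)))"
    proof (rule finite_energy_dominated[OF finite_energy_g, of _ "\<beta> * (2 * K)"])
      have "\<bar>\<beta> * (\<rho> x * (h x - \<psi> x))\<bar> \<le> \<beta> * (2 * K) * \<bar>g x\<bar>" for x
      proof -
        have "\<bar>h x - \<psi> x\<bar> \<le> 2 * K" using h[of x] \<psi>K[of x] by linarith
        then have "\<rho> x * \<bar>h x - \<psi> x\<bar> \<le> g x * (2 * K)"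
          using \<rho>[of x] K by (intro mult_mono) auto
        then have "\<beta> * (\<rho> x * \<bar>h x - \<psi> x\<bar>) \<le> \<beta> * (g x * (2 * K))" using \<beta> by (intro mult_left_mono) auto
        then show ?thesis using \<beta> \<rho>(1)[of x] g_pos[of x] by (simp add: abs_mult ac_simps)
      qed
      then show "AE x in m. \<bar>\<beta> * (\<rho> x * (h x - \<psi> x))\<bar> \<le> \<beta> * (2 * K) * \<bar>g x\<bar>" by simp
    qed (use \<beta> K in auto)
    fix v assume v: "v \<in> D"
    note [measurable] = D_measurable[OF v]
    have vg: "integrable m (\<lambda>x. v x * g x)" by (intro finite_energy_integrable finite_energy_g v)
    have bd: "\<bar>\<rho> x * (z * v x)\<bar> \<le> K * \<bar>v x * g x\<bar>" if "\<bar>z\<bar> \<le> K" for x z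
    proof -
      have "\<rho> x * (\<bar>z\<bar> * \<bar>v x\<bar>) \<le> g x * (K * \<bar>v x\<bar>)"
        using \<rho>[of x] that K by (intro mult_mono) auto
      then show ?thesis using \<rho>(1)[of x] g_pos[of x] by (simp add: abs_mult ac_simps)
    qed
    have ii: "integrable m (\<lambda>x. \<rho> x * (z x * v x))"
      if [measurable]: "z \<in> borel_measurable m" and z: "\<And>x. \<bar>z x\<bar> \<le> K" for z
    proof (rule Bochner_Integration.integrable_bound)
      show "integrable m (\<lambda>x. K * \<bar>v x * g x\<bar>)" using vg by simp
      show "AE x in m. norm (\<rho> x * (z x * v x)) \<le> norm (K * \<bar>v x * g x\<bar>)"
        using bd[OF z] K by auto
    qed measurable
    have conv: "(\<lambda>n. \<integral>x. \<rho> x * (vs n x * v x) \<partial>m) \<longlonglongrightarrow> (\<integral>x. \<rho> x * (\<psi> x * v x) \<partial>m)"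
    proof (rule integral_dominated_convergence)
      show "integrable m (\<lambda>x. K * \<bar>v x * g x\<bar>)" using vg by simp
      show "AE x in m. norm (\<rho> x * (vs n x * v x)) \<le> K * \<bar>v x * g x\<bar>" for n
        using bd[OF us(2)] by (auto simp: vs_def)
      show "AE x in m. (\<lambda>n. \<rho> x * (vs n x * v x)) \<longlonglongrightarrow> \<rho> x * (\<psi> x * v x)"
        using vlim by eventually_elim (intro tendsto_intros)
      show "(\<lambda>x. \<rho> x * (vs n x * v x)) \<in> borel_measurable m" for n unfolding vs_def by measurable
    qed measurable
    have "(\<lambda>n. weighted \<rho> \<beta> (vs n) v - \<beta> * (\<integral>x. \<rho> x * (vs n x * v x) \<partial>m)) \<longlonglongrightarrow>
       \<beta> * (\<integral>x. \<rho> x * (h x * v x) \<partial>m) - \<beta> * (\<integral>x. \<rho> x * (\<psi> x * v x) \<partial>m)"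
      using LIMSEQ_subseq_LIMSEQ[OF lim[OF v] r(1)]
      by (intro tendsto_intros conv) (simp add: vs_def comp_def)
    also have "\<beta> * (\<integral>x. \<rho> x * (h x * v x) \<partial>m) - \<beta> * (\<integral>x. \<rho> x * (\<psi> x * v x) \<partial>m)
        = \<beta> * (\<integral>x. \<rho> x * (h x * v x) - \<rho> x * (\<psi> x * v x) \<partial>m)"
      using ii[OF _ h] ii[OF _ \<psi>K] by (simp add: right_diff_distrib)
    also have "\<dots> = (\<integral>x. \<beta> * (\<rho> x * (h x * v x) - \<rho> x * (\<psi> x * v x)) \<partial>m)" by simp
    also have "\<dots> = (\<integral>x. v x * (\<beta> * (\<rho> x * (h x - \<psi> x))) \<partial>m)"
      by (rule Bochner_Integration.integral_cong) (auto simp: algebra_simps)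
    finally show "(\<lambda>n. \<E> (vs n) v) \<longlonglongrightarrow> (\<integral>x. v x * (\<beta> * (\<rho> x * (h x - \<psi> x))) \<partial>m)"
      by (simp add: weighted_def)
  qed
qed

end


section \<open>Locally compact separable metric spaces\<close>

lemma locally_compact_cball:
  fixes x :: "'a::metric_space"
  assumes "locally_compact_space (euclidean :: 'a topology)" "open U" "x \<in> U"
  obtains r where "r > 0" "cball x r \<subseteq> U" "compact (cball x r)"
proof -
  have "\<exists>V K. openin euclidean V \<and> compactin euclidean K \<and> x \<in> V \<and> V \<subseteq> K"
    using assms(1) unfolding locally_compact_space_def by simp
  then obtain V K where V: "open V" "compact K" "x \<in> V" "V \<subseteq> K" by auto
  then have "open (U \<inter> V)" "x \<in> U \<inter> V" using assms by auto
  then obtain r where r: "r > 0" "cball x r \<subseteq> U \<inter> V" using open_contains_cball by blast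
  have "compact (K \<inter> cball x r)" using V(2) by (intro compact_Int_closed) auto
  moreover have "K \<inter> cball x r = cball x r" using r V by auto
  ultimately show ?thesis using r by (intro that[of r]) auto
qed

lemma cont_compact_supportI:
  fixes h :: "'a::metric_space \<Rightarrow> real"
  assumes "continuous_on UNIV h" "compact K" "\<And>x. x \<notin> K \<Longrightarrow> h x = 0"
  shows "h \<in> cont_compact_support"
proof -
  have "closure {x. h x \<noteq> 0} \<subseteq> K"
    using assms by (intro closure_minimal compact_imp_closed) auto
  then have "closure {x. h x \<noteq> 0} = K \<inter> closure {x. h x \<noteq> 0}" by auto
  moreover have "compact (K \<inter> closure {x. h x \<noteq> 0})" using assms(2) by (intro compact_Int_closed) auto
  ultimately have "compact (closure {x. h x \<noteq> 0})" by metis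
  then show ?thesis using assms by (simp add: cont_compact_support_def)
qed

text \<open>Compactly supported continuous functions extend continuously by \<open>0\<close> to the one-point
  compactification; through this covering they settle the measurability of the events that the
  process is in an open set.\<close>

lemma open_eq_countable_union_supports:
  fixes U :: "'a::{metric_space, second_countable_topology} set"
  assumes lc: "locally_compact_space (euclidean :: 'a topology)" and U: "open U"
  obtains H :: "('a \<Rightarrow> real) set" where "countable H" "H \<subseteq> cont_compact_support"
    "U = (\<Union>h\<in>H. {x. 0 < h x})"
proof -
  have "\<exists>r. r > 0 \<and> cball x r \<subseteq> U \<and> compact (cball x r)" if "x \<in> U" for x
    using locally_compact_cball[OF lc U that] by blast
  then obtain r where r: "\<And>x. x \<in> U \<Longrightarrow> r x > 0 \<and> cball x (r x) \<subseteq> U \<and> compact (cball x (r x))"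
    by metis
  obtain C where C: "C \<subseteq> (\<lambda>x. ball x (r x)) ` U" "countable C" "\<Union>C = \<Union>((\<lambda>x. ball x (r x)) ` U)"
  proof (rule Lindelof_openin[of "(\<lambda>x. ball x (r x)) ` U" UNIV])
    show "openin (top_of_set UNIV) S" if "S \<in> (\<lambda>x. ball x (r x)) ` U" for S
      using that by (auto simp: subtopology_UNIV)
  qed
  obtain U' where U': "countable U'" "U' \<subseteq> U" "C = (\<lambda>x. ball x (r x)) ` U'"
    using countable_subset_image[of C "\<lambda>x. ball x (r x)" U] C(1,2) by blast
  define h where "h = (\<lambda>x y. max 0 (r x - dist x y))"
  show ?thesis
  proof (rule that[of "h ` U'"])
    show "countable (h ` U')" using U' by auto
    show "h ` U' \<subseteq> cont_compact_support"
    proof clarify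
      fix x assume "x \<in> U'"
      then have x: "compact (cball x (r x))" using r U' by blast
      show "h x \<in> cont_compact_support"
        by (rule cont_compact_supportI[OF _ x]) (auto simp: h_def intro!: continuous_intros)
    qed
    have "(\<Union>k\<in>h ` U'. {x. 0 < k x}) = \<Union>C" by (auto simp: U'(3) h_def max_def split: if_splits)
    also have "\<dots> = (\<Union>x\<in>U. ball x (r x))" using C(3) by simp
    also have "\<dots> = U" using r ball_subset_cball by fastforce
    finally show "U = (\<Union>k\<in>h ` U'. {x. 0 < k x})" by simp
  qed
qed

lemma radon_sigma_finite:
  fixes m :: "'a::{metric_space, second_countable_topology} measure"
  assumes lc: "locally_compact_space (euclidean :: 'a topology)" and m: "radon_measure m"
  shows "sigma_finite_measure m"
proof
  obtain H :: "('a \<Rightarrow> real) set" where H: "countable H" "H \<subseteq> cont_compact_support"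
    "UNIV = (\<Union>h\<in>H. {x. 0 < h x})"
    using open_eq_countable_union_supports[OF lc open_UNIV] by blast
  have sets: "sets m = sets borel" and K: "\<And>K. compact K \<Longrightarrow> emeasure m K < \<infinity>"
    using m by (auto simp: radon_measure_def)
  have sp: "space m = UNIV" using sets_eq_imp_space_eq[OF sets] by simp
  define c where "c = (\<lambda>h::'a \<Rightarrow> real. closure {x. h x \<noteq> 0})"
  show "\<exists>A. countable A \<and> A \<subseteq> sets m \<and> \<Union>A = space m \<and> (\<forall>a\<in>A. emeasure m a \<noteq> \<infinity>)"
  proof (intro exI[of _ "c ` H"] conjI ballI)
    show "countable (c ` H)" using H by auto
    show "c ` H \<subseteq> sets m" by (auto simp: sets c_def)
    have "x \<in> \<Union>(c ` H)" for x
    proof -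
      obtain h where "h \<in> H" "0 < h x" using H(3) by blast
      moreover have "{x. h x \<noteq> 0} \<subseteq> c h" unfolding c_def by (rule closure_subset)
      ultimately show ?thesis by force
    qed
    then show "\<Union>(c ` H) = space m" by (auto simp: sp)
    fix a assume "a \<in> c ` H"
    then have "compact a" using H(2) by (auto simp: c_def cont_compact_support_def)
    then show "emeasure m a \<noteq> \<infinity>" using K[of a] by simp
  qed
qed

lemma cont_compact_support_bounded:
  fixes h :: "'a::metric_space \<Rightarrow> real"
  assumes "h \<in> cont_compact_support"
  obtains K where "\<And>x. \<bar>h x\<bar> \<le> K" "0 < K"
proof -
  let ?S = "closure {x. h x \<noteq> 0}"
  have "compact (h ` ?S)"
    using assms by (intro compact_continuous_image)
      (auto simp: cont_compact_support_def intro: continuous_on_subset)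
  then have "bounded (h ` ?S)" by (rule compact_imp_bounded)
  then obtain K where K: "0 < K" "\<And>y. y \<in> h ` ?S \<Longrightarrow> norm y \<le> K" unfolding bounded_pos by blast
  have "\<bar>h x\<bar> \<le> K" for x
  proof (cases "h x = 0")
    case False
    then have "x \<in> ?S" using closure_subset[of "{x. h x \<noteq> 0}"] by auto
    then show ?thesis using K(2) by auto
  qed (use K in auto)
  then show ?thesis using K that by blast
qed

lemma zero_ext_continuous:
  fixes h :: "'a::metric_space \<Rightarrow> real"
  assumes h: "h \<in> cont_compact_support"
  shows "continuous_map E_bdry euclidean (zero_ext h)"
proof (unfold continuous_map_def, intro conjI allI impI)
  show "zero_ext h \<in> topspace E_bdry \<rightarrow> topspace euclidean" by simp
  fix V :: "real set" assume "openin euclidean V"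
  then have V: "open V" by simp
  have cont: "continuous_on UNIV h" and cpt: "compact (closure {x. h x \<noteq> 0})"
    using h by (auto simp: cont_compact_support_def)
  have top: "topspace (E_bdry :: 'a option topology) = UNIV"
    by (auto simp: UNIV_option_conv)
  show "openin E_bdry {x \<in> topspace E_bdry. zero_ext h x \<in> V}"
  proof (cases "0 \<in> V")
    case False
    then have "{x. zero_ext h x \<in> V} = Some ` (h -` V)"
      by (auto simp: zero_ext_def image_iff split: option.splits)
    moreover have "open (h -` V)" using cont V by (simp add: continuous_on_open_vimage)
    ultimately show ?thesis unfolding top by simp
  next
    case True
    have "open (h -` V)" using cont V by (simp add: continuous_on_open_vimage)
    then have cl: "closed (- (h -` V))" by (simp only: closed_def double_complement)
    have "- (h -` V) \<subseteq> closure {x. h x \<noteq> 0}"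
      using True closure_subset[of "{x. h x \<noteq> 0}"] by auto
    then have "- (h -` V) = closure {x. h x \<noteq> 0} \<inter> - (h -` V)" by auto
    then have c: "compact (- (h -` V))" using compact_Int_closed[OF cpt cl] by metis
    have "{x. zero_ext h x \<in> V} = insert None (Some ` (topspace euclidean - (- (h -` V))))"
    proof (rule set_eqI)
      fix z show "z \<in> {x. zero_ext h x \<in> V} \<longleftrightarrow> z \<in> insert None (Some ` (topspace euclidean - (- (h -` V))))"
        using True by (cases z) (auto simp: zero_ext_def)
    qed
    then show ?thesis using c cl unfolding top openin_Alexandroff_compactification
      by (intro disjI2 exI[of _ "- (h -` V)"]) auto
  qed
qed

section \<open>Joint measurability of the process\<close>

lemma sets_borel_bdry: "openin E_bdry U \<Longrightarrow> U \<in> sets borel_bdry"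
  and space_borel_bdry [simp]: "space borel_bdry = UNIV"
  by (auto simp: borel_bdry_def)

lemma zero_ext_measurable_bdry:
  fixes h :: "'a::metric_space \<Rightarrow> real"
  assumes "h \<in> cont_compact_support"
  shows "zero_ext h \<in> borel_measurable borel_bdry"
proof (rule borel_measurableI)
  fix V :: "real set" assume "open V"
  then have "openin E_bdry {x \<in> topspace E_bdry. zero_ext h x \<in> V}"
    using zero_ext_continuous[OF assms] by (auto simp: continuous_map_def)
  moreover have "{x \<in> topspace E_bdry. zero_ext h x \<in> V} = zero_ext h -` V \<inter> space borel_bdry"
    by (auto simp: UNIV_option_conv)
  ultimately show "zero_ext h -` V \<inter> space borel_bdry \<in> sets borel_bdry"
    using sets_borel_bdry by metis
qed

locale hunt =
  fixes M :: "'w measure" and F :: "ennreal \<Rightarrow> 'w measure"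
    and X :: "ennreal \<Rightarrow> 'w \<Rightarrow> 'a::{metric_space, second_countable_topology} option"
    and P :: "'a option \<Rightarrow> 'w measure"
  assumes hunt: "hunt_process M F X P"
    and lc: "locally_compact_space (euclidean :: 'a topology)"
begin

lemma X_measurable: "X t \<in> M \<rightarrow>\<^sub>M borel_bdry"
proof -
  have f: "filtration (space M) F" and s: "sets (F t) \<subseteq> sets M" and x: "X t \<in> F t \<rightarrow>\<^sub>M borel_bdry"
    using hunt unfolding hunt_process_def by auto
  have "space (F t) = space M" using f by (rule filtration.space_F)
  then show ?thesis using x s by (auto simp: measurable_def)
qed

lemma P_prob: "prob_space (P x)" and sets_P: "sets (P x) = sets M"
  using hunt unfolding hunt_process_def by auto

lemma space_P: "space (P x) = space M"
  using sets_P by (rule sets_eq_imp_space_eq)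

lemma X_after_lifetime: "\<omega> \<in> space M \<Longrightarrow> lifetime X \<omega> \<le> t \<Longrightarrow> X t \<omega> = None"
  using hunt unfolding hunt_process_def by auto

lemma X_right_continuous:
  assumes "h \<in> cont_compact_support" "\<omega> \<in> space M" "t < \<infinity>"
  shows "((\<lambda>s. zero_ext h (X s \<omega>)) \<longlongrightarrow> zero_ext h (X t \<omega>)) (at_right t)"
proof -
  have "limitin E_bdry (\<lambda>s. X s \<omega>) (X t \<omega>) (at_right t)"
    using hunt assms unfolding hunt_process_def by auto
  from continuous_map_limit[OF zero_ext_continuous[OF assms(1)] this]
  show ?thesis by (simp add: comp_def)
qed

text \<open>By right continuity the path at time \<open>t\<close> is the limit of its values at times to the right of \<open>t\<close>
  that range over a countable set.\<close>

lemma joint_measurable_cont: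
  assumes h: "h \<in> cont_compact_support"
  shows "(\<lambda>(t, \<omega>). zero_ext h (X (ennreal t) \<omega>)) \<in> borel_measurable (borel \<Otimes>\<^sub>M M)"
proof -
  define k where "k = (\<lambda>n t. nat \<lfloor>real (Suc n) * max 0 t\<rfloor>)"
  define s where "s = (\<lambda>n t. ennreal ((real (k n t) + 1) / real (Suc n)))"
  have bound: "max 0 t < (real (k n t) + 1) / real (Suc n)"
     "(real (k n t) + 1) / real (Suc n) \<le> max 0 t + 1 / real (Suc n)" for n t
  proof -
    have nn: "0 \<le> real (Suc n) * max 0 t" by simp
    then have k: "real (k n t) = of_int \<lfloor>real (Suc n) * max 0 t\<rfloor>"
      unfolding k_def by simp
    have "real (Suc n) * max 0 t < real (k n t) + 1" unfolding k by linarith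
    then have "real (Suc n) * max 0 t / real (Suc n) < (real (k n t) + 1) / real (Suc n)"
      by (intro divide_strict_right_mono) auto
    then show "max 0 t < (real (k n t) + 1) / real (Suc n)" by simp
    have "real (k n t) \<le> real (Suc n) * max 0 t" unfolding k by linarith
    then have "(real (k n t) + 1) / real (Suc n) \<le> (real (Suc n) * max 0 t + 1) / real (Suc n)"
      by (intro divide_right_mono) auto
    also have "\<dots> = max 0 t + 1 / real (Suc n)" by (simp add: add_divide_distrib)
    finally show "(real (k n t) + 1) / real (Suc n) \<le> max 0 t + 1 / real (Suc n)" .
  qed
  have s_lim: "filterlim (\<lambda>n. s n t) (at_right (ennreal t)) sequentially" for t
  proof -
    have et: "ennreal t = ennreal (max 0 t)" by (cases "0 \<le> t") (auto simp: max_def ennreal_neg)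
    have "(\<lambda>n. (real (k n t) + 1) / real (Suc n)) \<longlonglongrightarrow> max 0 t"
    proof (rule tendsto_sandwich)
      show "\<forall>\<^sub>F n in sequentially. max 0 t \<le> (real (k n t) + 1) / real (Suc n)"
        by (intro always_eventually allI less_imp_le bound(1))
      show "\<forall>\<^sub>F n in sequentially. (real (k n t) + 1) / real (Suc n) \<le> max 0 t + 1 / real (Suc n)"
        by (intro always_eventually allI bound(2))
      show "(\<lambda>n. max 0 t + 1 / real (Suc n)) \<longlonglongrightarrow> max 0 t"
        using tendsto_add[OF tendsto_const[of "max 0 t"] LIMSEQ_inverse_real_of_nat]
        by (simp add: inverse_eq_divide)
    qed auto
    then have "(\<lambda>n. s n t) \<longlonglongrightarrow> ennreal t" unfolding s_def et by (rule tendsto_ennrealI)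
    moreover have "ennreal t < s n t" for n
      unfolding et s_def using bound(1) by (intro ennreal_lessI) (auto intro: le_less_trans)
    moreover from this have "s n t \<noteq> ennreal t" for n by (metis less_irrefl)
    ultimately show ?thesis unfolding filterlim_at
      by (intro conjI always_eventually allI) auto
  qed
  have meas_n: "(\<lambda>z. zero_ext h (X (s n (fst z)) (snd z))) \<in> borel_measurable (borel \<Otimes>\<^sub>M M)" for n
  proof -
    have "(\<lambda>z. zero_ext h (X (ennreal ((real i + 1) / real (Suc n))) (snd z))) \<in> borel_measurable (borel \<Otimes>\<^sub>M M)" for i :: nat
      by (rule measurable_compose[OF measurable_compose[OF measurable_snd X_measurable]
            zero_ext_measurable_bdry[OF h]])
    moreover have "(\<lambda>z. k n (fst z)) \<in> (borel \<Otimes>\<^sub>M M) \<rightarrow>\<^sub>M count_space UNIV"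
      unfolding k_def by measurable
    ultimately show ?thesis unfolding s_def by (rule measurable_compose_countable)
  qed
  have "(\<lambda>z. zero_ext h (X (ennreal (fst z)) (snd z))) \<in> borel_measurable (borel \<Otimes>\<^sub>M M)"
  proof (rule borel_measurable_LIMSEQ_real[OF _ meas_n])
    fix z :: "real \<times> 'w" assume "z \<in> space (borel \<Otimes>\<^sub>M M)"
    then have "snd z \<in> space M" by (auto simp: space_pair_measure)
    from X_right_continuous[OF h this, of "ennreal (fst z)"]
    show "(\<lambda>n. zero_ext h (X (s n (fst z)) (snd z))) \<longlonglongrightarrow> zero_ext h (X (ennreal (fst z)) (snd z))"
      using filterlim_compose[OF _ s_lim] by simp
  qed
  then show ?thesis by (simp add: case_prod_beta')
qed

lemma joint_measurable:
  assumes f: "f \<in> borel_measurable borel"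
  shows "(\<lambda>(t, \<omega>). zero_ext f (X (ennreal t) \<omega>) :: real) \<in> borel_measurable (borel \<Otimes>\<^sub>M M)"
proof -
  let ?N = "borel \<Otimes>\<^sub>M M :: (real \<times> 'w) measure"
  have hit: "{z \<in> space ?N. X (ennreal (fst z)) (snd z) \<in> Some ` U} \<in> sets ?N" if U: "open U" for U
  proof -
    obtain H :: "('a \<Rightarrow> real) set" where H: "countable H" "H \<subseteq> cont_compact_support"
      "U = (\<Union>h\<in>H. {x. 0 < h x})"
      using open_eq_countable_union_supports[OF lc U] by blast
    have "{z \<in> space ?N. X (ennreal (fst z)) (snd z) \<in> Some ` U}
       = (\<Union>h\<in>H. {z \<in> space ?N. 0 < zero_ext h (X (ennreal (fst z)) (snd z))})"
      unfolding H(3) by (auto simp: zero_ext_def split: option.splits)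
    also have "\<dots> \<in> sets ?N"
    proof (intro sets.countable_UN'' H(1))
      fix h assume "h \<in> H"
      then have "h \<in> cont_compact_support" using H(2) by auto
      note joint_measurable_cont[OF this, unfolded case_prod_beta', measurable]
      show "{z \<in> space ?N. 0 < zero_ext h (X (ennreal (fst z)) (snd z))} \<in> sets ?N" by measurable
    qed
    finally show ?thesis .
  qed
  define S where "S = {z \<in> space ?N. X (ennreal (fst z)) (snd z) \<in> Some ` UNIV}"
  have S: "S \<in> sets ?N" unfolding S_def by (rule hit) simp
  define W where "W = (\<lambda>z. case X (ennreal (fst z)) (snd z) of Some x \<Rightarrow> x | None \<Rightarrow> undefined)"
  have "W \<in> borel_measurable ?N"
  proof (rule borel_measurableI)
    fix U :: "'a set" assume U: "open U"
    have "W -` U \<inter> space ?N = {z \<in> space ?N. X (ennreal (fst z)) (snd z) \<in> Some ` U} \<union>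
        (if undefined \<in> U then space ?N - S else {})"
      by (auto simp: W_def S_def split: option.splits)
    then show "W -` U \<inter> space ?N \<in> sets ?N" using hit[OF U] S by auto
  qed
  note [measurable] = this f S
  have "(\<lambda>z. if z \<in> S then f (W z) else 0) \<in> borel_measurable ?N" by measurable
  also have "(\<lambda>z. if z \<in> S then f (W z) else 0) \<in> borel_measurable ?N \<longleftrightarrow>
      (\<lambda>z. zero_ext f (X (ennreal (fst z)) (snd z))) \<in> borel_measurable ?N"
    by (rule measurable_cong) (auto simp: S_def W_def zero_ext_def split: option.splits)
  finally show ?thesis by (simp add: case_prod_beta')
qed

section \<open>The resolvent of the process\<close>

text \<open>The integrand of the resolvent on the product of time axis and path space. It vanishes after the
  lifetime, since \<open>f\<close> is extended by \<open>0\<close> to the cemetery.\<close>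

definition path_integrand :: "real \<Rightarrow> ('a \<Rightarrow> real) \<Rightarrow> real \<times> 'w \<Rightarrow> real" where
  "path_integrand \<alpha> f = (\<lambda>(t, \<omega>). indicator {0..} t * exp (- \<alpha> * t) * zero_ext f (X (ennreal t) \<omega>))"

lemma path_integrand_measurable:
  assumes "f \<in> borel_measurable borel"
  shows "path_integrand \<alpha> f \<in> borel_measurable (lborel \<Otimes>\<^sub>M P x)"
proof -
  have eq: "sets (lborel \<Otimes>\<^sub>M P x) = sets (borel \<Otimes>\<^sub>M M)"
    by (intro sets_pair_measure_cong sets_P) simp
  note joint_measurable[OF assms, unfolded case_prod_beta', measurable]
  have "path_integrand \<alpha> f \<in> borel_measurable (borel \<Otimes>\<^sub>M M)"
    unfolding path_integrand_def case_prod_beta' by measurable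
  then show ?thesis using measurable_cong_sets[OF eq refl] by blast
qed

lemma nn_integral_discount:
  fixes \<alpha> :: real
  assumes "\<alpha> > 0"
  shows "(\<integral>\<^sup>+t. ennreal (indicator {0..} t * exp (- \<alpha> * t)) \<partial>lborel) = ennreal (1 / \<alpha>)"
proof -
  have "(\<integral>\<^sup>+t. ennreal (exp (- \<alpha> * t)) * indicator {0..} t \<partial>lborel) = ennreal (0 - (- exp (- \<alpha> * 0) / \<alpha>))"
  proof (rule nn_integral_FTC_atLeast)
    show "DERIV (\<lambda>t. - exp (- \<alpha> * t) / \<alpha>) t :> exp (- \<alpha> * t)" for t
      using assms by (auto intro!: derivative_eq_intros)
    have "((\<lambda>t. exp (- (\<alpha> * t))) \<longlongrightarrow> 0) at_top"
      using assms by (intro filterlim_compose[OF exp_at_bot] filterlim_uminus_at_bot_at_top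
          filterlim_compose[OF filterlim_uminus_at_bot_at_top] filterlim_tendsto_pos_mult_at_top[OF tendsto_const _ filterlim_ident]) auto
    then have "((\<lambda>t. - exp (- (\<alpha> * t)) / \<alpha>) \<longlongrightarrow> - 0 / \<alpha>) at_top"
      by (intro tendsto_intros) (use assms in auto)
    then show "((\<lambda>t. - exp (- \<alpha> * t) / \<alpha>) \<longlongrightarrow> 0) at_top" by simp
  qed auto
  moreover have "(\<integral>\<^sup>+t. ennreal (indicator {0..} t * exp (- \<alpha> * t)) \<partial>lborel)
     = (\<integral>\<^sup>+t. ennreal (exp (- \<alpha> * t)) * indicator {0..} t \<partial>lborel)"
    by (intro nn_integral_cong) (auto simp: indicator_def)
  ultimately show ?thesis by simp
qed

lemma discount_integrable:
  fixes \<alpha> K :: real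
  assumes "\<alpha> > 0"
  shows "integrable (lborel \<Otimes>\<^sub>M P x) (\<lambda>(t, \<omega>). K * (indicator {0..} t * exp (- \<alpha> * t)))"
proof -
  interpret p: prob_space "P x" by (rule P_prob)
  have "integrable (lborel \<Otimes>\<^sub>M P x) (\<lambda>z. indicator {0..} (fst z) * exp (- \<alpha> * fst z) :: real)"
  proof (rule integrableI_bounded)
    have "(\<integral>\<^sup>+z. ennreal (norm (indicator {0..} (fst z) * exp (- \<alpha> * fst z) :: real)) \<partial>(lborel \<Otimes>\<^sub>M P x))
      = (\<integral>\<^sup>+t. \<integral>\<^sup>+\<omega>. ennreal (indicator {0..} t * exp (- \<alpha> * t)) \<partial>P x \<partial>lborel)"
      by (subst p.nn_integral_fst[symmetric]) (auto simp: case_prod_beta' indicator_def)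
    also have "\<dots> = ennreal (1 / \<alpha>)"
      using nn_integral_discount[OF assms] by (simp add: p.emeasure_space_1)
    finally show "(\<integral>\<^sup>+z. ennreal (norm (indicator {0..} (fst z) * exp (- \<alpha> * fst z) :: real)) \<partial>(lborel \<Otimes>\<^sub>M P x)) < \<infinity>"
      by simp
  qed measurable
  then show ?thesis by (simp add: case_prod_beta')
qed

lemma zero_ext_bound: "(\<And>x. \<bar>f x\<bar> \<le> K) \<Longrightarrow> \<bar>zero_ext f z\<bar> \<le> (K::real)"
  by (cases z) (auto simp: zero_ext_def intro: order_trans[OF abs_ge_zero])

lemma path_integrand_bound:
  assumes "\<And>x. \<bar>f x\<bar> \<le> K"
  shows "norm (path_integrand \<alpha> f z) \<le> (case z of (t, \<omega>) \<Rightarrow> K * (indicator {0..} t * exp (- \<alpha> * t)))"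
  using zero_ext_bound[of f K, OF assms]
  by (auto simp: path_integrand_def abs_mult indicator_def split: prod.split)

lemma path_integrand_integrable:
  assumes "\<alpha> > 0" "f \<in> borel_measurable borel" "\<And>x. \<bar>f x\<bar> \<le> K"
  shows "integrable (lborel \<Otimes>\<^sub>M P x) (path_integrand \<alpha> f)"
proof (rule Bochner_Integration.integrable_bound[OF discount_integrable[OF assms(1), of x K]])
  show "path_integrand \<alpha> f \<in> borel_measurable (lborel \<Otimes>\<^sub>M P x)"
    by (rule path_integrand_measurable[OF assms(2)])
  show "AE z in lborel \<Otimes>\<^sub>M P x. norm (path_integrand \<alpha> f z)
      \<le> norm (case z of (t, \<omega>) \<Rightarrow> K * (indicator {0..} t * exp (- \<alpha> * t)))"
    by (intro AE_I2 order_trans[OF path_integrand_bound[OF assms(3)]]) simp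
qed

lemma resolvent_eq:
  assumes "\<alpha> > 0" "f \<in> borel_measurable borel" "\<And>x. \<bar>f x\<bar> \<le> K"
  shows "resolvent X P \<alpha> f x = integral\<^sup>L (lborel \<Otimes>\<^sub>M P (Some x)) (path_integrand \<alpha> f)"
proof -
  interpret p: prob_space "P (Some x)" by (rule P_prob)
  interpret pair_sigma_finite lborel "P (Some x)" ..
  have "resolvent X P \<alpha> f x = (\<integral>\<omega>. \<integral>t. path_integrand \<alpha> f (t, \<omega>) \<partial>lborel \<partial>P (Some x))"
    unfolding resolvent_def set_lebesgue_integral_def
  proof (intro Bochner_Integration.integral_cong refl)
    fix \<omega> t assume "\<omega> \<in> space (P (Some x))"
    then have "\<omega> \<in> space M" by (simp add: space_P)
    then show "indicator {t. 0 \<le> t \<and> ennreal t < lifetime X \<omega>} t *\<^sub>R (exp (- \<alpha> * t) * zero_ext f (X (ennreal t) \<omega>))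
        = path_integrand \<alpha> f (t, \<omega>)"
      using X_after_lifetime[of \<omega> "ennreal t"]
      by (auto simp: path_integrand_def indicator_def zero_ext_def not_less)
  qed
  also have "\<dots> = integral\<^sup>L (lborel \<Otimes>\<^sub>M P (Some x)) (\<lambda>(t, \<omega>). path_integrand \<alpha> f (t, \<omega>))"
    by (rule integral_snd) (use path_integrand_integrable[OF assms] in simp)
  finally show ?thesis by simp
qed

lemma process_resolvent_diff:
  assumes "\<alpha> > 0" "f1 \<in> borel_measurable borel" "\<And>x. \<bar>f1 x\<bar> \<le> K"
    "f2 \<in> borel_measurable borel" "\<And>x. \<bar>f2 x\<bar> \<le> K"
  shows "resolvent X P \<alpha> (\<lambda>x. f1 x - f2 x) x = resolvent X P \<alpha> f1 x - resolvent X P \<alpha> f2 x"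
proof -
  have b: "\<bar>f1 x - f2 x\<bar> \<le> 2 * K" for x using assms(3)[of x] assms(5)[of x] by linarith
  have "path_integrand \<alpha> (\<lambda>x. f1 x - f2 x) = (\<lambda>z. path_integrand \<alpha> f1 z - path_integrand \<alpha> f2 z)"
    by (auto simp: path_integrand_def zero_ext_def fun_eq_iff right_diff_distrib split: option.splits)
  then show ?thesis
    using path_integrand_integrable[OF assms(1-3)] path_integrand_integrable[OF assms(1,4,5)] assms
    by (simp add: resolvent_eq[OF assms(1) _ b] resolvent_eq[OF assms(1-3)] resolvent_eq[OF assms(1,4,5)])
qed

lemma process_resolvent_tendsto:
  assumes "\<alpha> > 0" "\<And>n. f n \<in> borel_measurable borel" "\<And>n x. \<bar>f n x\<bar> \<le> K"
    "f' \<in> borel_measurable borel" "\<And>x. (\<lambda>n. f n x) \<longlonglongrightarrow> f' x"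
  shows "(\<lambda>n. resolvent X P \<alpha> (f n) x) \<longlonglongrightarrow> resolvent X P \<alpha> f' x"
proof -
  have b: "\<bar>f' x\<bar> \<le> K" for x
    by (rule LIMSEQ_le_const2[OF tendsto_rabs[OF assms(5)]]) (use assms(3) in auto)
  show ?thesis
    unfolding resolvent_eq[OF assms(1-3)] resolvent_eq[OF assms(1,4) b]
  proof (rule integral_dominated_convergence)
    show "integrable (lborel \<Otimes>\<^sub>M P (Some x)) (\<lambda>(t, \<omega>). K * (indicator {0..} t * exp (- \<alpha> * t)))"
      by (rule discount_integrable[OF assms(1)])
    show "AE z in lborel \<Otimes>\<^sub>M P (Some x). norm (path_integrand \<alpha> (f n) z)
        \<le> (case z of (t, \<omega>) \<Rightarrow> K * (indicator {0..} t * exp (- \<alpha> * t)))" for n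
      by (rule AE_I2) (rule path_integrand_bound[OF assms(3)])
    show "AE z in lborel \<Otimes>\<^sub>M P (Some x). (\<lambda>n. path_integrand \<alpha> (f n) z) \<longlonglongrightarrow> path_integrand \<alpha> f' z"
    proof (rule AE_I2)
      fix z
      have "(\<lambda>n. zero_ext (f n) y) \<longlonglongrightarrow> zero_ext f' y" for y
        using assms(5) by (cases y) (auto simp: zero_ext_def)
      then show "(\<lambda>n. path_integrand \<alpha> (f n) z) \<longlonglongrightarrow> path_integrand \<alpha> f' z"
        unfolding path_integrand_def by (auto split: prod.split intro!: tendsto_intros)
    qed
  qed (use path_integrand_measurable assms in auto)
qed

lemma process_resolvent_bound:
  assumes "\<alpha> > 0" "f \<in> borel_measurable borel" "\<And>x. \<bar>f x\<bar> \<le> K"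
  shows "\<bar>resolvent X P \<alpha> f x\<bar> \<le> K / \<alpha>"
proof -
  interpret p: prob_space "P (Some x)" by (rule P_prob)
  have K: "0 \<le> K" using assms(3) order_trans[OF abs_ge_zero] by blast
  have "ennreal \<bar>resolvent X P \<alpha> f x\<bar> \<le> (\<integral>\<^sup>+z. ennreal (norm (path_integrand \<alpha> f z)) \<partial>(lborel \<Otimes>\<^sub>M P (Some x)))"
    unfolding resolvent_eq[OF assms]
    using integral_norm_bound_ennreal[OF path_integrand_integrable[OF assms]] by simp
  also have "\<dots> \<le> (\<integral>\<^sup>+z. ennreal K * ennreal (indicator {0..} (fst z) * exp (- \<alpha> * fst z)) \<partial>(lborel \<Otimes>\<^sub>M P (Some x)))"
    using path_integrand_bound[of f K \<alpha>, OF assms(3)] K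
    by (intro nn_integral_mono) (auto intro!: ennreal_leI simp: case_prod_beta' simp flip: ennreal_mult')
  also have "\<dots> = (\<integral>\<^sup>+t. \<integral>\<^sup>+\<omega>. ennreal K * ennreal (indicator {0..} t * exp (- \<alpha> * t)) \<partial>P (Some x) \<partial>lborel)"
    by (subst p.nn_integral_fst[symmetric]) auto
  also have "\<dots> = ennreal K * ennreal (1 / \<alpha>)"
    using nn_integral_discount[OF assms(1)] by (simp add: p.emeasure_space_1 nn_integral_cmult)
  also have "\<dots> = ennreal (K / \<alpha>)" using K assms(1) by (simp flip: ennreal_mult')
  finally show ?thesis using K assms(1) by (simp add: ennreal_le_iff)
qed

end


section \<open>The resolvent of the process is the resolvent of the form\<close>

lemma (in sigma_finite_measure) AE_eq_nn_integral_finite_sets: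
  assumes [measurable]: "f \<in> borel_measurable M" "h \<in> borel_measurable M"
    and eq: "\<And>A. A \<in> sets M \<Longrightarrow> emeasure M A < \<infinity> \<Longrightarrow>
       (\<integral>\<^sup>+x. f x * indicator A x \<partial>M) = (\<integral>\<^sup>+x. h x * indicator A x \<partial>M)"
  shows "AE x in M. f x = (h x :: ennreal)"
proof (rule density_unique)
  obtain A :: "nat \<Rightarrow> 'a set" where A: "range A \<subseteq> sets M" "(\<Union>i. A i) = space M"
      "\<And>i. emeasure M (A i) \<noteq> \<infinity>" "incseq A"
    using sigma_finite_incseq by metis
  have [measurable]: "A i \<in> sets M" for i using A by auto
  show "density M f = density M h"
  proof (rule measure_eqI)
    fix B assume "B \<in> sets (density M f)"
    then have [measurable]: "B \<in> sets M" by simp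
    have lim: "(\<integral>\<^sup>+x. k x * indicator B x \<partial>M) = (SUP i. \<integral>\<^sup>+x. k x * indicator (B \<inter> A i) x \<partial>M)"
      if [measurable]: "k \<in> borel_measurable M" for k
    proof -
      have "(\<integral>\<^sup>+x. k x * indicator B x \<partial>M) = (\<integral>\<^sup>+x. (SUP i. k x * indicator (B \<inter> A i) x) \<partial>M)"
      proof (rule nn_integral_cong)
        fix x assume "x \<in> space M"
        then obtain i where i: "x \<in> A i" using A(2) by blast
        show "k x * indicator B x = (SUP i. k x * indicator (B \<inter> A i) x)"
          by (rule antisym) (use i in \<open>auto intro!: SUP_upper2[of i] SUP_least simp: indicator_def\<close>)
      qed
      also have "\<dots> = (SUP i. \<integral>\<^sup>+x. k x * indicator (B \<inter> A i) x \<partial>M)"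
        using A(4) by (intro nn_integral_monotone_convergence_SUP)
          (auto simp: incseq_def le_fun_def indicator_def)
      finally show ?thesis .
    qed
    have "(\<integral>\<^sup>+x. f x * indicator (B \<inter> A i) x \<partial>M) = (\<integral>\<^sup>+x. h x * indicator (B \<inter> A i) x \<partial>M)" for i
    proof (rule eq)
      show "B \<inter> A i \<in> sets M" by measurable
      have "emeasure M (B \<inter> A i) \<le> emeasure M (A i)" by (intro emeasure_mono) auto
      then show "emeasure M (B \<inter> A i) < \<infinity>" using A(3)[of i] by (simp add: top.not_eq_extremum le_less_trans)
    qed
    then show "emeasure (density M f) B = emeasure (density M h) B"
      by (simp add: emeasure_density lim)
  qed simp
qed simp_all

locale process_dirichlet_space = dirichlet_space m D \<E> + hunt M F X P
  for m :: "'a::{metric_space, second_countable_topology} measure" and D and \<E>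
    and M :: "'w measure" and F and X :: "ennreal \<Rightarrow> 'w \<Rightarrow> 'a option" and P +
  fixes p :: "real \<Rightarrow> 'a \<Rightarrow> 'a \<Rightarrow> ennreal"
  assumes sets_m: "sets m = sets borel"
    and assoc: "associated_process m D \<E> X P"
    and p_measurable: "(\<lambda>(t, x, y). p t x y) \<in> borel_measurable borel"
    and p_density: "t > 0 \<Longrightarrow> h \<in> borel_measurable borel \<Longrightarrow>
       (\<integral>\<^sup>+\<omega>. zero_ext h (X (ennreal t) \<omega>) \<partial>P (Some x)) = (\<integral>\<^sup>+y. h y * p t x y \<partial>m)"
begin

lemma borel_measurable_m: "f \<in> borel_measurable m \<longleftrightarrow> f \<in> borel_measurable borel"
  using measurable_cong_sets[OF sets_m refl] by blast

definition transition :: "('a \<Rightarrow> real) \<Rightarrow> real \<Rightarrow> 'a \<Rightarrow> ennreal" where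
  "transition f t x = (\<integral>\<^sup>+y. ennreal (f y) * p t x y \<partial>m)"

lemma transition_measurable:
  assumes [measurable]: "f \<in> borel_measurable borel"
  shows "(\<lambda>z. transition f (fst z) (snd z)) \<in> borel_measurable (borel \<Otimes>\<^sub>M m)"
proof -
  have p': "(\<lambda>z. p (fst z) (fst (snd z)) (snd (snd z))) \<in> borel_measurable (borel \<Otimes>\<^sub>M (borel \<Otimes>\<^sub>M borel))"
    using p_measurable by (simp add: borel_prod case_prod_beta')
  have "sets (borel \<Otimes>\<^sub>M (borel \<Otimes>\<^sub>M borel)) = sets (borel \<Otimes>\<^sub>M (m \<Otimes>\<^sub>M m))"
    using sets_m by (intro sets_pair_measure_cong) auto
  with p' have p'': "(\<lambda>z. p (fst z) (fst (snd z)) (snd (snd z))) \<in> borel_measurable (borel \<Otimes>\<^sub>M (m \<Otimes>\<^sub>M m))"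
    using measurable_cong_sets by blast
  have "(\<lambda>w. (fst (fst w), (snd (fst w), snd w))) \<in> ((borel \<Otimes>\<^sub>M m) \<Otimes>\<^sub>M m) \<rightarrow>\<^sub>M (borel \<Otimes>\<^sub>M (m \<Otimes>\<^sub>M m))"
    by measurable
  from measurable_compose[OF this p'']
  have [measurable]: "(\<lambda>w. p (fst (fst w)) (snd (fst w)) (snd w)) \<in> borel_measurable ((borel \<Otimes>\<^sub>M m) \<Otimes>\<^sub>M m)"
    by simp
  have [measurable]: "f \<in> borel_measurable m" using assms by (simp add: borel_measurable_m)
  have "(\<lambda>w. ennreal (f (snd w)) * p (fst (fst w)) (snd (fst w)) (snd w)) \<in> borel_measurable ((borel \<Otimes>\<^sub>M m) \<Otimes>\<^sub>M m)"
    by measurable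
  then have "(\<lambda>z. \<integral>\<^sup>+y. ennreal (f (snd (z, y))) * p (fst (fst (z, y))) (snd (fst (z, y))) (snd (z, y)) \<partial>m)
      \<in> borel_measurable (borel \<Otimes>\<^sub>M m)"
    by (rule borel_measurable_nn_integral_fst)
  then show ?thesis unfolding transition_def by simp
qed

lemma transition_eq:
  assumes t: "t > 0" and [measurable]: "f \<in> borel_measurable borel" and f: "\<And>x. 0 \<le> f x" "\<And>x. f x \<le> K"
  shows "transition f t x = ennreal (\<integral>\<omega>. zero_ext f (X (ennreal t) \<omega>) \<partial>P (Some x))"
proof -
  interpret p: prob_space "P (Some x)" by (rule P_prob)
  have [measurable]: "(\<lambda>\<omega>. zero_ext f (X (ennreal t) \<omega>)) \<in> borel_measurable (P (Some x))"
  proof -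
    have "(\<lambda>\<omega>. (t, \<omega>)) \<in> M \<rightarrow>\<^sub>M (borel \<Otimes>\<^sub>M M)" by measurable
    from measurable_compose[OF this joint_measurable[OF assms(2)]]
    show ?thesis using measurable_cong_sets[OF sets_P refl] by auto
  qed
  have b: "\<bar>zero_ext f z\<bar> \<le> K" for z by (rule zero_ext_bound) (use f in auto)
  have nn: "0 \<le> zero_ext f z" for z using f by (cases z) (auto simp: zero_ext_def)
  have "transition f t x = (\<integral>\<^sup>+\<omega>. zero_ext (\<lambda>y. ennreal (f y)) (X (ennreal t) \<omega>) \<partial>P (Some x))"
    unfolding transition_def by (rule p_density[symmetric, OF t]) simp
  also have "\<dots> = (\<integral>\<^sup>+\<omega>. ennreal (zero_ext f (X (ennreal t) \<omega>)) \<partial>P (Some x))"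
    by (intro nn_integral_cong) (auto simp: zero_ext_def split: option.split)
  also have "\<dots> = ennreal (\<integral>\<omega>. zero_ext f (X (ennreal t) \<omega>) \<partial>P (Some x))"
    using b nn by (intro nn_integral_eq_integral p.integrable_const_bound[of _ K]) auto
  finally show ?thesis .
qed

lemma process_resolvent_transition:
  assumes \<alpha>: "\<alpha> > 0" and [measurable]: "f \<in> borel_measurable borel" and f: "\<And>x. 0 \<le> f x" "\<And>x. f x \<le> K"
  shows "ennreal (resolvent X P \<alpha> f x) =
    (\<integral>\<^sup>+t. (indicator {0<..} t * ennreal (exp (- \<alpha> * t))) * transition f t x \<partial>lborel)"
    and "0 \<le> resolvent X P \<alpha> f x"
proof -
  interpret p: prob_space "P (Some x)" by (rule P_prob)
  have fb: "\<bar>f x\<bar> \<le> K" for x using f[of x] by simp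
  have nn: "0 \<le> path_integrand \<alpha> f z" for z
    using f by (auto simp: path_integrand_def zero_ext_def split: prod.split option.split)
  have res: "resolvent X P \<alpha> f x = integral\<^sup>L (lborel \<Otimes>\<^sub>M P (Some x)) (path_integrand \<alpha> f)"
    by (rule resolvent_eq[OF \<alpha> assms(2) fb])
  then show "0 \<le> resolvent X P \<alpha> f x" using nn by simp
  have "ennreal (resolvent X P \<alpha> f x) = (\<integral>\<^sup>+z. ennreal (path_integrand \<alpha> f z) \<partial>(lborel \<Otimes>\<^sub>M P (Some x)))"
    unfolding res using nn path_integrand_integrable[OF \<alpha> assms(2) fb]
    by (intro nn_integral_eq_integral[symmetric]) auto
  also have "\<dots> = (\<integral>\<^sup>+t. \<integral>\<^sup>+\<omega>. ennreal (path_integrand \<alpha> f (t, \<omega>)) \<partial>P (Some x) \<partial>lborel)"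
    using path_integrand_measurable[OF assms(2)]
    by (intro p.nn_integral_fst[symmetric]) simp
  also have "\<dots> = (\<integral>\<^sup>+t. (indicator {0<..} t * ennreal (exp (- \<alpha> * t))) * transition f t x \<partial>lborel)"
  proof (rule nn_integral_cong_AE)
    have "AE t in lborel. t \<noteq> (0::real)" by (rule AE_lborel_singleton)
    then show "AE t in lborel. (\<integral>\<^sup>+\<omega>. ennreal (path_integrand \<alpha> f (t, \<omega>)) \<partial>P (Some x))
       = (indicator {0<..} t * ennreal (exp (- \<alpha> * t))) * transition f t x"
    proof eventually_elim
      case (elim t)
      show ?case
      proof (cases "t > 0")
        case False
        then show ?thesis using elim by (simp add: path_integrand_def indicator_def)
      next
        case True
        have [measurable]: "(\<lambda>\<omega>. zero_ext f (X (ennreal t) \<omega>)) \<in> borel_measurable (P (Some x))"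
        proof -
          have "(\<lambda>\<omega>. (t, \<omega>)) \<in> M \<rightarrow>\<^sub>M (borel \<Otimes>\<^sub>M M)" by measurable
          from measurable_compose[OF this joint_measurable[OF assms(2)]]
          show ?thesis using measurable_cong_sets[OF sets_P refl] by auto
        qed
        have "(\<integral>\<^sup>+\<omega>. ennreal (path_integrand \<alpha> f (t, \<omega>)) \<partial>P (Some x))
          = (\<integral>\<^sup>+\<omega>. ennreal (exp (- \<alpha> * t)) * ennreal (zero_ext f (X (ennreal t) \<omega>)) \<partial>P (Some x))"
          using True by (intro nn_integral_cong) (simp add: path_integrand_def ennreal_mult')
        also have "\<dots> = ennreal (exp (- \<alpha> * t)) * (\<integral>\<^sup>+\<omega>. ennreal (zero_ext f (X (ennreal t) \<omega>)) \<partial>P (Some x))"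
          by (rule nn_integral_cmult) simp
        also have "(\<integral>\<^sup>+\<omega>. ennreal (zero_ext f (X (ennreal t) \<omega>)) \<partial>P (Some x))
            = (\<integral>\<^sup>+\<omega>. zero_ext (\<lambda>y. ennreal (f y)) (X (ennreal t) \<omega>) \<partial>P (Some x))"
          by (intro nn_integral_cong) (auto simp: zero_ext_def split: option.split)
        also have "\<dots> = transition f t x"
          unfolding transition_def by (rule p_density[OF True]) simp
        finally show ?thesis using True by simp
      qed
    qed
  qed
  finally show "ennreal (resolvent X P \<alpha> f x) =
    (\<integral>\<^sup>+t. (indicator {0<..} t * ennreal (exp (- \<alpha> * t))) * transition f t x \<partial>lborel)" .
qed

lemma process_resolvent_measurable:
  assumes \<alpha>: "\<alpha> > 0" and [measurable]: "f \<in> borel_measurable borel" and f: "\<And>x. 0 \<le> f x" "\<And>x. f x \<le> K"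
  shows "resolvent X P \<alpha> f \<in> borel_measurable m"
proof -
  have "(\<lambda>w. (indicator {0<..} (snd w) * ennreal (exp (- \<alpha> * snd w))) * transition f (snd w) (fst w))
      \<in> borel_measurable (m \<Otimes>\<^sub>M lborel)"
  proof -
    have "(\<lambda>w. (snd w, fst w)) \<in> (m \<Otimes>\<^sub>M lborel) \<rightarrow>\<^sub>M (borel \<Otimes>\<^sub>M m)" by measurable
    from measurable_compose[OF this transition_measurable[OF assms(2)]]
    have [measurable]: "(\<lambda>w. transition f (snd w) (fst w)) \<in> borel_measurable (m \<Otimes>\<^sub>M lborel)" by simp
    show ?thesis by measurable
  qed
  from lborel.borel_measurable_nn_integral_fst[OF this]
  have "(\<lambda>x. ennreal (resolvent X P \<alpha> f x)) \<in> borel_measurable m"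
    unfolding process_resolvent_transition(1)[OF assms] by simp
  then have "(\<lambda>x. enn2real (ennreal (resolvent X P \<alpha> f x))) \<in> borel_measurable m" by measurable
  then show ?thesis using process_resolvent_transition(2)[OF assms] by simp
qed

text \<open>For \<open>\<psi>\<close> in the domain of the generator the function \<open>t \<mapsto> exp(-\<alpha> t) (T\<^sub>t \<psi>, \<kappa>)\<close> has derivative
  \<open>-exp(-\<alpha> t) (T\<^sub>t f, \<kappa>)\<close>, where \<open>f = (\<alpha> - A) \<psi>\<close>; integrating it over the half-line identifies
  the Laplace transform of the semigroup.\<close>

lemma semigroup_laplace:
  assumes \<alpha>: "\<alpha> > 0" and f: "f \<in> L2 m" "f \<in> borel_measurable borel" "\<And>x. 0 \<le> f x" "\<And>x. f x \<le> K"
    and r: "is_resolvent \<alpha> f \<psi>" and \<kappa>: "\<kappa> \<in> L2 m" "\<And>x. 0 \<le> \<kappa> x"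
  shows "(\<integral>\<^sup>+t. (indicator {0<..} t * ennreal (exp (- \<alpha> * t))) * (\<integral>\<^sup>+x. transition f t x * ennreal (\<kappa> x) \<partial>m) \<partial>lborel)
     = ennreal (l2_inner m \<psi> \<kappa>)"
proof -
  obtain T where T: "generated_semigroup m (form_generator m D \<E>) T"
    and TX: "\<And>t h. t > 0 \<Longrightarrow> h \<in> L2 m \<inter> bounded_borel \<Longrightarrow>
           AE x in m. (\<integral>\<omega>. zero_ext h (X (ennreal t) \<omega>) \<partial>P (Some x)) = T t h x"
    using assoc unfolding associated_process_def by blast
  have TL: "T t h \<in> L2 m" and Tnorm: "l2_norm m (T t h) \<le> l2_norm m h" if "t \<ge> 0" "h \<in> L2 m" for t h
    using T that unfolding generated_semigroup_def by auto
  have \<psi>D: "\<psi> \<in> D" and \<psi>eq: "\<And>v. v \<in> D \<Longrightarrow> \<E> \<psi> v + \<alpha> * l2_inner m \<psi> v = l2_inner m f v"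
    using r by (auto simp: is_resolvent_def)
  have \<psi>L: "\<psi> \<in> L2 m" using \<psi>D by (rule D_L2)
  note [measurable] = L2_measurable[OF \<kappa>(1)] L2_measurable[OF \<psi>L] L2_measurable[OF f(1)]
  define w where "w = (\<lambda>x. \<alpha> * \<psi> x + (-1) * f x)"
  have wL: "w \<in> L2 m" unfolding w_def by (intro l2.comb_mem \<psi>L f)
  define J where "J = (\<lambda>t h. l2_inner m (T t h) \<kappa>)"
  define C where "C = l2_norm m \<kappa>"
  have C0: "0 \<le> C" by (simp add: C_def l2_norm_def l2.nonneg[OF \<kappa>(1)])
  have cs: "\<bar>l2_inner m h \<kappa>\<bar> \<le> l2_norm m h * C" if "h \<in> L2 m" for h
    using l2.cauchy_schwarz[OF that \<kappa>(1)] by (simp add: l2_norm_def C_def)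
  have inner_cong: "l2_inner m h \<kappa> = l2_inner m h' \<kappa>"
    if "AE x in m. h x = h' x" "h \<in> L2 m" "h' \<in> L2 m" for h h'
    unfolding l2_inner_def
    by (rule integral_cong_AE) (use that L2_measurable in \<open>auto intro!: borel_measurable_times\<close>)
  have J_comb: "J t (\<lambda>x. a * h x + b * k x) = a * J t h + b * J t k"
    if "t \<ge> 0" "h \<in> L2 m" "k \<in> L2 m" for t a b h k
  proof -
    have "AE x in m. T t (\<lambda>y. a * h y + b * k y) x = a * T t h x + b * T t k x"
      using T that unfolding generated_semigroup_def by blast
    then have "J t (\<lambda>x. a * h x + b * k x) = l2_inner m (\<lambda>x. a * T t h x + b * T t k x) \<kappa>"
      unfolding J_def using that by (intro inner_cong TL l2.comb_mem)
    also have "\<dots> = a * J t h + b * J t k"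
      unfolding J_def using that \<kappa>(1) by (intro l2.comb_left TL)
    finally show ?thesis .
  qed
  have J_semi: "J (s + t) h = J s (T t h)" if "s \<ge> 0" "t \<ge> 0" "h \<in> L2 m" for s t h
  proof -
    have "AE x in m. T (s + t) h x = T s (T t h) x"
      using T that unfolding generated_semigroup_def by blast
    then show ?thesis unfolding J_def using that by (intro inner_cong TL) auto
  qed
  have J_bound: "\<bar>J t h\<bar> \<le> l2_norm m h * C" if "t \<ge> 0" "h \<in> L2 m" for t h
    using cs[OF TL[OF that]] mult_right_mono[OF Tnorm[OF that] C0] by (simp add: J_def)
  have gen: "form_generator m D \<E> \<psi> w"
    unfolding form_generator_def
  proof (intro conjI ballI \<psi>D wL)
    fix v assume v: "v \<in> D"
    have "l2_inner m (\<lambda>x. - w x) v = l2_inner m (\<lambda>x. 1 * f x + (- \<alpha>) * \<psi> x) v"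
      by (simp add: w_def algebra_simps)
    also have "\<dots> = 1 * l2_inner m f v + (- \<alpha>) * l2_inner m \<psi> v"
      by (intro l2.comb_left f \<psi>L D_L2 v)
    finally show "\<E> \<psi> v = l2_inner m (\<lambda>x. - w x) v" using \<psi>eq[OF v] by simp
  qed
  define z where "z = (\<lambda>s x. (1 / s) * (1 * T s \<psi> x + (-1) * \<psi> x) + (-1) * w x)"
  have zL: "z s \<in> L2 m" if "s \<ge> 0" for s
    unfolding z_def using that by (intro l2.comb_mem TL \<psi>L wL)
  have e0: "((\<lambda>s. l2_norm m (z s)) \<longlongrightarrow> 0) (at_right 0)"
  proof -
    have "((\<lambda>t. l2_norm m (\<lambda>x. (T t \<psi> x - \<psi> x) / t - w x)) \<longlongrightarrow> 0) (at_right 0)"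
      using T gen \<psi>L wL unfolding generated_semigroup_def by blast
    then show ?thesis by (simp add: z_def)
  qed
  have strong: "((\<lambda>s. l2_norm m (\<lambda>x. T s h x - h x)) \<longlongrightarrow> 0) (at_right 0)" if "h \<in> L2 m" for h
    using T that unfolding generated_semigroup_def by blast
  have J_z: "J t (z s) = (J (t + s) \<psi> - J t \<psi>) / s - J t w" if "s > 0" "t \<ge> 0" for s t
  proof -
    have d: "(\<lambda>x. 1 * T s \<psi> x + (-1) * \<psi> x) \<in> L2 m"
      using that by (intro l2.comb_mem TL \<psi>L) auto
    have "J t (z s) = (1 / s) * (1 * J t (T s \<psi>) + (-1) * J t \<psi>) + (-1) * J t w"
      unfolding z_def using that J_comb[OF _ d wL, of t "1/s" "-1"]
        J_comb[OF _ TL[OF _ \<psi>L] \<psi>L, of t s 1 "-1"] by simp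
    then show ?thesis using J_semi[OF that(2) _ \<psi>L, of s] that by (simp add: field_simps)
  qed
  have der: "DERIV (\<lambda>t. J t \<psi>) t :> J t w" if t: "t > 0" for t
    unfolding DERIV_def
  proof (rule filterlim_split_at)
    have "((\<lambda>s. (J (t + s) \<psi> - J t \<psi>) / s - J t w) \<longlongrightarrow> 0) (at_right 0)"
    proof (rule Lim_null_comparison)
      show "((\<lambda>s. l2_norm m (z s) * C) \<longlongrightarrow> 0) (at_right 0)"
        using e0 by (rule tendsto_mult_left_zero)
      have "\<forall>\<^sub>F s in at_right 0. (0::real) < s" by (simp add: eventually_at_right_less)
      then show "\<forall>\<^sub>F s in at_right 0. norm ((J (t + s) \<psi> - J t \<psi>) / s - J t w) \<le> l2_norm m (z s) * C"
      proof eventually_elim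
        case (elim s)
        then show ?case using J_z[of s t] J_bound[of t "z s"] zL[of s] t by simp
      qed
    qed
    then show "((\<lambda>h. (J (t + h) \<psi> - J t \<psi>) / h) \<longlongrightarrow> J t w) (at_right 0)" by (simp add: LIM_zero_iff)
    have "((\<lambda>s. (J (t + - s) \<psi> - J t \<psi>) / - s - J t w) \<longlongrightarrow> 0) (at_right 0)"
    proof (rule Lim_null_comparison)
      show "((\<lambda>s. (l2_norm m (z s) + l2_norm m (\<lambda>x. T s w x - w x)) * C) \<longlongrightarrow> 0) (at_right 0)"
        using tendsto_add[OF e0 strong[OF wL]] by (intro tendsto_mult_left_zero) simp
      have "\<forall>\<^sub>F s in at_right 0. (0::real) < s" "\<forall>\<^sub>F s in at_right 0. s < t"
        using t by (auto simp: eventually_at_right_less eventually_at_right_field intro!: exI[of _ t])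
      then show "\<forall>\<^sub>F s in at_right 0. norm ((J (t + - s) \<psi> - J t \<psi>) / - s - J t w)
          \<le> (l2_norm m (z s) + l2_norm m (\<lambda>x. T s w x - w x)) * C"
      proof eventually_elim
        case (elim s)
        then have s: "0 < s" "0 \<le> t - s" by auto
        have 1: "J (t - s) (z s) = (J t \<psi> - J (t - s) \<psi>) / s - J (t - s) w"
          using J_z[OF s] by simp
        have 2: "J t w = J (t - s) (T s w)" using J_semi[OF s(2) _ wL, of s] s by simp
        have dL: "(\<lambda>x. T s w x - w x) \<in> L2 m" using s by (intro l2.diff_mem TL wL) auto
        have 3: "J (t - s) (\<lambda>x. T s w x - w x) = J t w - J (t - s) w"
          using J_comb[OF s(2) TL[OF _ wL] wL, of s 1 "-1"] 2 s by simp
        have "(J (t + - s) \<psi> - J t \<psi>) / - s = (J t \<psi> - J (t - s) \<psi>) / s"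
          by (simp add: minus_divide_left)
        then have "(J (t + - s) \<psi> - J t \<psi>) / - s - J t w = J (t - s) (z s) - J (t - s) (\<lambda>x. T s w x - w x)"
          unfolding 1 3 by simp
        moreover have "\<bar>J (t - s) (z s)\<bar> \<le> l2_norm m (z s) * C"
          using s zL by (intro J_bound) auto
        moreover have "\<bar>J (t - s) (\<lambda>x. T s w x - w x)\<bar> \<le> l2_norm m (\<lambda>x. T s w x - w x) * C"
          using s dL by (intro J_bound) auto
        ultimately show ?case by (simp add: distrib_right)
      qed
    qed
    then have "((\<lambda>s. (J (t + - s) \<psi> - J t \<psi>) / - s) \<longlongrightarrow> J t w) (at_right 0)" by (rule LIM_zero_cancel)
    then show "((\<lambda>h. (J (t + h) \<psi> - J t \<psi>) / h) \<longlongrightarrow> J t w) (at_left 0)"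
      by (simp add: filterlim_at_left_to_right)
  qed
  have fB: "f \<in> L2 m \<inter> bounded_borel"
    using f by (auto simp: bounded_borel_def bounded_iff intro!: exI[of _ K])
  have AE_T: "AE x in m. transition f t x = ennreal (T t f x) \<and> 0 \<le> T t f x" if t: "t > 0" for t
    using TX[OF t fB]
  proof eventually_elim
    case (elim x)
    interpret p: prob_space "P (Some x)" by (rule P_prob)
    have "0 \<le> zero_ext f y" for y using f(3) by (cases y) (auto simp: zero_ext_def)
    then have "0 \<le> (\<integral>\<omega>. zero_ext f (X (ennreal t) \<omega>) \<partial>P (Some x))" by simp
    then show ?case using transition_eq[OF t f(2,3,4), of x] elim by simp
  qed
  define G where "G = (\<lambda>t. \<integral>\<^sup>+x. transition f t x * ennreal (\<kappa> x) \<partial>m)"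
  have [measurable]: "G \<in> borel_measurable borel"
  proof -
    note [measurable] = transition_measurable[OF f(2)]
    have "(\<lambda>z. transition f (fst z) (snd z) * ennreal (\<kappa> (snd z))) \<in> borel_measurable (borel \<Otimes>\<^sub>M m)"
      by measurable
    from borel_measurable_nn_integral_fst[OF this] show ?thesis by (simp add: G_def)
  qed
  have GJ: "G t = ennreal (J t f)" "0 \<le> J t f" if t: "t > 0" for t
  proof -
    note [measurable] = L2_measurable[OF TL[OF less_imp_le[OF t] f(1)]]
    have ae: "AE x in m. 0 \<le> T t f x * \<kappa> x"
      using AE_T[OF t] by eventually_elim (use \<kappa>(2) in auto)
    have "G t = (\<integral>\<^sup>+x. ennreal (T t f x * \<kappa> x) \<partial>m)"
      unfolding G_def
    proof (rule nn_integral_cong_AE)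
      show "AE x in m. transition f t x * ennreal (\<kappa> x) = ennreal (T t f x * \<kappa> x)"
        using AE_T[OF t] by eventually_elim (use \<kappa>(2) in \<open>auto simp: ennreal_mult\<close>)
    qed
    also have "\<dots> = ennreal (J t f)"
      unfolding J_def l2_inner_def
      using L2_mult_integrable[OF TL[OF less_imp_le[OF t] f(1)] \<kappa>(1)] ae
      by (rule nn_integral_eq_integral)
    finally show "G t = ennreal (J t f)" .
    show "0 \<le> J t f" unfolding J_def l2_inner_def using ae by (rule integral_nonneg_AE)
  qed
  have Jw: "J t w = \<alpha> * J t \<psi> - J t f" if "t > 0" for t
    using J_comb[OF _ \<psi>L f(1), of t \<alpha> "-1"] that by (simp add: w_def)
  have FTC: "(\<integral>\<^sup>+t. ennreal (exp (- \<alpha> * t) * enn2real (G t)) * indicator {a..} t \<partial>lborel)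
      = ennreal (exp (- \<alpha> * a) * J a \<psi>)" if a: "a > 0" for a
  proof -
    have "(\<integral>\<^sup>+t. ennreal (exp (- \<alpha> * t) * enn2real (G t)) * indicator {a..} t \<partial>lborel)
      = ennreal (0 - (- exp (- \<alpha> * a) * J a \<psi>))"
    proof (rule nn_integral_FTC_atLeast)
      show "(\<lambda>t. exp (- \<alpha> * t) * enn2real (G t)) \<in> borel_measurable borel" by measurable
      show "DERIV (\<lambda>t. - exp (- \<alpha> * t) * J t \<psi>) t :> exp (- \<alpha> * t) * enn2real (G t)" if "a \<le> t" for t
      proof -
        have t: "t > 0" using that a by simp
        have "enn2real (G t) = J t f" using GJ[OF t] by simp
        then show ?thesis using der[OF t] Jw[OF t]
          by (auto intro!: derivative_eq_intros simp: algebra_simps)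
      qed
      have "((\<lambda>t. exp (- (\<alpha> * t))) \<longlongrightarrow> 0) at_top"
        using \<alpha> by (intro filterlim_compose[OF exp_at_bot] filterlim_uminus_at_bot_at_top
          filterlim_compose[OF filterlim_uminus_at_bot_at_top] filterlim_tendsto_pos_mult_at_top[OF tendsto_const _ filterlim_ident]) auto
      then have lim: "((\<lambda>t. exp (- \<alpha> * t) * (l2_norm m \<psi> * C)) \<longlongrightarrow> 0) at_top"
        by (intro tendsto_mult_left_zero) simp
      show "((\<lambda>t. - exp (- \<alpha> * t) * J t \<psi>) \<longlongrightarrow> 0) at_top"
      proof (rule Lim_null_comparison[OF _ lim])
        have "\<forall>\<^sub>F t in at_top. (0::real) \<le> t" by (rule eventually_ge_at_top)
        then show "\<forall>\<^sub>F t in at_top. norm (- exp (- \<alpha> * t) * J t \<psi>) \<le> exp (- \<alpha> * t) * (l2_norm m \<psi> * C)"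
          by eventually_elim (use J_bound[OF _ \<psi>L] in \<open>auto simp: abs_mult\<close>)
      qed
    qed auto
    then show ?thesis by simp
  qed
  define a where "a = (\<lambda>n. 1 / real (Suc n))"
  have a: "a n > 0" "a (Suc n) \<le> a n" for n by (auto simp: a_def field_simps)
  have a0: "a \<longlonglongrightarrow> 0" using LIMSEQ_inverse_real_of_nat by (simp add: a_def inverse_eq_divide)
  have dec: "decseq a" using a(2) by (rule decseq_SucI)
  let ?H = "\<lambda>t. ennreal (exp (- \<alpha> * t) * enn2real (G t))"
  have inc: "incseq (\<lambda>n t. ?H t * indicator {a n..} t)"
    unfolding incseq_def le_fun_def
  proof (intro allI impI)
    fix i j :: nat and t :: real assume "i \<le> j"
    then have "a j \<le> a i" using dec by (simp add: decseq_def)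
    then show "?H t * indicator {a i..} t \<le> ?H t * indicator {a j..} t"
      by (auto simp: indicator_def)
  qed
  have "(\<integral>\<^sup>+t. (indicator {0<..} t * ennreal (exp (- \<alpha> * t))) * G t \<partial>lborel)
     = (\<integral>\<^sup>+t. (SUP n. ?H t * indicator {a n..} t) \<partial>lborel)"
  proof (rule nn_integral_cong)
    fix t :: real
    show "(indicator {0<..} t * ennreal (exp (- \<alpha> * t))) * G t = (SUP n. ?H t * indicator {a n..} t)"
    proof (cases "t > 0")
      case True
      then obtain n where n: "a n < t" using order_tendstoD(2)[OF a0 True] by (auto simp: eventually_sequentially)
      have "(SUP n. ?H t * indicator {a n..} t) = ?H t"
        by (rule antisym) (use n in \<open>auto intro!: SUP_upper2[of n] SUP_least simp: indicator_def\<close>)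
      then show ?thesis using True GJ[OF True] by (simp add: ennreal_mult')
    next
      case False
      then have "indicator {a n..} t = (0::ennreal)" for n
        using a(1)[of n] by (auto simp: indicator_def)
      then show ?thesis using False by simp
    qed
  qed
  also have "\<dots> = (SUP n. \<integral>\<^sup>+t. ?H t * indicator {a n..} t \<partial>lborel)"
    by (rule nn_integral_monotone_convergence_SUP[OF inc]) measurable
  also have "\<dots> = ennreal (l2_inner m \<psi> \<kappa>)"
  proof (rule LIMSEQ_unique)
    show "(\<lambda>n. \<integral>\<^sup>+t. ?H t * indicator {a n..} t \<partial>lborel) \<longlonglongrightarrow> (SUP n. \<integral>\<^sup>+t. ?H t * indicator {a n..} t \<partial>lborel)"
      using inc by (intro LIMSEQ_SUP) (auto simp: incseq_def le_fun_def intro!: nn_integral_mono)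
    have fa: "filterlim a (at_right 0) sequentially"
      unfolding filterlim_at
      by (intro conjI a0 always_eventually allI) (use a(1) in \<open>auto simp: less_imp_neq[symmetric]\<close>)
    have "(\<lambda>n. J (a n) \<psi> - l2_inner m \<psi> \<kappa>) \<longlonglongrightarrow> 0"
    proof (rule Lim_null_comparison)
      show "(\<lambda>n. l2_norm m (\<lambda>x. T (a n) \<psi> x - \<psi> x) * C) \<longlonglongrightarrow> 0"
        by (intro tendsto_mult_left_zero filterlim_compose[OF strong[OF \<psi>L] fa])
      show "\<forall>\<^sub>F n in sequentially. norm (J (a n) \<psi> - l2_inner m \<psi> \<kappa>) \<le> l2_norm m (\<lambda>x. T (a n) \<psi> x - \<psi> x) * C"
      proof (intro always_eventually allI)
        fix n
        have TaL: "T (a n) \<psi> \<in> L2 m" using a(1)[of n] \<psi>L by (intro TL) auto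
        have "J (a n) \<psi> - l2_inner m \<psi> \<kappa> = l2_inner m (\<lambda>x. T (a n) \<psi> x - \<psi> x) \<kappa>"
          unfolding J_def using TaL \<psi>L \<kappa>(1) by (simp add: l2.diff_left)
        then show "norm (J (a n) \<psi> - l2_inner m \<psi> \<kappa>) \<le> l2_norm m (\<lambda>x. T (a n) \<psi> x - \<psi> x) * C"
          using cs[OF l2.diff_mem[OF TaL \<psi>L]] by simp
      qed
    qed
    then have "(\<lambda>n. J (a n) \<psi>) \<longlonglongrightarrow> l2_inner m \<psi> \<kappa>" by (rule LIM_zero_cancel)
    then have "(\<lambda>n. ennreal (exp (- \<alpha> * a n) * J (a n) \<psi>)) \<longlonglongrightarrow> ennreal (exp (- \<alpha> * 0) * l2_inner m \<psi> \<kappa>)"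
      by (intro tendsto_intros a0)
    then show "(\<lambda>n. \<integral>\<^sup>+t. ?H t * indicator {a n..} t \<partial>lborel) \<longlonglongrightarrow> ennreal (l2_inner m \<psi> \<kappa>)"
      using FTC[OF a(1)] by simp
  qed
  finally show ?thesis by (simp add: G_def)
qed

lemma process_resolvent_nonneg_AE:
  assumes \<alpha>: "\<alpha> > 0" and f: "f \<in> L2 m" "f \<in> borel_measurable borel" "\<And>x. 0 \<le> f x" "\<And>x. f x \<le> K"
    and r: "is_resolvent \<alpha> f \<psi>"
  shows "AE x in m. resolvent X P \<alpha> f x = \<psi> x"
proof -
  have \<psi>D: "\<psi> \<in> D" using r by (simp add: is_resolvent_def)
  note [measurable] = D_measurable[OF \<psi>D] process_resolvent_measurable[OF \<alpha> f(2,3,4)]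
  have \<psi>0: "AE x in m. 0 \<le> \<psi> x" by (rule resolvent_nonneg[OF \<alpha> f(1,3,4) r])
  have "AE x in m. ennreal (resolvent X P \<alpha> f x) = ennreal (\<psi> x)"
  proof (rule AE_eq_nn_integral_finite_sets)
    fix A assume A [measurable]: "A \<in> sets m" and fin: "emeasure m A < \<infinity>"
    define \<kappa> :: "'a \<Rightarrow> real" where "\<kappa> = indicator A"
    have "integrable m \<kappa>" unfolding \<kappa>_def using fin by simp
    then have \<kappa>L: "\<kappa> \<in> L2 m" by (rule L2_bounded_integrable[where K = 1]) (simp add: \<kappa>_def indicator_def)
    interpret pair: pair_sigma_finite m lborel ..
    note [measurable] = L2_measurable[OF \<kappa>L]
    have tm: "(\<lambda>(x, t). (indicator {0<..} t * ennreal (exp (- \<alpha> * t))) * (transition f t x * ennreal (\<kappa> x)))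
        \<in> borel_measurable (m \<Otimes>\<^sub>M lborel)"
    proof -
      have "(\<lambda>w. (snd w, fst w)) \<in> (m \<Otimes>\<^sub>M lborel) \<rightarrow>\<^sub>M (borel \<Otimes>\<^sub>M m)" by measurable
      from measurable_compose[OF this transition_measurable[OF f(2)]]
      have [measurable]: "(\<lambda>w. transition f (snd w) (fst w)) \<in> borel_measurable (m \<Otimes>\<^sub>M lborel)" by simp
      show ?thesis unfolding case_prod_beta' by measurable
    qed
    have tx: "(\<lambda>t. transition f t x) \<in> borel_measurable borel" if "x \<in> space m" for x
    proof -
      have "(\<lambda>t. (t, x)) \<in> borel \<rightarrow>\<^sub>M (borel \<Otimes>\<^sub>M m)" using that by measurable
      from measurable_compose[OF this transition_measurable[OF f(2)]] show ?thesis by simp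
    qed
    have tt: "(\<lambda>x. transition f t x) \<in> borel_measurable m" for t
    proof -
      have "(\<lambda>x. (t, x)) \<in> m \<rightarrow>\<^sub>M (borel \<Otimes>\<^sub>M m)" by measurable
      from measurable_compose[OF this transition_measurable[OF f(2)]] show ?thesis by simp
    qed
    have "(\<integral>\<^sup>+x. ennreal (resolvent X P \<alpha> f x) * indicator A x \<partial>m)
      = (\<integral>\<^sup>+x. \<integral>\<^sup>+t. (indicator {0<..} t * ennreal (exp (- \<alpha> * t))) * (transition f t x * ennreal (\<kappa> x)) \<partial>lborel \<partial>m)"
    proof (rule nn_integral_cong)
      fix x assume x: "x \<in> space m"
      note [measurable] = tx[OF x]
      have "(\<integral>\<^sup>+t. (indicator {0<..} t * ennreal (exp (- \<alpha> * t))) * (transition f t x * ennreal (\<kappa> x)) \<partial>lborel)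
         = (\<integral>\<^sup>+t. ((indicator {0<..} t * ennreal (exp (- \<alpha> * t))) * transition f t x) * ennreal (\<kappa> x) \<partial>lborel)"
        by (simp add: mult.assoc)
      also have "\<dots> = (\<integral>\<^sup>+t. (indicator {0<..} t * ennreal (exp (- \<alpha> * t))) * transition f t x \<partial>lborel) * ennreal (\<kappa> x)"
        by (rule nn_integral_multc) measurable
      finally show "ennreal (resolvent X P \<alpha> f x) * indicator A x
        = (\<integral>\<^sup>+t. (indicator {0<..} t * ennreal (exp (- \<alpha> * t))) * (transition f t x * ennreal (\<kappa> x)) \<partial>lborel)"
        unfolding process_resolvent_transition(1)[OF \<alpha> f(2,3,4)] by (simp add: \<kappa>_def indicator_def)
    qed
    also have "\<dots> = (\<integral>\<^sup>+t. \<integral>\<^sup>+x. (indicator {0<..} t * ennreal (exp (- \<alpha> * t))) * (transition f t x * ennreal (\<kappa> x)) \<partial>m \<partial>lborel)"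
      using pair.Fubini'[OF tm] by simp
    also have "\<dots> = (\<integral>\<^sup>+t. (indicator {0<..} t * ennreal (exp (- \<alpha> * t))) * (\<integral>\<^sup>+x. transition f t x * ennreal (\<kappa> x) \<partial>m) \<partial>lborel)"
    proof (rule nn_integral_cong)
      fix t :: real
      note [measurable] = tt[of t]
      show "(\<integral>\<^sup>+x. (indicator {0<..} t * ennreal (exp (- \<alpha> * t))) * (transition f t x * ennreal (\<kappa> x)) \<partial>m)
         = (indicator {0<..} t * ennreal (exp (- \<alpha> * t))) * (\<integral>\<^sup>+x. transition f t x * ennreal (\<kappa> x) \<partial>m)"
        by (rule nn_integral_cmult) measurable
    qed
    also have "\<dots> = ennreal (l2_inner m \<psi> \<kappa>)"
      by (rule semigroup_laplace[OF \<alpha> f r \<kappa>L]) (simp add: \<kappa>_def)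
    also have "\<dots> = (\<integral>\<^sup>+x. ennreal (\<psi> x * \<kappa> x) \<partial>m)"
      unfolding l2_inner_def using \<psi>0 L2_mult_integrable[OF D_L2[OF \<psi>D] \<kappa>L]
      by (intro nn_integral_eq_integral[symmetric]) (auto simp: \<kappa>_def elim!: eventually_mono)
    also have "\<dots> = (\<integral>\<^sup>+x. ennreal (\<psi> x) * indicator A x \<partial>m)"
      by (intro nn_integral_cong) (auto simp: \<kappa>_def indicator_def)
    finally show "(\<integral>\<^sup>+x. ennreal (resolvent X P \<alpha> f x) * indicator A x \<partial>m) = (\<integral>\<^sup>+x. ennreal (\<psi> x) * indicator A x \<partial>m)" .
  qed measurable
  then show ?thesis using \<psi>0
    by eventually_elim (use process_resolvent_transition(2)[OF \<alpha> f(2,3,4)] in simp)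
qed

lemma process_resolvent_AE:
  assumes \<alpha>: "\<alpha> > 0" and f: "f \<in> L2 m" "f \<in> borel_measurable borel" "\<And>x. \<bar>f x\<bar> \<le> K"
    and r: "is_resolvent \<alpha> f \<psi>"
  shows "AE x in m. resolvent X P \<alpha> f x = \<psi> x"
proof -
  define fp where "fp = (\<lambda>x. max (f x) 0)"
  define fn where "fn = (\<lambda>x. max (- f x) 0)"
  note [measurable] = f(2) L2_measurable[OF f(1)]
  have b: "0 \<le> fp x" "fp x \<le> K" "\<bar>fp x\<bar> \<le> K" "0 \<le> fn x" "fn x \<le> K" "\<bar>fn x\<bar> \<le> K" for x
    using f(3)[of x] by (auto simp: fp_def fn_def)
  have meas: "fp \<in> borel_measurable borel" "fn \<in> borel_measurable borel"
    by (auto simp: fp_def fn_def)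
  have L: "fp \<in> L2 m" "fn \<in> L2 m"
    by (rule L2_dominated[OF f(1)]; auto simp: fp_def fn_def)+
  have eq: "(\<lambda>x. fp x - fn x) = f" by (auto simp: fp_def fn_def)
  obtain \<psi>1 where 1: "is_resolvent \<alpha> fp \<psi>1" using resolvent_exists[OF \<alpha> L(1) b(3)] by blast
  obtain \<psi>2 where 2: "is_resolvent \<alpha> fn \<psi>2" using resolvent_exists[OF \<alpha> L(2) b(6)] by blast
  have "AE x in m. \<psi> x = \<psi>1 x - \<psi>2 x"
    using resolvent_unique[OF \<alpha> f(1) r resolvent_diff[OF L 1 2, unfolded eq]] .
  moreover have "AE x in m. resolvent X P \<alpha> fp x = \<psi>1 x"
    by (rule process_resolvent_nonneg_AE[OF \<alpha> L(1) meas(1) b(1,2) 1])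
  moreover have "AE x in m. resolvent X P \<alpha> fn x = \<psi>2 x"
    by (rule process_resolvent_nonneg_AE[OF \<alpha> L(2) meas(2) b(4,5) 2])
  ultimately show ?thesis
  proof eventually_elim
    case (elim x)
    then show ?case
      using process_resolvent_diff[OF \<alpha> meas(1) b(3) meas(2) b(6), of x] by (simp add: eq)
  qed
qed

end


section \<open>Jordan decomposition of bounded signed measures\<close>

lemma signed_empty:
  assumes "\<mu> \<in> bounded_signed_measures"
  shows "\<mu> {} = 0"
proof -
  have "(\<lambda>i::nat. \<mu> {}) sums \<mu> (\<Union>i::nat. {})"
    using assms by (auto simp: bounded_signed_measures_def disjoint_family_on_def
        dest!: spec[of _ "\<lambda>i. {}"])
  then have "summable (\<lambda>i::nat. \<mu> {})" by (rule sums_summable)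
  then show ?thesis by (simp add: summable_const_iff)
qed

lemma signed_sums:
  fixes B :: "nat \<Rightarrow> 'a::topological_space set"
  assumes "\<mu> \<in> bounded_signed_measures" "\<And>i. B i \<in> sets borel" "disjoint_family B"
  shows "(\<lambda>i. \<mu> (B i)) sums \<mu> (\<Union>i. B i)"
  using assms by (auto simp: bounded_signed_measures_def)

lemma signed_union:
  assumes \<mu>: "\<mu> \<in> bounded_signed_measures" and "A \<in> sets borel" "B \<in> sets borel" "A \<inter> B = {}"
  shows "\<mu> (A \<union> B) = \<mu> A + \<mu> B"
proof -
  have "(\<lambda>i. \<mu> (binaryset A B i)) sums \<mu> (\<Union>i. binaryset A B i)"
    using assms by (intro signed_sums)
      (auto simp: binaryset_def disjoint_family_on_def)
  then have "(\<lambda>i. \<mu> (binaryset A B i)) sums \<mu> (A \<union> B)" by (simp add: UN_binaryset_eq)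
  moreover have "(\<lambda>i. \<mu> (binaryset A B i)) sums (\<mu> A + \<mu> B)"
    by (rule binaryset_sums) (rule signed_empty[OF \<mu>])
  ultimately show ?thesis by (rule sums_unique2)
qed

lemma signed_diff:
  assumes "\<mu> \<in> bounded_signed_measures" "A \<in> sets borel" "B \<in> sets borel" "B \<subseteq> A"
  shows "\<mu> (A - B) = \<mu> A - \<mu> B"
proof -
  have "\<mu> ((A - B) \<union> B) = \<mu> (A - B) + \<mu> B" using assms by (intro signed_union) auto
  moreover have "(A - B) \<union> B = A" using assms by auto
  ultimately show ?thesis by simp
qed

lemma signed_uminus:
  assumes "\<mu> \<in> bounded_signed_measures"
  shows "(\<lambda>A. - \<mu> A) \<in> bounded_signed_measures"
  using assms sums_minus unfolding bounded_signed_measures_def by blast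

definition sup_subsets :: "('a::topological_space set \<Rightarrow> real) \<Rightarrow> 'a set \<Rightarrow> ennreal" where
  "sup_subsets \<mu> B = (SUP A\<in>{A \<in> sets borel. A \<subseteq> B}. ennreal (\<mu> A))"

lemma sup_subsets_upper: "A \<in> sets borel \<Longrightarrow> A \<subseteq> B \<Longrightarrow> ennreal (\<mu> A) \<le> sup_subsets \<mu> B"
  unfolding sup_subsets_def by (intro SUP_upper) auto

lemma sup_subsets_mono: "B \<subseteq> C \<Longrightarrow> sup_subsets \<mu> B \<le> sup_subsets \<mu> C"
  unfolding sup_subsets_def by (intro SUP_subset_mono) auto

lemma sup_subsets_superadditive:
  assumes \<mu>: "\<mu> \<in> bounded_signed_measures" and "B \<inter> C = {}"
  shows "sup_subsets \<mu> B + sup_subsets \<mu> C \<le> sup_subsets \<mu> (B \<union> C)"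
proof -
  have ne: "{A \<in> sets borel. A \<subseteq> B} \<noteq> {}" "{A \<in> sets borel. A \<subseteq> C} \<noteq> {}" by blast+
  have *: "ennreal (\<mu> A) + ennreal (\<mu> A') \<le> sup_subsets \<mu> (B \<union> C)"
    if A: "A \<in> sets borel" "A \<subseteq> B" and A': "A' \<in> sets borel" "A' \<subseteq> C" for A A'
  proof -
    define A1 where "A1 = (if 0 \<le> \<mu> A then A else {})"
    define A2 where "A2 = (if 0 \<le> \<mu> A' then A' else {})"
    have 1: "ennreal (\<mu> A) = ennreal (\<mu> A1)" "0 \<le> \<mu> A1" "A1 \<in> sets borel" "A1 \<subseteq> B"
      using A signed_empty[OF \<mu>] by (auto simp: A1_def ennreal_neg)
    have 2: "ennreal (\<mu> A') = ennreal (\<mu> A2)" "0 \<le> \<mu> A2" "A2 \<in> sets borel" "A2 \<subseteq> C"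
      using A' signed_empty[OF \<mu>] by (auto simp: A2_def ennreal_neg)
    have "ennreal (\<mu> A) + ennreal (\<mu> A') = ennreal (\<mu> A1 + \<mu> A2)" using 1 2 by simp
    also have "\<mu> A1 + \<mu> A2 = \<mu> (A1 \<union> A2)"
      using 1 2 assms by (intro signed_union[symmetric]) auto
    also have "ennreal (\<mu> (A1 \<union> A2)) \<le> sup_subsets \<mu> (B \<union> C)"
      using 1 2 by (intro sup_subsets_upper) auto
    finally show ?thesis .
  qed
  have "sup_subsets \<mu> B + sup_subsets \<mu> C
      = (SUP A'\<in>{A \<in> sets borel. A \<subseteq> C}. SUP A\<in>{A \<in> sets borel. A \<subseteq> B}. ennreal (\<mu> A) + ennreal (\<mu> A'))"
    unfolding sup_subsets_def
    using ne by (simp add: ennreal_SUP_add_left ennreal_SUP_add_right)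
  also have "\<dots> \<le> sup_subsets \<mu> (B \<union> C)" by (intro SUP_least *) auto
  finally show ?thesis .
qed

lemma ennreal_add_le: "ennreal (a + b) \<le> ennreal a + ennreal b"
  by (cases "0 \<le> a"; cases "0 \<le> b")
     (auto simp: ennreal_neg ennreal_plus[symmetric] simp del: ennreal_plus intro: ennreal_leI)

lemma sup_subsets_countably_additive:
  assumes \<mu>: "\<mu> \<in> bounded_signed_measures"
  shows "countably_additive (sets borel) (sup_subsets \<mu>)"
proof (unfold countably_additive_def, intro allI impI)
  fix B :: "nat \<Rightarrow> 'a set" assume B: "range B \<subseteq> sets borel" "disjoint_family B"
  have Bi: "B i \<in> sets borel" for i using B by auto
  show "(\<Sum>i. sup_subsets \<mu> (B i)) = sup_subsets \<mu> (\<Union>i. B i)"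
  proof (rule antisym)
    have fin: "(\<Sum>i<n. sup_subsets \<mu> (B i)) \<le> sup_subsets \<mu> (\<Union>i<n. B i)" for n
    proof (induction n)
      case (Suc n)
      have "B i \<inter> B n = {}" if "i < n" for i
        using that disjoint_family_onD[OF B(2), of i n] by simp
      then have "(\<Union>i<n. B i) \<inter> B n = {}" by blast
      from sup_subsets_superadditive[OF \<mu> this]
      have "sup_subsets \<mu> (\<Union>i<n. B i) + sup_subsets \<mu> (B n) \<le> sup_subsets \<mu> (\<Union>i<Suc n. B i)"
        by (simp add: lessThan_Suc Un_commute)
      with Suc show ?case by (simp add: add_mono order_trans[OF add_right_mono])
    qed simp
    show "(\<Sum>i. sup_subsets \<mu> (B i)) \<le> sup_subsets \<mu> (\<Union>i. B i)"
      unfolding suminf_eq_SUP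
      by (intro SUP_least order_trans[OF fin] sup_subsets_mono) auto
    show "sup_subsets \<mu> (\<Union>i. B i) \<le> (\<Sum>i. sup_subsets \<mu> (B i))"
      unfolding sup_subsets_def[of \<mu> "\<Union>i. B i"]
    proof (rule SUP_least, clarify)
      fix A :: "'a set" assume A: "A \<in> sets borel" "A \<subseteq> (\<Union>i. B i)"
      have "(\<lambda>i. \<mu> (A \<inter> B i)) sums \<mu> (\<Union>i. A \<inter> B i)"
        using A Bi by (intro signed_sums[OF \<mu>] disjoint_family_on_bisimulation[OF B(2)]) auto
      also have "(\<Union>i. A \<inter> B i) = A" using A by auto
      finally have lim: "(\<lambda>n. \<Sum>i<n. \<mu> (A \<inter> B i)) \<longlonglongrightarrow> \<mu> A" by (simp add: sums_def)
      have "ennreal (\<Sum>i<n. \<mu> (A \<inter> B i)) \<le> (\<Sum>i<n. sup_subsets \<mu> (B i))" for n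
      proof (induction n)
        case (Suc n)
        have "ennreal (\<Sum>i<Suc n. \<mu> (A \<inter> B i)) \<le> ennreal (\<Sum>i<n. \<mu> (A \<inter> B i)) + ennreal (\<mu> (A \<inter> B n))"
          by (simp add: ennreal_add_le)
        also have "\<dots> \<le> (\<Sum>i<n. sup_subsets \<mu> (B i)) + sup_subsets \<mu> (B n)"
          using A Bi by (intro add_mono Suc sup_subsets_upper) auto
        finally show ?case by simp
      qed simp
      also have "(\<Sum>i<n. sup_subsets \<mu> (B i)) \<le> (\<Sum>i. sup_subsets \<mu> (B i))" for n
        by (rule sum_le_suminf) auto
      finally have "ennreal (\<Sum>i<n. \<mu> (A \<inter> B i)) \<le> (\<Sum>i. sup_subsets \<mu> (B i))" for n .
      then show "ennreal (\<mu> A) \<le> (\<Sum>i. sup_subsets \<mu> (B i))"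
        by (intro LIMSEQ_le_const2[OF tendsto_ennrealI[OF lim]]) auto
    qed
  qed
qed

lemma sets_pos_part [simp, measurable_cong]: "sets (pos_part \<mu>) = sets borel"
  and space_pos_part [simp]: "space (pos_part \<mu>) = UNIV"
  using sets.sigma_sets_eq[of borel] by (auto simp: pos_part_def)

lemma emeasure_pos_part:
  assumes \<mu>: "\<mu> \<in> bounded_signed_measures" and B: "B \<in> sets borel"
  shows "emeasure (pos_part \<mu>) B = sup_subsets \<mu> B"
proof (rule emeasure_measure_of[OF pos_part_def[of \<mu>, folded sup_subsets_def]])
  show "positive (sets (pos_part \<mu>)) (sup_subsets \<mu>)"
    using signed_empty[OF \<mu>] by (auto simp: positive_def sup_subsets_def)
  show "countably_additive (sets (pos_part \<mu>)) (sup_subsets \<mu>)"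
    using sup_subsets_countably_additive[OF \<mu>] by simp
qed (use B in auto)

text \<open>If the values on subsets of \<open>UNIV\<close> were unbounded, one could descend through sets with
  unboundedly large values, all of whose subsets' values are again unbounded; but the values along
  a decreasing sequence converge.\<close>

lemma signed_bounded:
  fixes \<mu> :: "'a::topological_space set \<Rightarrow> real"
  assumes \<mu>: "\<mu> \<in> bounded_signed_measures"
  shows "\<exists>C. \<forall>A\<in>sets borel. \<bar>\<mu> A\<bar> \<le> C"
proof (rule ccontr)
  define U where "U = (\<lambda>B. \<forall>C. \<exists>A\<in>sets borel. A \<subseteq> B \<and> \<not> \<bar>\<mu> A\<bar> \<le> C)"
  assume "\<not> ?thesis"
  then have U0: "U UNIV" unfolding U_def by auto
  have step: "\<exists>B'. (B' \<in> sets borel \<and> U B') \<and> B' \<subseteq> B \<and> n \<le> \<bar>\<mu> B'\<bar>"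
    if B: "B \<in> sets borel" "U B" for B n
  proof -
    obtain A where A: "A \<in> sets borel" "A \<subseteq> B" "\<not> \<bar>\<mu> A\<bar> \<le> \<bar>n\<bar> + \<bar>\<mu> B\<bar>"
      using B(2) unfolding U_def by blast
    have d: "\<mu> (B - A) = \<mu> B - \<mu> A" using A B by (intro signed_diff[OF \<mu>]) auto
    have "U A \<or> U (B - A)"
    proof (rule ccontr)
      assume "\<not> (U A \<or> U (B - A))"
      then have "\<not> U A" "\<not> U (B - A)" by auto
      then obtain C1 C2 where C: "\<And>S. S \<in> sets borel \<Longrightarrow> S \<subseteq> A \<Longrightarrow> \<bar>\<mu> S\<bar> \<le> C1"
        "\<And>S. S \<in> sets borel \<Longrightarrow> S \<subseteq> B - A \<Longrightarrow> \<bar>\<mu> S\<bar> \<le> C2"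
        unfolding U_def not_all not_ex bex_simps by (metis (no_types))
      obtain S where S: "S \<in> sets borel" "S \<subseteq> B" "\<not> \<bar>\<mu> S\<bar> \<le> C1 + C2"
        using B(2) unfolding U_def by blast
      have "\<mu> ((S \<inter> A) \<union> (S - A)) = \<mu> (S \<inter> A) + \<mu> (S - A)"
        using S A by (intro signed_union[OF \<mu>]) auto
      moreover have "(S \<inter> A) \<union> (S - A) = S" by auto
      moreover have "\<bar>\<mu> (S \<inter> A)\<bar> \<le> C1" using S A by (intro C) auto
      moreover have "\<bar>\<mu> (S - A)\<bar> \<le> C2" using S A by (intro C) auto
      ultimately show False using S(3) by simp
    qed
    then show ?thesis
    proof
      assume "U A"
      moreover have "n \<le> \<bar>\<mu> A\<bar>" using A(3) by linarith
      ultimately show ?thesis using A(1,2) by blast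
    next
      assume "U (B - A)"
      moreover have "n \<le> \<bar>\<mu> (B - A)\<bar>" using A(3) d by linarith
      ultimately show ?thesis using A(1) B(1) by blast
    qed
  qed
  have "\<exists>C. \<forall>n. (C n \<in> sets borel \<and> U (C n)) \<and> (C (Suc n) \<subseteq> C n \<and> real n \<le> \<bar>\<mu> (C (Suc n))\<bar>)"
    by (rule dependent_nat_choice) (use U0 step in auto)
  then obtain C where C: "\<And>n. C n \<in> sets borel" "\<And>n. C (Suc n) \<subseteq> C n"
      "\<And>n. real n \<le> \<bar>\<mu> (C (Suc n))\<bar>" by blast
  have dec: "decseq C" using C(2) by (rule decseq_SucI)
  have "disjoint_family (\<lambda>n. C n - C (Suc n))"
    unfolding disjoint_family_on_def
  proof (intro ballI impI)
    fix i j :: nat assume "i \<noteq> j"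
    then consider "Suc i \<le> j" | "Suc j \<le> i" by linarith
    then show "(C i - C (Suc i)) \<inter> (C j - C (Suc j)) = {}"
      using decseqD[OF dec] by cases blast+
  qed
  then have "(\<lambda>n. \<mu> (C n - C (Suc n))) sums \<mu> (\<Union>n. C n - C (Suc n))"
    using C by (intro signed_sums[OF \<mu>]) auto
  moreover have "\<mu> (C n - C (Suc n)) = \<mu> (C n) - \<mu> (C (Suc n))" for n
    using C by (intro signed_diff[OF \<mu>])
  ultimately have "(\<lambda>n. \<Sum>i<n. \<mu> (C i) - \<mu> (C (Suc i))) \<longlonglongrightarrow> \<mu> (\<Union>n. C n - C (Suc n))"
    by (simp add: sums_def)
  moreover have "(\<Sum>i<n. \<mu> (C i) - \<mu> (C (Suc i))) = \<mu> (C 0) - \<mu> (C n)" for n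
    by (rule sum_lessThan_telescope')
  ultimately have "(\<lambda>n. \<mu> (C 0) - \<mu> (C n)) \<longlonglongrightarrow> \<mu> (\<Union>n. C n - C (Suc n))" by simp
  then have "(\<lambda>n. \<mu> (C 0) - (\<mu> (C 0) - \<mu> (C n))) \<longlonglongrightarrow> \<mu> (C 0) - \<mu> (\<Union>n. C n - C (Suc n))"
    by (intro tendsto_intros)
  then have "(\<lambda>n. \<mu> (C n)) \<longlonglongrightarrow> \<mu> (C 0) - \<mu> (\<Union>n. C n - C (Suc n))" by simp
  then have "Bseq (\<lambda>n. \<mu> (C n))" by (intro convergent_imp_Bseq convergentI)
  then obtain K where K: "\<And>n. \<bar>\<mu> (C n)\<bar> \<le> K" by (auto simp: Bseq_def)
  obtain n where "K < real n" using reals_Archimedean2 by blast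
  then show False using C(3)[of n] K[of "Suc n"] by linarith
qed

lemma finite_pos_part:
  assumes \<mu>: "\<mu> \<in> bounded_signed_measures"
  shows "finite_measure (pos_part \<mu>)"
proof (rule finite_measureI)
  obtain C where C: "\<forall>A\<in>sets borel. \<bar>\<mu> A\<bar> \<le> C" using signed_bounded[OF \<mu>] by blast
  have "sup_subsets \<mu> UNIV \<le> ennreal C"
    unfolding sup_subsets_def using C by (intro SUP_least ennreal_leI) (auto simp: abs_le_iff)
  then show "emeasure (pos_part \<mu>) (space (pos_part \<mu>)) \<noteq> \<infinity>"
    using emeasure_pos_part[OF \<mu>, of UNIV] by (auto simp: top_unique)
qed

lemma measure_pos_part_upper:
  assumes \<mu>: "\<mu> \<in> bounded_signed_measures" and "A \<in> sets borel" "B \<in> sets borel" "A \<subseteq> B"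
  shows "\<mu> A \<le> measure (pos_part \<mu>) B"
proof -
  interpret finite_measure "pos_part \<mu>" using \<mu> by (rule finite_pos_part)
  have "ennreal (\<mu> A) \<le> ennreal (measure (pos_part \<mu>) B)"
    using sup_subsets_upper[OF assms(2,4)] emeasure_pos_part[OF \<mu> assms(3)]
    by (simp add: emeasure_eq_measure)
  then show ?thesis by (simp add: ennreal_le_iff)
qed

lemma measure_pos_part_least:
  assumes \<mu>: "\<mu> \<in> bounded_signed_measures" and "B \<in> sets borel" "0 \<le> C"
    "\<And>A. A \<in> sets borel \<Longrightarrow> A \<subseteq> B \<Longrightarrow> \<mu> A \<le> C"
  shows "measure (pos_part \<mu>) B \<le> C"
proof -
  interpret finite_measure "pos_part \<mu>" using \<mu> by (rule finite_pos_part)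
  have "sup_subsets \<mu> B \<le> ennreal C"
    unfolding sup_subsets_def using assms by (intro SUP_least ennreal_leI) auto
  then have "ennreal (measure (pos_part \<mu>) B) \<le> ennreal C"
    using emeasure_pos_part[OF \<mu> assms(2)] by (simp add: emeasure_eq_measure)
  then show ?thesis using assms by (simp add: ennreal_le_iff)
qed

text \<open>For \<open>A \<subseteq> B\<close> the value at \<open>B - A\<close> is \<open>\<mu> B - \<mu> A\<close>, so the suprema over subsets of \<open>\<mu>\<close> and of \<open>-\<mu>\<close> differ
  by \<open>\<mu> B\<close>.\<close>

lemma jordan_decomposition:
  assumes \<mu>: "\<mu> \<in> bounded_signed_measures" and B: "B \<in> sets borel"
  shows "\<mu> B = measure (pos_part \<mu>) B - measure (neg_part \<mu>) B"
proof -
  have *: "measure (pos_part (\<lambda>A. - \<nu> A)) B \<le> measure (pos_part \<nu>) B - \<nu> B"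
    if \<nu>: "\<nu> \<in> bounded_signed_measures" for \<nu> :: "'a set \<Rightarrow> real"
  proof (rule measure_pos_part_least[OF signed_uminus[OF \<nu>] B])
    show "0 \<le> measure (pos_part \<nu>) B - \<nu> B" using measure_pos_part_upper[OF \<nu> B B] by simp
    fix A :: "'a set" assume A: "A \<in> sets borel" "A \<subseteq> B"
    have "\<nu> (B - A) \<le> measure (pos_part \<nu>) B"
      using A B by (intro measure_pos_part_upper[OF \<nu>]) auto
    then show "- \<nu> A \<le> measure (pos_part \<nu>) B - \<nu> B"
      using signed_diff[OF \<nu> B A] by simp
  qed
  show ?thesis
    unfolding neg_part_def using *[OF \<mu>] *[OF signed_uminus[OF \<mu>]] by simp
qed

lemma sets_neg_part [simp, measurable_cong]: "sets (neg_part \<mu>) = sets borel"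
  and space_neg_part [simp]: "space (neg_part \<mu>) = UNIV"
  by (auto simp: neg_part_def)

lemma finite_neg_part: "\<mu> \<in> bounded_signed_measures \<Longrightarrow> finite_measure (neg_part \<mu>)"
  unfolding neg_part_def by (intro finite_pos_part signed_uminus)

lemma nn_integral_cong_measures3:
  fixes f :: "'a::topological_space \<Rightarrow> ennreal"
  assumes sets: "sets a1 = sets borel" "sets a2 = sets borel" "sets a3 = sets borel"
      "sets b1 = sets borel" "sets b2 = sets borel" "sets b3 = sets borel"
    and eq: "\<And>B. B \<in> sets borel \<Longrightarrow>
        emeasure a1 B + emeasure a2 B + emeasure a3 B = emeasure b1 B + emeasure b2 B + emeasure b3 B"
    and f: "f \<in> borel_measurable borel"
  shows "integral\<^sup>N a1 f + integral\<^sup>N a2 f + integral\<^sup>N a3 f =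
         integral\<^sup>N b1 f + integral\<^sup>N b2 f + integral\<^sup>N b3 f"
  using f
proof (induction rule: borel_measurable_induct)
  case (cong f g)
  then show ?case by (simp cong: nn_integral_cong)
next
  case (set A)
  then show ?case using eq[of A] sets by simp
next
  case (mult u c)
  have int: "integral\<^sup>N M (\<lambda>x. c * u x) = c * integral\<^sup>N M u"
    if "sets M = sets borel" for M
    using that mult.hyps by (intro nn_integral_cmult) (auto cong: measurable_cong_sets)
  show ?case unfolding sets[THEN int] distrib_left[symmetric] mult.IH ..
next
  case (add u v)
  have int: "integral\<^sup>N M (\<lambda>x. v x + u x) = integral\<^sup>N M v + integral\<^sup>N M u"
    if "sets M = sets borel" for M
    using that add.hyps by (intro nn_integral_add) (auto cong: measurable_cong_sets)
  have swap: "(a + b) + (c + d) + (e + f) = (a + c + e) + (b + d + f)" for a b c d e f :: ennreal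
    by (simp add: ac_simps)
  show ?case unfolding sets[THEN int] swap add.IH ..
next
  case (seq U)
  have [measurable]: "U i \<in> borel_measurable a1" "U i \<in> borel_measurable a2" "U i \<in> borel_measurable a3"
    "U i \<in> borel_measurable b1" "U i \<in> borel_measurable b2" "U i \<in> borel_measurable b3" for i
    using seq(1)[of i] sets by (auto cong: measurable_cong_sets)
  have inc: "incseq (\<lambda>i. integral\<^sup>N M (U i))" for M
    using seq(3) by (auto simp: incseq_def le_fun_def intro!: nn_integral_mono)
  have "(SUP i. U i) = (\<lambda>x. SUP i. U i x)" by (simp add: fun_eq_iff image_image)
  moreover have "integral\<^sup>N a1 (\<lambda>x. SUP i. U i x) + integral\<^sup>N a2 (\<lambda>x. SUP i. U i x) + integral\<^sup>N a3 (\<lambda>x. SUP i. U i x)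
    = (SUP i. integral\<^sup>N a1 (U i) + integral\<^sup>N a2 (U i) + integral\<^sup>N a3 (U i))"
    using seq(3) inc by (simp add: nn_integral_monotone_convergence_SUP ennreal_SUP_add
        incseq_def add_mono)
  moreover have "integral\<^sup>N b1 (\<lambda>x. SUP i. U i x) + integral\<^sup>N b2 (\<lambda>x. SUP i. U i x) + integral\<^sup>N b3 (\<lambda>x. SUP i. U i x)
    = (SUP i. integral\<^sup>N b1 (U i) + integral\<^sup>N b2 (U i) + integral\<^sup>N b3 (U i))"
    using seq(3) inc by (simp add: nn_integral_monotone_convergence_SUP ennreal_SUP_add
        incseq_def add_mono)
  ultimately show ?case using seq by simp
qed

text \<open>The positive part of a sum is not the sum of the positive parts. The identity
  \<open>\<mu>\<^sup>+ + \<mu>1\<^sup>- + \<mu>2\<^sup>- = \<mu>\<^sup>- + \<mu>1\<^sup>+ + \<mu>2\<^sup>+\<close> of measures has no such defect.\<close>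

lemma signed_integral_add:
  assumes \<mu>: "\<mu> \<in> bounded_signed_measures" and \<mu>1: "\<mu>1 \<in> bounded_signed_measures"
    and \<mu>2: "\<mu>2 \<in> bounded_signed_measures"
    and eq: "\<And>B. B \<in> sets borel \<Longrightarrow> \<mu> B = \<mu>1 B + \<mu>2 B"
    and \<eta> [measurable]: "\<eta> \<in> borel_measurable borel" and K: "\<And>x. \<bar>\<eta> x\<bar> \<le> K"
  shows "signed_integral \<mu> \<eta> = signed_integral \<mu>1 \<eta> + signed_integral \<mu>2 \<eta>"
proof -
  note fin = finite_pos_part[OF \<mu>] finite_pos_part[OF \<mu>1] finite_pos_part[OF \<mu>2]
    finite_neg_part[OF \<mu>] finite_neg_part[OF \<mu>1] finite_neg_part[OF \<mu>2]
  have em: "emeasure (pos_part \<mu>) B + emeasure (neg_part \<mu>1) B + emeasure (neg_part \<mu>2) B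
      = emeasure (neg_part \<mu>) B + emeasure (pos_part \<mu>1) B + emeasure (pos_part \<mu>2) B"
    if B: "B \<in> sets borel" for B
    using eq[OF B] jordan_decomposition[OF \<mu> B] jordan_decomposition[OF \<mu>1 B]
      jordan_decomposition[OF \<mu>2 B] fin
    by (simp add: finite_measure.emeasure_eq_measure flip: ennreal_plus)
  have int: "integrable M f"
    if "finite_measure M" "sets M = sets borel" "f \<in> borel_measurable borel" "\<And>x. \<bar>f x\<bar> \<le> C"
    for M and f :: "'a \<Rightarrow> real" and C
    using that by (intro finite_measure.integrable_const_bound[of M f C]) (auto cong: measurable_cong_sets)
  define R :: "('a \<Rightarrow> real) \<Rightarrow> real" where "R = (\<lambda>f. integral\<^sup>L (pos_part \<mu>) f + integral\<^sup>L (neg_part \<mu>1) f + integral\<^sup>L (neg_part \<mu>2) f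
      - (integral\<^sup>L (neg_part \<mu>) f + integral\<^sup>L (pos_part \<mu>1) f + integral\<^sup>L (pos_part \<mu>2) f))"
  have nonneg: "R f = 0"
    if f [measurable]: "f \<in> borel_measurable borel" and b: "\<And>x. 0 \<le> f x" "\<And>x. \<bar>f x\<bar> \<le> C" for f C
  proof -
    have i: "integral\<^sup>N M (\<lambda>x. ennreal (f x)) = ennreal (integral\<^sup>L M f)"
      if "finite_measure M" "sets M = sets borel" for M
      using int[OF that f b(2)] b(1) by (intro nn_integral_eq_integral) auto
    have "ennreal (integral\<^sup>L (pos_part \<mu>) f + integral\<^sup>L (neg_part \<mu>1) f + integral\<^sup>L (neg_part \<mu>2) f)
      = ennreal (integral\<^sup>L (neg_part \<mu>) f + integral\<^sup>L (pos_part \<mu>1) f + integral\<^sup>L (pos_part \<mu>2) f)"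
      using nn_integral_cong_measures3[of "pos_part \<mu>" "neg_part \<mu>1" "neg_part \<mu>2"
          "neg_part \<mu>" "pos_part \<mu>1" "pos_part \<mu>2" "\<lambda>x. ennreal (f x)"] em b(1) fin
      by (simp add: i)
    then show ?thesis using b(1) unfolding R_def by (subst (asm) ennreal_inj) auto
  qed
  have "R (\<lambda>x. \<eta> x + K) = R \<eta> + R (\<lambda>x. K)"
    unfolding R_def using fin
    by (simp add: int[OF _ _ \<eta> K] finite_measure.integrable_const)
  moreover have "R (\<lambda>x. \<eta> x + K) = 0"
    by (rule nonneg[of _ "2 * K"]) (use K in \<open>auto simp: abs_le_iff, (smt (verit) abs_le_iff K)+\<close>)
  moreover have "R (\<lambda>x. K) = 0"
    by (rule nonneg[of _ K]) (use K in \<open>auto intro: order_trans[OF abs_ge_zero]\<close>)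
  ultimately have "R \<eta> = 0" by simp
  then show ?thesis by (simp add: R_def signed_integral_def)
qed


section \<open>Truncation and vanishing\<close>

lemma borel_of_bcontfun:
  fixes \<eta> :: "'a::topological_space \<Rightarrow> real"
  assumes "\<eta> \<in> bcontfun"
  shows "\<eta> \<in> borel_measurable borel" "\<eta> \<in> bounded_borel" "\<exists>K. \<forall>x. \<bar>\<eta> x\<bar> \<le> K"
  using assms by (auto simp: bcontfun_def bounded_borel_def bounded_iff intro: borel_measurable_continuous_onI)

lemma truncation_bound: "0 \<le> k \<Longrightarrow> \<bar>truncation k u x\<bar> \<le> k"
  by (auto simp: truncation_def)

lemma truncation_le: "0 \<le> k \<Longrightarrow> \<bar>truncation k u x\<bar> \<le> \<bar>u x\<bar>"
  by (auto simp: truncation_def)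

lemma truncation_eq: "\<bar>u x\<bar> \<le> k \<Longrightarrow> truncation k u x = u x"
  by (auto simp: truncation_def)

lemma truncation_measurable [measurable]:
  "u \<in> borel_measurable N \<Longrightarrow> truncation k u \<in> borel_measurable N"
  unfolding truncation_def[abs_def] by measurable

text \<open>Since \<open>\<psi>\<close> lies between the truncation levels of \<open>\<phi>\<close>, the product \<open>(w - \<phi>) (\<phi> - \<psi>)\<close> is
  nonnegative, so \<open>w\<close> may be replaced by its truncation.\<close>

lemma truncation_estimate:
  fixes \<rho> w \<psi> :: "'a \<Rightarrow> real"
  assumes \<beta>: "0 < \<beta>" and \<rho>: "\<And>x. 0 \<le> \<rho> x" and \<psi>: "\<And>x. \<bar>\<psi> x\<bar> \<le> K"
  defines "\<phi> \<equiv> truncation K w"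
  defines "q \<equiv> \<lambda>x. \<beta> * (\<rho> x * (\<phi> x - \<psi> x))"
  assumes int: "integrable m (\<lambda>x. \<phi> x * q x)" "integrable m (\<lambda>x. \<psi> x * q x)" "integrable m (\<lambda>x. w x * q x)"
    and energy: "0 \<le> (\<integral>x. \<psi> x * q x \<partial>m)"
  shows "(\<integral>x. \<psi> x * q x \<partial>m) \<le> (\<integral>x. w x * q x \<partial>m)"
    and "(\<integral>\<^sup>+x. ennreal (\<rho> x * (\<phi> x - \<psi> x)\<^sup>2) \<partial>m) \<le> ennreal ((\<integral>x. w x * q x \<partial>m) / \<beta>)"
proof -
  have le: "(\<integral>x. \<phi> x * q x \<partial>m) \<le> (\<integral>x. w x * q x \<partial>m)"
  proof (rule integral_mono[OF int(1,3)])
    fix x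
    have "0 \<le> (w x - \<phi> x) * (\<phi> x - \<psi> x)"
      using \<psi>[of x] by (auto simp: \<phi>_def truncation_def min_def max_def abs_le_iff
          intro: mult_nonneg_nonneg mult_nonpos_nonpos)
    then have "0 \<le> \<beta> * (\<rho> x * ((w x - \<phi> x) * (\<phi> x - \<psi> x)))" using \<beta> \<rho>[of x] by simp
    then show "\<phi> x * q x \<le> w x * q x" by (simp add: q_def algebra_simps)
  qed
  have eq: "\<beta> * (\<rho> x * (\<phi> x - \<psi> x)\<^sup>2) = \<phi> x * q x - \<psi> x * q x" for x
    by (simp add: q_def power2_eq_square algebra_simps)
  have i: "integrable m (\<lambda>x. \<beta> * (\<rho> x * (\<phi> x - \<psi> x)\<^sup>2))" unfolding eq using int by simp
  have i': "integrable m (\<lambda>x. \<rho> x * (\<phi> x - \<psi> x)\<^sup>2)"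
    using integrable_mult_right[OF i, of "1 / \<beta>"] \<beta> by simp
  have I: "\<beta> * (\<integral>x. \<rho> x * (\<phi> x - \<psi> x)\<^sup>2 \<partial>m) = (\<integral>x. \<phi> x * q x \<partial>m) - (\<integral>x. \<psi> x * q x \<partial>m)"
  proof -
    have "\<beta> * (\<integral>x. \<rho> x * (\<phi> x - \<psi> x)\<^sup>2 \<partial>m) = (\<integral>x. \<beta> * (\<rho> x * (\<phi> x - \<psi> x)\<^sup>2) \<partial>m)" by simp
    also have "\<dots> = (\<integral>x. \<phi> x * q x \<partial>m) - (\<integral>x. \<psi> x * q x \<partial>m)" unfolding eq using int by simp
    finally show ?thesis .
  qed
  have n: "0 \<le> (\<integral>x. \<rho> x * (\<phi> x - \<psi> x)\<^sup>2 \<partial>m)" using \<rho> by simp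
  then have "0 \<le> \<beta> * (\<integral>x. \<rho> x * (\<phi> x - \<psi> x)\<^sup>2 \<partial>m)" using \<beta> by simp
  then show "(\<integral>x. \<psi> x * q x \<partial>m) \<le> (\<integral>x. w x * q x \<partial>m)" using I le by linarith
  have "\<beta> * (\<integral>x. \<rho> x * (\<phi> x - \<psi> x)\<^sup>2 \<partial>m) \<le> (\<integral>x. w x * q x \<partial>m)" using I le energy by linarith
  then have "(\<integral>x. \<rho> x * (\<phi> x - \<psi> x)\<^sup>2 \<partial>m) \<le> (\<integral>x. w x * q x \<partial>m) / \<beta>" using \<beta> by (simp add: field_simps)
  moreover have "(\<integral>\<^sup>+x. ennreal (\<rho> x * (\<phi> x - \<psi> x)\<^sup>2) \<partial>m) = ennreal (\<integral>x. \<rho> x * (\<phi> x - \<psi> x)\<^sup>2 \<partial>m)"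
    using i' \<rho> by (intro nn_integral_eq_integral) auto
  ultimately show "(\<integral>\<^sup>+x. ennreal (\<rho> x * (\<phi> x - \<psi> x)\<^sup>2) \<partial>m) \<le> ennreal ((\<integral>x. w x * q x \<partial>m) / \<beta>)"
    by (simp add: ennreal_leI)
qed

text \<open>The estimate \<open>close\<close> forces \<open>\<psi> j\<close> to converge to \<open>\<phi>\<close> along a subsequence, everywhere up to a null
  set since the sets \<open>A j\<close> exhaust the space. Since \<open>\<integral>G \<phi> \<le> 0\<close>, the right-hand sides of \<open>trans\<close>
  then tend to zero, and the \<open>L\<^sup>1(g m)\<close> norm of \<open>\<phi>\<close> is zero by Fatou's lemma.\<close>

lemma vanishing_criterion:
  fixes \<psi> :: "nat \<Rightarrow> 'a \<Rightarrow> real"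
  assumes [measurable]: "g \<in> borel_measurable m" "p \<in> borel_measurable m" "\<phi> \<in> borel_measurable m"
      "\<And>j. \<psi> j \<in> borel_measurable m" "\<And>j. A j \<in> sets m"
    and gp: "\<And>x. 0 < g x" "\<And>x. 0 < p x"
    and A: "incseq A" "(\<Union>j. A j) = space m"
    and \<psi>: "\<And>j x. \<bar>\<psi> j x\<bar> \<le> K"
    and G: "integrable m G" and sign: "\<And>x. G x * \<phi> x \<le> 0"
    and close: "\<And>j. (\<integral>\<^sup>+x. ennreal (p x * indicator (A j) x * (\<phi> x - \<psi> j x)\<^sup>2) \<partial>m)
                  \<le> ennreal ((\<integral>x. G x * \<psi> j x \<partial>m) / real (Suc j))"
    and trans: "\<And>j. (\<integral>\<^sup>+x. ennreal \<bar>\<psi> j x * g x\<bar> \<partial>m) \<le> ennreal (c * sqrt (\<integral>x. G x * \<psi> j x \<partial>m))"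
    and c: "0 < c"
  shows "AE x in m. \<phi> x = 0"
proof -
  have [measurable]: "G \<in> borel_measurable m" using G by auto
  define B where "B = (\<integral>x. K * \<bar>G x\<bar> \<partial>m)"
  have bd: "\<bar>G x * \<psi> j x\<bar> \<le> K * \<bar>G x\<bar>" for j x
    using mult_right_mono[OF \<psi>[of j x] abs_ge_zero[of "G x"]] by (simp add: abs_mult mult.commute)
  have iG: "integrable m (\<lambda>x. G x * \<psi> j x)" for j
    by (rule Bochner_Integration.integrable_bound[of m "\<lambda>x. K * \<bar>G x\<bar>"])
       (use G bd in \<open>auto intro!: AE_I2 intro: order_trans[OF _ abs_ge_self]\<close>)
  have GB: "(\<integral>x. G x * \<psi> j x \<partial>m) \<le> B" for j
    unfolding B_def using G bd by (intro integral_mono iG) (auto simp: abs_le_iff)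
  define d where "d = (\<lambda>j x. p x * indicator (A j) x * (\<phi> x - \<psi> j x)\<^sup>2)"
  have d0: "0 \<le> d j x" for j x using gp(2)[of x] by (simp add: d_def less_imp_le)
  have [measurable]: "d j \<in> borel_measurable m" for j unfolding d_def by measurable
  have dle: "(\<integral>\<^sup>+x. ennreal (d j x) \<partial>m) \<le> ennreal (B / real (Suc j))" for j
  proof -
    have "(\<integral>\<^sup>+x. ennreal (d j x) \<partial>m) \<le> ennreal ((\<integral>x. G x * \<psi> j x \<partial>m) / real (Suc j))"
      unfolding d_def by (rule close)
    also have "\<dots> \<le> ennreal (B / real (Suc j))" using GB[of j] by (intro ennreal_leI divide_right_mono) auto
    finally show ?thesis .
  qed
  have di: "integrable m (d j)" for j
    using le_less_trans[OF dle[of j] ennreal_less_top] d0 by (intro integrableI_bounded) auto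
  have dint: "(\<integral>x. norm (d j x) \<partial>m) \<le> \<bar>B\<bar> / real (Suc j)" for j
  proof -
    have "ennreal (\<integral>x. norm (d j x) \<partial>m) = (\<integral>\<^sup>+x. ennreal (d j x) \<partial>m)"
      using nn_integral_eq_integral[OF di[of j]] d0 by simp
    also have "\<dots> \<le> ennreal (\<bar>B\<bar> / real (Suc j))"
      by (rule order_trans[OF dle]) (intro ennreal_leI divide_right_mono, auto)
    finally show ?thesis by (subst (asm) ennreal_le_iff) auto
  qed
  have "(\<lambda>j. \<integral>x. norm (d j x) \<partial>m) \<longlonglongrightarrow> 0"
  proof (rule tendsto_sandwich[OF _ _ tendsto_const])
    show "(\<lambda>j. \<bar>B\<bar> / real (Suc j)) \<longlonglongrightarrow> 0"
      using tendsto_mult_right_zero[OF LIMSEQ_inverse_real_of_nat, of "\<bar>B\<bar>"] by (simp add: divide_inverse)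
  qed (use dint in auto)
  then obtain r where r: "strict_mono r" "AE x in m. (\<lambda>j. d (r j) x) \<longlonglongrightarrow> 0"
    using tendsto_L1_AE_subseq[of m d, OF di] by blast
  have conv: "AE x in m. (\<lambda>j. \<psi> (r j) x) \<longlonglongrightarrow> \<phi> x"
    using r(2) AE_space
  proof eventually_elim
    case (elim x)
    then obtain j0 where j0: "x \<in> A j0" using A(2) by blast
    have "x \<in> A (r j)" if "j \<ge> j0" for j
      using j0 that seq_suble[OF r(1), of j] A(1) by (meson incseqD le_trans subsetD)
    then have ev: "\<forall>\<^sub>F j in sequentially. d (r j) x / p x = (\<phi> x - \<psi> (r j) x)\<^sup>2"
      using gp(2)[of x] by (intro eventually_sequentiallyI[of j0]) (auto simp: d_def)
    have "(\<lambda>j. d (r j) x / p x) \<longlonglongrightarrow> 0 / p x"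
      by (intro tendsto_intros elim) (use gp(2)[of x] in auto)
    with ev have "(\<lambda>j. (\<phi> x - \<psi> (r j) x)\<^sup>2) \<longlonglongrightarrow> 0" by (simp add: tendsto_cong)
    then have "(\<lambda>j. sqrt ((\<phi> x - \<psi> (r j) x)\<^sup>2)) \<longlonglongrightarrow> sqrt 0" by (intro tendsto_real_sqrt)
    then have "(\<lambda>j. \<phi> x - \<psi> (r j) x) \<longlonglongrightarrow> 0" by (simp add: tendsto_rabs_zero_iff)
    then have "(\<lambda>j. \<phi> x - (\<phi> x - \<psi> (r j) x)) \<longlonglongrightarrow> \<phi> x - 0" by (intro tendsto_intros)
    then show ?case by simp
  qed
  have lim: "(\<lambda>j. \<integral>x. G x * \<psi> (r j) x \<partial>m) \<longlonglongrightarrow> (\<integral>x. G x * \<phi> x \<partial>m)"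
  proof (rule integral_dominated_convergence)
    show "integrable m (\<lambda>x. K * \<bar>G x\<bar>)" using G by simp
    show "AE x in m. norm (G x * \<psi> (r j) x) \<le> K * \<bar>G x\<bar>" for j using bd by auto
    show "AE x in m. (\<lambda>j. G x * \<psi> (r j) x) \<longlonglongrightarrow> G x * \<phi> x"
      using conv by eventually_elim (intro tendsto_intros)
  qed measurable
  have neg: "(\<integral>x. G x * \<phi> x \<partial>m) \<le> 0"
  proof -
    have "0 \<le> (\<integral>x. - (G x * \<phi> x) \<partial>m)" using sign by (intro integral_nonneg_AE) auto
    then show ?thesis by simp
  qed
  have "(\<integral>\<^sup>+x. ennreal \<bar>\<phi> x * g x\<bar> \<partial>m) \<le> 0"
  proof (rule ennreal_le_epsilon)
    fix e :: real assume e: "0 < e"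
    have "(\<lambda>j. c * sqrt (\<integral>x. G x * \<psi> (r j) x \<partial>m)) \<longlonglongrightarrow> c * sqrt (\<integral>x. G x * \<phi> x \<partial>m)"
      by (intro tendsto_intros lim)
    moreover have "c * sqrt (\<integral>x. G x * \<phi> x \<partial>m) < e"
    proof -
      have "sqrt (\<integral>x. G x * \<phi> x \<partial>m) \<le> 0" using neg by simp
      then have "c * sqrt (\<integral>x. G x * \<phi> x \<partial>m) \<le> 0" using c by (simp add: mult_nonneg_nonpos)
      with e show ?thesis by linarith
    qed
    ultimately have ev: "\<forall>\<^sub>F j in sequentially. c * sqrt (\<integral>x. G x * \<psi> (r j) x \<partial>m) < e"
      by (rule order_tendstoD)
    show "(\<integral>\<^sup>+x. ennreal \<bar>\<phi> x * g x\<bar> \<partial>m) \<le> 0 + ennreal e"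
      unfolding add_0
    proof (rule nn_integral_Fatou_bound)
      show "AE x in m. (\<lambda>j. \<psi> (r j) x * g x) \<longlonglongrightarrow> \<phi> x * g x"
        using conv by eventually_elim (intro tendsto_intros)
      show "\<forall>\<^sub>F j in sequentially. (\<integral>\<^sup>+x. ennreal \<bar>\<psi> (r j) x * g x\<bar> \<partial>m) \<le> ennreal e"
        using ev by eventually_elim (intro order_trans[OF trans] ennreal_leI less_imp_le)
    qed measurable
  qed
  then have "AE x in m. ennreal \<bar>\<phi> x * g x\<bar> = 0"
    by (subst (asm) le_zero_eq, subst (asm) nn_integral_0_iff_AE) auto
  then show ?thesis
  proof eventually_elim
    case (elim x)
    then show ?case using gp(1)[of x] by (auto simp: ennreal_eq_0_iff)
  qed
qed

section \<open>The equation for the difference of two solutions\<close>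

context dirichlet_space
begin

lemma ext_spaceI_D:
  assumes "u \<in> D"
  shows "approximating_seq m D \<E> (\<lambda>n. u) u" "u \<in> ext_space m D \<E>"
proof -
  show "approximating_seq m D \<E> (\<lambda>n. u) u"
    using form.const_cauchy_seq[OF assms] by (auto simp: approximating_seq_def form.cauchy_seq_def)
  then show "u \<in> ext_space m D \<E>" using D_measurable[OF assms] by (auto simp: ext_space_def)
qed

end

text \<open>Against continuous bounded test functions the measures \<open>\<mu>\<^sub>d + \<nu>\<^sub>k\<close> converge to \<open>\<mu>\<close>, for any
  choice of \<open>\<mu>\<^sub>d\<close> and \<open>\<nu>\<^sub>k\<close>; so the limiting equation does not refer to them.\<close>

lemma renormalized_limit:
  fixes m :: "'a::topological_space measure"
  assumes "dirichlet_space m D \<E>"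
    and u: "renormalized_solution m D \<E> f \<mu> u" and \<mu>: "\<mu> \<in> bounded_signed_measures"
    and \<eta>: "\<eta> \<in> ext_space m D \<E>" "\<eta> \<in> bcontfun"
  shows "((\<lambda>k. ext_form m D \<E> (truncation k u) \<eta>) \<longlongrightarrow> (\<integral>x. f x (u x) * \<eta> x \<partial>m) + signed_integral \<mu> \<eta>) at_top"
proof -
  interpret dirichlet_space m D \<E> by fact
  obtain \<mu>d \<mu>c \<nu> where dec: "diffuse_concentrated_decomposition m D \<E> \<mu> \<mu>d \<mu>c"
    and eq: "\<And>k \<eta> \<eta>'. k > 0 \<Longrightarrow> \<eta> \<in> ext_space m D \<E> \<inter> bounded_borel \<Longrightarrow> qc_version m D \<E> \<eta> \<eta>' \<Longrightarrow>
           ext_form m D \<E> (truncation k u) \<eta> =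
             (\<integral>x. f x (u x) * \<eta> x \<partial>m) + signed_integral \<mu>d \<eta>' + signed_integral (\<nu> k) \<eta>'"
    and lim: "narrow_limit \<nu> \<mu>c"
    using u unfolding renormalized_solution_def by blast
  have "capacity m D \<E> {} \<le> cap_open m D \<E> {}"
    unfolding capacity_def by (rule INF_lower) auto
  also have "\<dots> \<le> ennreal (\<E> (\<lambda>x. 0) (\<lambda>x. 0))"
    unfolding cap_open_def by (rule INF_lower) (auto simp: form.zero_mem)
  also have "\<E> (\<lambda>x. 0) (\<lambda>x. 0) = 0"
    using form.scale_left[OF form.zero_mem form.zero_mem, of 0] by simp
  finally have cap: "capacity m D \<E> {} = 0" by simp
  have "continuous_on UNIV \<eta>" using \<eta>(2) by (simp add: bcontfun_def)
  then have "quasi_continuous m D \<E> \<eta>"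
    unfolding quasi_continuous_def using cap by (intro allI impI exI[of _ UNIV]) auto
  then have qc: "qc_version m D \<E> \<eta> \<eta>"
    using borel_of_bcontfun[OF \<eta>(2)] by (simp add: qc_version_def)
  obtain K where K: "\<And>x. \<bar>\<eta> x\<bar> \<le> K" using borel_of_bcontfun(3)[OF \<eta>(2)] by blast
  have si: "signed_integral \<mu> \<eta> = signed_integral \<mu>d \<eta> + signed_integral \<mu>c \<eta>"
    by (rule signed_integral_add[OF \<mu> _ _ _ borel_of_bcontfun(1)[OF \<eta>(2)] K])
       (use dec in \<open>auto simp: diffuse_concentrated_decomposition_def bounded_smooth_measures_def\<close>)
  have "((\<lambda>k. (\<integral>x. f x (u x) * \<eta> x \<partial>m) + signed_integral \<mu>d \<eta> + signed_integral (\<nu> k) \<eta>)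
      \<longlongrightarrow> (\<integral>x. f x (u x) * \<eta> x \<partial>m) + signed_integral \<mu>d \<eta> + signed_integral \<mu>c \<eta>) at_top"
    using lim \<eta>(2) by (intro tendsto_intros) (auto simp: narrow_limit_def)
  moreover have "\<forall>\<^sub>F k in at_top. (\<integral>x. f x (u x) * \<eta> x \<partial>m) + signed_integral \<mu>d \<eta> + signed_integral (\<nu> k) \<eta>
       = ext_form m D \<E> (truncation k u) \<eta>"
    using eventually_gt_at_top[of "0::real"]
    by eventually_elim (use eq[OF _ _ qc] \<eta>(1) borel_of_bcontfun(2)[OF \<eta>(2)] in simp)
  ultimately show ?thesis unfolding si add.assoc by (rule Lim_transform_eventually)
qed

locale uniqueness_setting = transient_dirichlet_space m D \<E> g c + process_dirichlet_space m D \<E> M F X P p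
  for m :: "'a::{metric_space, second_countable_topology} measure" and D and \<E> and g and c
    and M :: "'w measure" and F and X :: "ennreal \<Rightarrow> 'w \<Rightarrow> 'a option" and P and p +
  fixes f :: "'a \<Rightarrow> real \<Rightarrow> real" and \<mu> :: "'a set \<Rightarrow> real" and u v :: "'a \<Rightarrow> real"
  assumes radon: "radon_measure m" and regular: "regular_form m D \<E>"
    and \<mu>: "\<mu> \<in> bounded_signed_measures" and mono: "\<And>x. antimono (f x)"
    and u: "renormalized_solution m D \<E> f \<mu> u" and v: "renormalized_solution m D \<E> f \<mu> v"
begin

definition G :: "'a \<Rightarrow> real" where "G x = f x (u x) - f x (v x)"

definition w :: "'a \<Rightarrow> real" where "w x = u x - v x"

lemma uv_measurable [measurable]: "u \<in> borel_measurable m" "v \<in> borel_measurable m"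
  "u \<in> borel_measurable borel" "v \<in> borel_measurable borel"
  using u v by (auto simp: renormalized_solution_def borel_measurable_m)

lemma w_measurable [measurable]: "w \<in> borel_measurable m" "w \<in> borel_measurable borel"
  unfolding w_def[abs_def] by measurable

lemma f_integrable: "integrable m (\<lambda>x. f x (u x))" "integrable m (\<lambda>x. f x (v x))"
  using u v by (auto simp: renormalized_solution_def)

lemma G_integrable: "integrable m G"
  unfolding G_def[abs_def] using f_integrable by simp

lemma G_sign: "G x * truncation K w x \<le> 0" if "0 \<le> K"
proof (cases "u x \<le> v x")
  case True
  then have "f x (v x) \<le> f x (u x)" by (rule antimonoD[OF mono])
  then show ?thesis using True that
    by (intro mult_nonneg_nonpos) (auto simp: G_def w_def truncation_def)
next
  case False
  then have "f x (u x) \<le> f x (v x)" by (intro antimonoD[OF mono]) simp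
  then show ?thesis using False that
    by (intro mult_nonpos_nonneg) (auto simp: G_def w_def truncation_def)
qed

lemma truncation_approx:
  assumes "0 < k"
  obtains us where "approximating_seq m D \<E> us (truncation k u)"
proof -
  have "\<forall>k\<ge>0. truncation k u \<in> ext_space m D \<E>"
    using u unfolding renormalized_solution_def by (elim conjE)
  then have "truncation k u \<in> ext_space m D \<E>" using assms by simp
  then show ?thesis using that by (auto simp: ext_space_def)
qed

lemma truncation_approx_v:
  assumes "0 < k"
  obtains us where "approximating_seq m D \<E> us (truncation k v)"
proof -
  have "\<forall>k\<ge>0. truncation k v \<in> ext_space m D \<E>"
    using v unfolding renormalized_solution_def by (elim conjE)
  then have "truncation k v \<in> ext_space m D \<E>" using assms by simp
  then show ?thesis using that by (auto simp: ext_space_def)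
qed

lemma bounded_test_integrable:
  fixes h \<eta> :: "'a \<Rightarrow> real"
  assumes "integrable m h" "\<eta> \<in> borel_measurable m" "\<And>x. \<bar>\<eta> x\<bar> \<le> K"
  shows "integrable m (\<lambda>x. h x * \<eta> x)"
proof (rule Bochner_Integration.integrable_bound[of m "\<lambda>x. K * \<bar>h x\<bar>"])
  show "integrable m (\<lambda>x. K * \<bar>h x\<bar>)" using assms by simp
  show "(\<lambda>x. h x * \<eta> x) \<in> borel_measurable m" using assms by auto
  have "\<bar>h x\<bar> * \<bar>\<eta> x\<bar> \<le> \<bar>K * \<bar>h x\<bar>\<bar>" for x
    using mult_right_mono[OF assms(3)[of x] abs_ge_zero[of "h x"]] by (simp add: mult.commute)
  then show "AE x in m. norm (h x * \<eta> x) \<le> norm (K * \<bar>h x\<bar>)" by (auto simp: abs_mult)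
qed

text \<open>Both solutions satisfy the limiting equation with the same \<open>\<mu>\<close>, which cancels.\<close>

lemma difference_equation:
  assumes \<eta>: "\<eta> \<in> ext_space m D \<E>" "\<eta> \<in> bcontfun"
    and lim: "(\<lambda>n. ext_form m D \<E> (truncation (real n) u) \<eta> - ext_form m D \<E> (truncation (real n) v) \<eta>) \<longlonglongrightarrow> l"
  shows "l = (\<integral>x. G x * \<eta> x \<partial>m)"
proof -
  obtain K where K: "\<And>x. \<bar>\<eta> x\<bar> \<le> K" using borel_of_bcontfun(3)[OF \<eta>(2)] by blast
  have [measurable]: "\<eta> \<in> borel_measurable m" using borel_of_bcontfun(1)[OF \<eta>(2)] by (simp add: borel_measurable_m)
  have "(\<lambda>n. ext_form m D \<E> (truncation (real n) u) \<eta> - ext_form m D \<E> (truncation (real n) v) \<eta>)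
    \<longlonglongrightarrow> ((\<integral>x. f x (u x) * \<eta> x \<partial>m) + signed_integral \<mu> \<eta>) - ((\<integral>x. f x (v x) * \<eta> x \<partial>m) + signed_integral \<mu> \<eta>)"
    by (intro tendsto_diff filterlim_compose[OF renormalized_limit[OF dirichlet_space_axioms u \<mu> \<eta>] filterlim_real_sequentially]
        filterlim_compose[OF renormalized_limit[OF dirichlet_space_axioms v \<mu> \<eta>] filterlim_real_sequentially])
  from LIMSEQ_unique[OF lim this]
  have "l = (\<integral>x. f x (u x) * \<eta> x \<partial>m) - (\<integral>x. f x (v x) * \<eta> x \<partial>m)" by simp
  also have "\<dots> = (\<integral>x. f x (u x) * \<eta> x - f x (v x) * \<eta> x \<partial>m)"
    using bounded_test_integrable[OF f_integrable(1) _ K] bounded_test_integrable[OF f_integrable(2) _ K]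
    by simp
  also have "\<dots> = (\<integral>x. G x * \<eta> x \<partial>m)" by (simp add: G_def left_diff_distrib)
  finally show ?thesis .
qed

lemma cont_compact_support_facts:
  assumes h: "h \<in> cont_compact_support"
  shows "h \<in> bcontfun" "integrable m h"
proof -
  obtain K where K: "\<And>x. \<bar>h x\<bar> \<le> K" using cont_compact_support_bounded[OF h] by blast
  have cont: "continuous_on UNIV h" and cpt: "compact (closure {x. h x \<noteq> 0})"
    using h by (auto simp: cont_compact_support_def)
  show "h \<in> bcontfun" using cont K by (auto simp: bcontfun_def bounded_iff)
  have [measurable]: "h \<in> borel_measurable m"
    using cont by (simp add: borel_measurable_m borel_measurable_continuous_onI)
  have "closure {x. h x \<noteq> 0} \<in> sets m" by (simp add: sets_m)
  moreover have "emeasure m (closure {x. h x \<noteq> 0}) < \<infinity>" using radon cpt by (simp add: radon_measure_def)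
  ultimately have "integrable m (\<lambda>x. K * indicator (closure {x. h x \<noteq> 0}) x)" by simp
  then show "integrable m h"
  proof (rule Bochner_Integration.integrable_bound)
    have "\<bar>h x\<bar> \<le> \<bar>K * indicator (closure {x. h x \<noteq> 0}) x\<bar>" for x
      using K[of x] closure_subset[of "{x. h x \<noteq> 0}"] by (cases "h x = 0") (auto simp: indicator_def)
    then show "AE x in m. norm (h x) \<le> norm (K * indicator (closure {x. h x \<noteq> 0}) x)" by auto
  qed simp
qed

lemma resolvent_AE_cong:
  assumes "is_resolvent \<alpha> h \<psi>" "\<eta> \<in> borel_measurable m" "AE x in m. \<eta> x = \<psi> x"
  shows "is_resolvent \<alpha> h \<eta>"
proof -
  have \<psi>D: "\<psi> \<in> D" using assms(1) by (simp add: is_resolvent_def)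
  note [measurable] = D_measurable[OF \<psi>D] assms(2)
  have ae: "AE x in m. \<psi> x = \<eta> x" using assms(3) by auto
  note c = D_AE_cong[OF \<psi>D assms(2) ae]
  have "l2_inner m \<psi> k = l2_inner m \<eta> k" if [measurable]: "k \<in> borel_measurable m" for k
    unfolding l2_inner_def by (rule integral_cong_AE) (use ae in auto)
  then show ?thesis using assms(1) c D_measurable unfolding is_resolvent_def by metis
qed

text \<open>\<open>D\<close> is dense in \<open>L\<^sup>2\<close>, compactly supported functions are dense in \<open>D\<close> by regularity, and truncating
  an approximation of \<open>h\<close> at the bound of \<open>h\<close> improves it.\<close>

lemma compact_support_dense:
  assumes h: "h \<in> L2 m" "\<And>x. \<bar>h x\<bar> \<le> K" and K: "0 < K" and e: "0 < e"
  obtains k where "k \<in> cont_compact_support" "\<And>x. \<bar>k x\<bar> \<le> K" "k \<in> L2 m"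
    "l2.dist_sq m h k < e"
proof -
  have "sqrt (e / 4) > 0" using e by simp
  then obtain y where y: "y \<in> D" "l2_norm m (\<lambda>x. h x - y x) < sqrt (e / 4)"
    using symmetric h(1) unfolding symmetric_form_def by blast
  have "e / 4 > 0" using e by simp
  then obtain z where z: "z \<in> D" "z \<in> cont_compact_support" "energy1 m \<E> (\<lambda>x. y x - z x) < e / 4"
    using regular y(1) unfolding regular_form_def by blast
  define k where "k = truncation K z"
  have yL: "y \<in> L2 m" and zL: "z \<in> L2 m" using y z by (auto intro: D_L2)
  note [measurable] = L2_measurable[OF h(1)] L2_measurable[OF zL]
  have kL: "k \<in> L2 m" by (rule L2_dominated[OF zL]) (use K in \<open>auto simp: k_def truncation_le\<close>)
  have 1: "l2.dist_sq m h y < e / 4"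
    using y(2) by (simp add: l2_norm_def)
  have 2: "l2.dist_sq m y z < e / 4"
    using z(3) form.nonneg[OF form.diff_mem[OF y(1) z(1)]] by (simp add: energy1_def)
  have hz: "(\<lambda>x. h x - z x) \<in> L2 m" and hk: "(\<lambda>x. h x - k x) \<in> L2 m"
    by (intro l2.diff_mem h zL kL)+
  have "l2.dist_sq m h k \<le> l2.dist_sq m h z"
    unfolding l2_inner_def
  proof (intro integral_mono L2_mult_integrable hz hk)
    fix x
    have "\<bar>h x - k x\<bar> \<le> \<bar>h x - z x\<bar>"
      using h(2)[of x] by (auto simp: k_def truncation_def min_def max_def)
    then show "(h x - k x) * (h x - k x) \<le> (h x - z x) * (h x - z x)"
      by (simp add: abs_le_square_iff flip: power2_eq_square)
  qed
  also have "l2.dist_sq m h z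
      = l2_inner m (\<lambda>x. (h x - y x) + (y x - z x)) (\<lambda>x. (h x - y x) + (y x - z x))" by simp
  also have "\<dots> \<le> 2 * l2.dist_sq m h y + 2 * l2.dist_sq m y z"
    by (intro l2.quad_add_le l2.diff_mem h yL zL)
  also have "\<dots> < e" using 1 2 by linarith
  finally have close: "l2.dist_sq m h k < e" .
  have "k \<in> cont_compact_support"
  proof (rule cont_compact_supportI)
    show "compact (closure {x. z x \<noteq> 0})" using z(2) by (simp add: cont_compact_support_def)
    have "continuous_on UNIV z" using z(2) by (simp add: cont_compact_support_def)
    then show "continuous_on UNIV k" unfolding k_def truncation_def[abs_def] by (intro continuous_intros)
    show "k x = 0" if "x \<notin> closure {x. z x \<noteq> 0}" for x
    proof -
      have "z x = 0" using that closure_subset[of "{x. z x \<noteq> 0}"] by blast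
      then show ?thesis using K by (simp add: k_def truncation_def)
    qed
  qed
  then show ?thesis by (rule that) (use K kL close in \<open>auto simp: k_def truncation_bound\<close>)
qed

text \<open>The equation of \<open>w\<close> tested with resolvents of continuous functions extends to resolvents of
  bounded functions by density, since \<open>w\<close> and \<open>G\<close> are integrable.\<close>

lemma difference_equation_integrable:
  assumes \<alpha>: "\<alpha> > 0" and feller: "resolvent X P \<alpha> ` bcontfun \<subseteq> bcontfun"
    and ui: "integrable m u" and vi: "integrable m v"
    and h: "h \<in> L2 m" "\<And>x. \<bar>h x\<bar> \<le> K" and K: "0 < K" and r: "is_resolvent \<alpha> h \<psi>"
  shows "(\<integral>x. w x * (h x - \<alpha> * \<psi> x) \<partial>m) = (\<integral>x. G x * \<psi> x \<partial>m)"
proof -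
  have wi: "integrable m w" unfolding w_def[abs_def] using ui vi by simp
  have cont: "(\<integral>x. w x * (k x - \<alpha> * \<eta> x) \<partial>m) = (\<integral>x. G x * \<eta> x \<partial>m)"
    and res: "is_resolvent \<alpha> k \<eta>" and \<eta>b: "\<And>x. \<bar>\<eta> x\<bar> \<le> K / \<alpha>"
    if k: "k \<in> cont_compact_support" "\<And>x. \<bar>k x\<bar> \<le> K" "\<eta> = resolvent X P \<alpha> k" for k \<eta>
  proof -
    note kf = cont_compact_support_facts[OF k(1)]
    have kB: "k \<in> borel_measurable borel" using borel_of_bcontfun(1)[OF kf(1)] .
    have \<eta>c: "\<eta> \<in> bcontfun" using feller kf(1) k(3) by auto
    have [measurable]: "\<eta> \<in> borel_measurable m" "k \<in> borel_measurable m"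
      using borel_of_bcontfun(1)[OF \<eta>c] kB by (auto simp: borel_measurable_m)
    have kL: "k \<in> L2 m" by (rule L2_bounded_integrable[OF kf(2) k(2)])
    obtain \<psi>' where \<psi>': "is_resolvent \<alpha> k \<psi>'" using resolvent_exists[OF \<alpha> kL k(2)] by blast
    show res: "is_resolvent \<alpha> k \<eta>"
    proof (rule resolvent_AE_cong[OF \<psi>'])
      show "AE x in m. \<eta> x = \<psi>' x" unfolding k(3) by (rule process_resolvent_AE[OF \<alpha> kL kB k(2) \<psi>'])
    qed measurable
    show \<eta>b: "\<bar>\<eta> x\<bar> \<le> K / \<alpha>" for x unfolding k(3) by (rule process_resolvent_bound[OF \<alpha> kB k(2)])
    have \<eta>D: "\<eta> \<in> D" using res by (simp add: is_resolvent_def)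
    define q where "q = (\<lambda>x. k x - \<alpha> * \<eta> x)"
    have qb: "\<bar>q x\<bar> \<le> 2 * K" for x
    proof -
      have "\<bar>\<alpha> * \<eta> x\<bar> \<le> K" using \<eta>b[of x] \<alpha> by (simp add: abs_mult field_simps)
      then show ?thesis using k(2)[of x] unfolding q_def by linarith
    qed
    have [measurable]: "q \<in> borel_measurable m" unfolding q_def by measurable
    have formula: "ext_form m D \<E> (truncation n y) \<eta> = (\<integral>x. truncation n y x * q x \<partial>m)"
      if n: "0 < n" and us: "approximating_seq m D \<E> us (truncation n y)"
        and [measurable]: "y \<in> borel_measurable m" for n y us
    proof (rule LIMSEQ_unique)
      show "(\<lambda>i. \<E> (us i) \<eta>) \<longlonglongrightarrow> ext_form m D \<E> (truncation n y) \<eta>"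
        using ext_form_limit[OF us ext_spaceI_D(1)[OF \<eta>D]] .
      show "(\<lambda>i. \<E> (us i) \<eta>) \<longlonglongrightarrow> (\<integral>x. truncation n y x * q x \<partial>m)"
        unfolding q_def
        by (rule bounded_limit_resolvent[OF _ _ _ truncation_bound n \<alpha> kf(2) k(2) res])
           (use us n in \<open>auto simp: approximating_seq_iff\<close>)
    qed
    have lim: "(\<lambda>n. \<integral>x. truncation (real n) y x * q x \<partial>m) \<longlonglongrightarrow> (\<integral>x. y x * q x \<partial>m)"
      if y: "integrable m y" for y
    proof (rule integral_dominated_convergence)
      have [measurable]: "y \<in> borel_measurable m" using y by auto
      show "(\<lambda>x. y x * q x) \<in> borel_measurable m" "(\<lambda>x. truncation (real n) y x * q x) \<in> borel_measurable m" for n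
        by measurable
      show "integrable m (\<lambda>x. \<bar>y x\<bar> * (2 * K))" using y by simp
      show "AE x in m. norm (truncation (real n) y x * q x) \<le> \<bar>y x\<bar> * (2 * K)" for n
        using qb by (auto simp: abs_mult truncation_le intro!: AE_I2 mult_mono)
      show "AE x in m. (\<lambda>n. truncation (real n) y x * q x) \<longlonglongrightarrow> y x * q x"
      proof (rule AE_I2)
        fix x
        obtain N where N: "\<bar>y x\<bar> \<le> real N" using real_arch_simple by blast
        then have "truncation (real n) y x * q x = y x * q x" if "n \<ge> N" for n
          using that by (subst truncation_eq) auto
        then have "\<forall>\<^sub>F n in sequentially. truncation (real n) y x * q x = y x * q x"
          by (rule eventually_sequentiallyI)
        then show "(\<lambda>n. truncation (real n) y x * q x) \<longlonglongrightarrow> y x * q x" by (rule tendsto_eventually)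
      qed
    qed
    have ext: "\<forall>\<^sub>F n in sequentially. (\<integral>x. truncation (real n) u x * q x \<partial>m) - (\<integral>x. truncation (real n) v x * q x \<partial>m)
        = ext_form m D \<E> (truncation (real n) u) \<eta> - ext_form m D \<E> (truncation (real n) v) \<eta>"
    proof (rule eventually_sequentiallyI[of 1])
      fix n :: nat assume "1 \<le> n"
      then have n: "0 < real n" by simp
      obtain us where us: "approximating_seq m D \<E> us (truncation (real n) u)" using truncation_approx[OF n] .
      obtain vs where vs: "approximating_seq m D \<E> vs (truncation (real n) v)" using truncation_approx_v[OF n] .
      show "(\<integral>x. truncation (real n) u x * q x \<partial>m) - (\<integral>x. truncation (real n) v x * q x \<partial>m)
        = ext_form m D \<E> (truncation (real n) u) \<eta> - ext_form m D \<E> (truncation (real n) v) \<eta>"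
        using formula[OF n us] formula[OF n vs] by simp
    qed
    have "(\<integral>x. u x * q x \<partial>m) - (\<integral>x. v x * q x \<partial>m) = (\<integral>x. G x * \<eta> x \<partial>m)"
    proof (rule difference_equation[OF ext_spaceI_D(2)[OF \<eta>D] \<eta>c])
      show "(\<lambda>n. ext_form m D \<E> (truncation (real n) u) \<eta> - ext_form m D \<E> (truncation (real n) v) \<eta>)
         \<longlonglongrightarrow> (\<integral>x. u x * q x \<partial>m) - (\<integral>x. v x * q x \<partial>m)"
        using tendsto_diff[OF lim[OF ui] lim[OF vi]] ext by (rule Lim_transform_eventually)
    qed
    moreover have "(\<integral>x. w x * q x \<partial>m) = (\<integral>x. u x * q x \<partial>m) - (\<integral>x. v x * q x \<partial>m)"
      using bounded_test_integrable[OF ui _ qb] bounded_test_integrable[OF vi _ qb]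
      by (simp add: w_def left_diff_distrib)
    ultimately show "(\<integral>x. w x * (k x - \<alpha> * \<eta> x) \<partial>m) = (\<integral>x. G x * \<eta> x \<partial>m)" by (simp add: q_def)
  qed
  have "\<exists>k. k \<in> cont_compact_support \<and> (\<forall>x. \<bar>k x\<bar> \<le> K) \<and> k \<in> L2 m \<and>
      l2.dist_sq m h k < 1 / real (Suc n)" for n
    using compact_support_dense[OF h K, of "1 / real (Suc n)"] by (metis of_nat_0_less_iff zero_less_Suc zero_less_divide_1_iff)
  then obtain k where k: "\<And>n. k n \<in> cont_compact_support" "\<And>n x. \<bar>k n x\<bar> \<le> K" "\<And>n. k n \<in> L2 m"
      "\<And>n. l2.dist_sq m h (k n) < 1 / real (Suc n)" by metis
  define \<eta> where "\<eta> = (\<lambda>n. resolvent X P \<alpha> (k n))"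
  have \<eta>: "is_resolvent \<alpha> (k n) (\<eta> n)" "\<And>x. \<bar>\<eta> n x\<bar> \<le> K / \<alpha>"
     "(\<integral>x. w x * (k n x - \<alpha> * \<eta> n x) \<partial>m) = (\<integral>x. G x * \<eta> n x \<partial>m)" for n
    using cont[OF k(1) k(2), of "\<eta> n" n] res[OF k(1) k(2), of "\<eta> n" n] \<eta>b[OF k(1) k(2), of "\<eta> n" n]
    by (auto simp: \<eta>_def)
  have \<eta>D: "\<eta> n \<in> D" and \<psi>D: "\<psi> \<in> D" for n using \<eta> r by (auto simp: is_resolvent_def)
  have lim0: "(\<lambda>n. l2.dist_sq m h (k n)) \<longlonglongrightarrow> 0"
  proof (rule Lim_null_comparison)
    show "(\<lambda>n. 1 / real (Suc n)) \<longlonglongrightarrow> 0" using LIMSEQ_inverse_real_of_nat by (simp add: inverse_eq_divide)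
    show "\<forall>\<^sub>F n in sequentially. norm (l2.dist_sq m h (k n)) \<le> 1 / real (Suc n)"
      using k(4) l2.nonneg[OF l2.diff_mem[OF h(1) k(3)]] by (auto intro!: always_eventually less_imp_le)
  qed
  have lim1: "(\<lambda>n. l2.dist_sq m \<psi> (\<eta> n)) \<longlonglongrightarrow> 0"
  proof (rule Lim_null_comparison)
    show "(\<lambda>n. l2.dist_sq m h (k n) / \<alpha>\<^sup>2) \<longlonglongrightarrow> 0"
      using tendsto_divide[OF lim0 tendsto_const[of "\<alpha>\<^sup>2"]] \<alpha> by simp
    have "l2.dist_sq m \<psi> (\<eta> n) \<le> l2.dist_sq m h (k n) / \<alpha>\<^sup>2" for n
    proof -
      let ?a = "l2.dist_sq m \<psi> (\<eta> n)"
      let ?b = "l2.dist_sq m h (k n)"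
      have hk: "(\<lambda>x. h x - k n x) \<in> L2 m" by (intro l2.diff_mem h k)
      have a: "0 \<le> ?a" by (intro l2.nonneg D_L2 form.diff_mem \<eta>D \<psi>D)
      have b: "0 \<le> ?b" by (intro l2.nonneg hk)
      have "\<alpha> * sqrt ?a \<le> sqrt ?b"
        by (rule resolvent_norm_le(1)[OF \<alpha> hk resolvent_diff[OF h(1) k(3) r \<eta>(1)]])
      then have "(\<alpha> * sqrt ?a)\<^sup>2 \<le> (sqrt ?b)\<^sup>2" using \<alpha> a by (intro power_mono) auto
      then have "\<alpha>\<^sup>2 * ?a \<le> ?b" using a b by (simp add: power_mult_distrib)
      then show ?thesis using \<alpha> by (simp add: field_simps)
    qed
    then show "\<forall>\<^sub>F n in sequentially. norm (l2.dist_sq m \<psi> (\<eta> n))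
       \<le> l2.dist_sq m h (k n) / \<alpha>\<^sup>2"
      using l2.nonneg[OF D_L2[OF form.diff_mem[OF \<psi>D \<eta>D]]] by (auto intro!: always_eventually)
  qed
  obtain r1 where r1: "strict_mono r1" "AE x in m. (\<lambda>n. h x - k (r1 n) x) \<longlonglongrightarrow> 0"
    using l2_tendsto_zero_AE_subseq[OF l2.diff_mem[OF h(1) k(3)] lim0] by blast
  have "(\<lambda>n. l2.dist_sq m \<psi> (\<eta> (r1 n))) \<longlonglongrightarrow> 0"
    using LIMSEQ_subseq_LIMSEQ[OF lim1 r1(1)] by (simp add: comp_def)
  then obtain r2 where r2: "strict_mono r2" "AE x in m. (\<lambda>n. \<psi> x - \<eta> (r1 (r2 n)) x) \<longlonglongrightarrow> 0"
    using l2_tendsto_zero_AE_subseq[OF D_L2[OF form.diff_mem[OF \<psi>D \<eta>D]]] by blast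
  define s where "s = r1 \<circ> r2"
  have ae: "AE x in m. (\<lambda>n. k (s n) x) \<longlonglongrightarrow> h x \<and> (\<lambda>n. \<eta> (s n) x) \<longlonglongrightarrow> \<psi> x"
    using r1(2) r2(2)
  proof eventually_elim
    case (elim x)
    have "(\<lambda>n. h x - k (s n) x) \<longlonglongrightarrow> 0"
      using LIMSEQ_subseq_LIMSEQ[OF elim(1) r2(1)] by (simp add: comp_def s_def)
    from tendsto_diff[OF tendsto_const[of "h x"] this]
      tendsto_diff[OF tendsto_const[of "\<psi> x"] elim(2)]
    show ?case by (simp add: s_def)
  qed
  note [measurable] = L2_measurable[OF h(1)] L2_measurable[OF k(3)] D_measurable[OF \<eta>D] D_measurable[OF \<psi>D]
  have [measurable]: "G \<in> borel_measurable m" using G_integrable by auto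
  have bq: "\<bar>k n x - \<alpha> * \<eta> n x\<bar> \<le> 2 * K" for n x
  proof -
    have "\<bar>\<alpha> * \<eta> n x\<bar> \<le> K" using \<eta>(2)[of n x] \<alpha> by (simp add: abs_mult field_simps)
    then show ?thesis using k(2)[of n x] by linarith
  qed
  have "(\<lambda>n. \<integral>x. w x * (k (s n) x - \<alpha> * \<eta> (s n) x) \<partial>m) \<longlonglongrightarrow> (\<integral>x. w x * (h x - \<alpha> * \<psi> x) \<partial>m)"
  proof (rule integral_dominated_convergence)
    show "integrable m (\<lambda>x. \<bar>w x\<bar> * (2 * K))" using wi by simp
    show "AE x in m. norm (w x * (k (s n) x - \<alpha> * \<eta> (s n) x)) \<le> \<bar>w x\<bar> * (2 * K)" for n
      using bq by (auto simp: abs_mult intro!: AE_I2 mult_left_mono)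
    show "AE x in m. (\<lambda>n. w x * (k (s n) x - \<alpha> * \<eta> (s n) x)) \<longlonglongrightarrow> w x * (h x - \<alpha> * \<psi> x)"
      using ae by eventually_elim (auto intro!: tendsto_intros)
  qed measurable
  moreover have "(\<lambda>n. \<integral>x. G x * \<eta> (s n) x \<partial>m) \<longlonglongrightarrow> (\<integral>x. G x * \<psi> x \<partial>m)"
  proof (rule integral_dominated_convergence)
    show "integrable m (\<lambda>x. \<bar>G x\<bar> * (K / \<alpha>))" using G_integrable by simp
    show "AE x in m. norm (G x * \<eta> (s n) x) \<le> \<bar>G x\<bar> * (K / \<alpha>)" for n
      using \<eta>(2) by (auto simp: abs_mult simp del: times_divide_eq_right intro!: AE_I2 mult_left_mono)
    show "AE x in m. (\<lambda>n. G x * \<eta> (s n) x) \<longlonglongrightarrow> G x * \<psi> x"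
      using ae by eventually_elim (auto intro!: tendsto_intros)
  qed measurable
  ultimately show ?thesis unfolding \<eta>(3) by (rule LIMSEQ_unique)
qed

section \<open>Uniqueness of integrable solutions\<close>

lemma w_zero_of_truncation:
  assumes "AE x in m. truncation 1 w x = 0"
  shows "AE x in m. u x = v x"
  using assms by eventually_elim (auto simp: truncation_def w_def min_def max_def split: if_splits)

text \<open>The functions \<open>\<psi> j\<close> are \<open>\<beta> R\<^sub>\<beta> \<phi>\<close> for \<open>\<beta> = j + 1\<close> and the truncation \<open>\<phi>\<close> of \<open>w\<close>. Their energy densities
  \<open>\<beta> (\<phi> - \<psi> j)\<close> are admissible in the equation of \<open>w\<close> for every \<open>\<beta>\<close>, although the resolvent of the
  process is assumed to preserve continuity for one \<open>\<alpha>\<close> only.\<close>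

lemma uniqueness_integrable:
  assumes \<alpha>: "\<alpha> > 0" and feller: "resolvent X P \<alpha> ` bcontfun \<subseteq> bcontfun"
    and ui: "integrable m u" and vi: "integrable m v"
  shows "AE x in m. u x = v x"
proof (rule w_zero_of_truncation)
  define \<phi> where "\<phi> = truncation 1 w"
  have wi: "integrable m w" unfolding w_def[abs_def] using ui vi by simp
  have \<phi>b: "\<bar>\<phi> x\<bar> \<le> 1" for x by (simp add: \<phi>_def truncation_bound)
  have [measurable]: "\<phi> \<in> borel_measurable m" unfolding \<phi>_def by measurable
  have \<phi>i: "integrable m \<phi>"
    by (rule Bochner_Integration.integrable_bound[OF wi]) (auto simp: \<phi>_def truncation_le)
  have \<phi>L: "\<phi> \<in> L2 m" by (rule L2_bounded_integrable[OF \<phi>i \<phi>b])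
  have "\<exists>\<psi>. is_resolvent (real (Suc j)) (\<lambda>x. real (Suc j) * \<phi> x) \<psi> \<and> (\<forall>x. \<bar>\<psi> x\<bar> \<le> 1)" for j
  proof -
    have "(\<lambda>x. real (Suc j) * \<phi> x) \<in> L2 m" by (rule l2.scale_mem[OF \<phi>L])
    moreover have "\<bar>real (Suc j) * \<phi> x\<bar> \<le> real (Suc j)" for x
      using mult_left_mono[OF \<phi>b[of x], of "real (Suc j)"] by (simp add: abs_mult)
    ultimately obtain \<psi> where "is_resolvent (real (Suc j)) (\<lambda>x. real (Suc j) * \<phi> x) \<psi>"
        "\<And>x. \<bar>\<psi> x\<bar> \<le> real (Suc j) / real (Suc j)"
      using resolvent_exists[of "real (Suc j)"] by (metis of_nat_0_less_iff zero_less_Suc)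
    then show ?thesis by (intro exI[of _ \<psi>]) simp
  qed
  then obtain \<psi> where \<psi>: "\<And>j. is_resolvent (real (Suc j)) (\<lambda>x. real (Suc j) * \<phi> x) (\<psi> j)"
    "\<And>j x. \<bar>\<psi> j x\<bar> \<le> 1" by metis
  have \<psi>D: "\<psi> j \<in> D" for j using \<psi>(1)[of j] by (simp add: is_resolvent_def)
  have \<psi>L: "\<psi> j \<in> L2 m" for j using \<psi>D by (rule D_L2)
  note [measurable] = D_measurable[OF \<psi>D]
  define q where "q = (\<lambda>j x. real (Suc j) * (1 * (\<phi> x - \<psi> j x)))"
  have qL: "q j \<in> L2 m" for j unfolding q_def mult_1 by (intro l2.scale_mem l2.diff_mem \<phi>L \<psi>L)
  have qb: "\<bar>q j x\<bar> \<le> 2 * real (Suc j)" for j x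
  proof -
    have "\<bar>\<phi> x - \<psi> j x\<bar> \<le> 2" using \<phi>b[of x] \<psi>(2)[of j x] by linarith
    from mult_left_mono[OF this, of "real (Suc j)"] show ?thesis by (simp add: q_def abs_mult)
  qed
  have E: "\<E> (\<psi> j) y = l2_inner m (q j) y" if "y \<in> D" for j y
  proof -
    have "\<E> (\<psi> j) y + real (Suc j) * l2_inner m (\<psi> j) y = l2_inner m (\<lambda>x. real (Suc j) * \<phi> x) y"
      using \<psi>(1)[of j] that unfolding is_resolvent_def by blast
    moreover have "l2_inner m (q j) y = l2_inner m (\<lambda>x. real (Suc j) * \<phi> x + (- real (Suc j)) * \<psi> j x) y"
      by (simp add: q_def algebra_simps)
    moreover have "\<dots> = real (Suc j) * l2_inner m \<phi> y + (- real (Suc j)) * l2_inner m (\<psi> j) y"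
      by (rule l2.comb_left[OF \<phi>L \<psi>L D_L2[OF that]])
    moreover have "l2_inner m (\<lambda>x. real (Suc j) * \<phi> x) y = real (Suc j) * l2_inner m \<phi> y"
      by (rule l2.scale_left[OF \<phi>L D_L2[OF that]])
    ultimately show ?thesis by (simp add: algebra_simps)
  qed
  have wq: "(\<integral>x. w x * q j x \<partial>m) = (\<integral>x. G x * \<psi> j x \<partial>m)" for j
  proof -
    define h where "h = (\<lambda>x. q j x + \<alpha> * \<psi> j x)"
    have hL: "h \<in> L2 m" unfolding h_def by (intro l2.add_mem l2.scale_mem qL \<psi>L)
    have hb: "\<bar>h x\<bar> \<le> 2 * real (Suc j) + \<alpha>" for x
    proof -
      have "\<bar>\<alpha> * \<psi> j x\<bar> \<le> \<alpha>" using mult_left_mono[OF \<psi>(2)[of j x], of \<alpha>] \<alpha> by (simp add: abs_mult)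
      then show ?thesis using qb[of j x] unfolding h_def by linarith
    qed
    \<comment> \<open>the resolvent equation, which exchanges the parameter \<open>j + 1\<close> for \<open>\<alpha>\<close>\<close>
    have "is_resolvent \<alpha> h (\<psi> j)"
      unfolding is_resolvent_def
    proof (intro conjI ballI \<psi>D)
      fix y assume y: "y \<in> D"
      have "l2_inner m h y = l2_inner m (\<lambda>x. 1 * q j x + \<alpha> * \<psi> j x) y" by (simp add: h_def)
      also have "\<dots> = 1 * l2_inner m (q j) y + \<alpha> * l2_inner m (\<psi> j) y"
        by (rule l2.comb_left[OF qL \<psi>L D_L2[OF y]])
      finally show "\<E> (\<psi> j) y + \<alpha> * l2_inner m (\<psi> j) y = l2_inner m h y" using E[OF y] by simp
    qed
    from difference_equation_integrable[OF \<alpha> feller ui vi hL hb _ this]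
    show ?thesis using \<alpha> by (simp add: h_def)
  qed
  have en: "(\<integral>x. \<psi> j x * q j x \<partial>m) = \<E> (\<psi> j) (\<psi> j)" for j
    using E[OF \<psi>D, of j j] by (simp add: l2_inner_def mult.commute)
  have int: "integrable m (\<lambda>x. truncation 1 w x * q j x)" "integrable m (\<lambda>x. \<psi> j x * q j x)" "integrable m (\<lambda>x. w x * q j x)" for j
    using L2_mult_integrable[OF \<phi>L qL] L2_mult_integrable[OF \<psi>L qL]
      bounded_test_integrable[OF wi L2_measurable[OF qL] qb]
    by (auto simp: \<phi>_def)
  note est = truncation_estimate[where \<rho> = "\<lambda>x. 1" and K = 1 and w = w and m = m, folded \<phi>_def]
  have pos: "0 \<le> (\<integral>x. \<psi> j x * q j x \<partial>m)" for j unfolding en by (intro form.nonneg \<psi>D)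
  show "AE x in m. truncation 1 w x = 0"
    unfolding \<phi>_def[symmetric]
  proof (rule vanishing_criterion[where g = g and p = "\<lambda>x. 1" and A = "\<lambda>j. space m" and \<psi> = \<psi> and K = 1 and G = G and c = c])
    show "G x * \<phi> x \<le> 0" for x unfolding \<phi>_def by (rule G_sign) simp
    fix j
    have e1: "(\<integral>x. \<psi> j x * q j x \<partial>m) \<le> (\<integral>x. w x * q j x \<partial>m)"
      and e2: "(\<integral>\<^sup>+x. ennreal (1 * (\<phi> x - \<psi> j x)\<^sup>2) \<partial>m) \<le> ennreal ((\<integral>x. w x * q j x \<partial>m) / real (Suc j))"
      using est[of "real (Suc j)" "\<psi> j"] \<psi>(2) int[of j] pos[of j] unfolding q_def \<phi>_def by auto
    have "(\<integral>\<^sup>+x. ennreal (1 * indicator (space m) x * (\<phi> x - \<psi> j x)\<^sup>2) \<partial>m) = (\<integral>\<^sup>+x. ennreal (1 * (\<phi> x - \<psi> j x)\<^sup>2) \<partial>m)"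
      by (intro nn_integral_cong) simp
    then show "(\<integral>\<^sup>+x. ennreal (1 * indicator (space m) x * (\<phi> x - \<psi> j x)\<^sup>2) \<partial>m) \<le> ennreal ((\<integral>x. G x * \<psi> j x \<partial>m) / real (Suc j))"
      using e2 wq[of j] by simp
    have "(\<integral>\<^sup>+x. ennreal \<bar>\<psi> j x * g x\<bar> \<partial>m) \<le> ennreal (c * sqrt (\<E> (\<psi> j) (\<psi> j)))" by (rule transient[OF \<psi>D])
    also have "\<dots> \<le> ennreal (c * sqrt (\<integral>x. G x * \<psi> j x \<partial>m))"
      using e1 c_pos unfolding en wq by (intro ennreal_leI mult_left_mono real_sqrt_le_mono) auto
    finally show "(\<integral>\<^sup>+x. ennreal \<bar>\<psi> j x * g x\<bar> \<partial>m) \<le> ennreal (c * sqrt (\<integral>x. G x * \<psi> j x \<partial>m))" .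
  qed (auto simp: g_pos \<psi>(2) G_integrable c_pos)
qed

section \<open>Uniqueness under the strong Feller property\<close>

text \<open>A bounded potential \<open>\<psi>\<close> of a bounded density \<open>q\<close> satisfies \<open>\<psi> = R\<^sub>\<alpha>(q + \<alpha> \<psi>)\<close> almost
  everywhere, by duality with resolvents of integrable functions.\<close>

lemma potential_eq_process_resolvent:
  assumes \<alpha>: "\<alpha> > 0" and vs: "potential_seq vs q \<psi>" and \<psi>: "\<And>x. \<bar>\<psi> x\<bar> \<le> K" and K: "0 < K"
    and qb: "\<And>x. \<bar>q x\<bar> \<le> L"
    and [measurable]: "resolvent X P \<alpha> (\<lambda>x. q x + \<alpha> * \<psi> x) \<in> borel_measurable m"
  shows "AE x in m. resolvent X P \<alpha> (\<lambda>x. q x + \<alpha> * \<psi> x) x = \<psi> x"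
proof -
  define b where "b = (\<lambda>x. q x + \<alpha> * \<psi> x)"
  define \<eta> where "\<eta> = resolvent X P \<alpha> b"
  define B where "B = L + \<alpha> * K"
  have L0: "0 \<le> L" using qb order_trans[OF abs_ge_zero] by blast
  have B0: "0 < B" using \<alpha> K L0 by (simp add: B_def add_nonneg_pos)
  have [measurable]: "\<psi> \<in> borel_measurable m" "q \<in> borel_measurable m"
    using vs by (auto simp: potential_seq_def finite_energy_def)
  have [measurable]: "\<eta> \<in> borel_measurable m" unfolding \<eta>_def b_def by measurable
  have bm [measurable]: "b \<in> borel_measurable m" unfolding b_def by measurable
  have bB: "\<bar>b x\<bar> \<le> B" for x
  proof -
    have "\<bar>\<alpha> * \<psi> x\<bar> \<le> \<alpha> * K" using mult_left_mono[OF \<psi>[of x], of \<alpha>] \<alpha> by (simp add: abs_mult)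
    then show ?thesis using qb[of x] unfolding b_def B_def by linarith
  qed
  have bb: "b \<in> borel_measurable borel" using bm by (simp add: borel_measurable_m)
  have \<eta>B: "\<bar>\<eta> x\<bar> \<le> B / \<alpha>" for x unfolding \<eta>_def by (rule process_resolvent_bound[OF \<alpha> bb bB])
  obtain S :: "nat \<Rightarrow> 'a set" where S: "range S \<subseteq> sets m" "(\<Union>i. S i) = space m"
      "\<And>i. emeasure m (S i) \<noteq> \<infinity>" "incseq S"
    using sigma_finite_incseq by metis
  have [measurable]: "S i \<in> sets m" for i using S by auto
  have spm: "space m = UNIV" using sets_eq_imp_space_eq[OF sets_m] by simp
  have bi: "integrable m (indicator A :: 'a \<Rightarrow> real)" if "A \<in> sets m" "emeasure m A \<noteq> \<infinity>" for A
    using that by (simp add: top.not_eq_extremum)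
  define bn where "bn = (\<lambda>n x. b x * indicator (S n) x)"
  have bnb: "\<bar>bn n x\<bar> \<le> B" for n x using bB[of x] B0 by (auto simp: bn_def indicator_def)
  have bnm [measurable]: "bn n \<in> borel_measurable m" for n unfolding bn_def by measurable
  have bnb': "bn n \<in> borel_measurable borel" for n using bnm by (simp add: borel_measurable_m)
  have bni: "integrable m (bn n)" for n
  proof (rule Bochner_Integration.integrable_bound)
    show "integrable m (\<lambda>x. B * indicator (S n) x)" using bi[OF _ S(3)[of n]] by simp
    show "AE x in m. norm (bn n x) \<le> norm (B * indicator (S n) x)"
      using bB B0 by (auto simp: bn_def indicator_def)
  qed simp
  have bnL: "bn n \<in> L2 m" for n by (rule L2_bounded_integrable[OF bni bnb])
  have bnlim: "(\<lambda>n. bn n x) \<longlonglongrightarrow> b x" for x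
  proof -
    obtain N where "x \<in> S N" using S(2) spm by blast
    then have "bn n x = b x" if "n \<ge> N" for n
      using that S(4) by (auto simp: bn_def indicator_def dest: incseqD)
    then have "\<forall>\<^sub>F n in sequentially. bn n x = b x" by (rule eventually_sequentiallyI)
    then show ?thesis by (rule tendsto_eventually)
  qed
  have "\<exists>\<tau>. is_resolvent \<alpha> (bn n) \<tau>" for n using resolvent_exists[OF \<alpha> bnL bnb] by metis
  then obtain \<tau> where \<tau>: "\<And>n. is_resolvent \<alpha> (bn n) (\<tau> n)" by metis
  have \<tau>D: "\<tau> n \<in> D" for n using \<tau>[of n] by (simp add: is_resolvent_def)
  note [measurable] = D_measurable[OF \<tau>D]
  have \<tau>ae: "AE x in m. resolvent X P \<alpha> (bn n) x = \<tau> n x" for n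
    by (rule process_resolvent_AE[OF \<alpha> bnL bnb' bnb \<tau>])
  have \<tau>B: "AE x in m. \<bar>\<tau> n x\<bar> \<le> B / \<alpha>" for n by (rule resolvent_bounded[OF \<alpha> bnL bnb \<tau>])
  have \<tau>lim: "AE x in m. (\<lambda>n. \<tau> n x) \<longlonglongrightarrow> \<eta> x"
  proof -
    have "AE x in m. \<forall>n. resolvent X P \<alpha> (bn n) x = \<tau> n x" using \<tau>ae by (simp add: AE_all_countable)
    then show ?thesis
    proof eventually_elim
      case (elim x)
      then show ?case
        using process_resolvent_tendsto[OF \<alpha> bnb' bnb bb bnlim, of x] by (simp add: \<eta>_def)
    qed
  qed
  have test: "(\<integral>x. \<psi> x * indicator A x \<partial>m) = (\<integral>x. \<eta> x * indicator A x \<partial>m)"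
    if A [measurable]: "A \<in> sets m" and fin: "emeasure m A < \<infinity>" for A
  proof -
    define \<kappa> :: "'a \<Rightarrow> real" where "\<kappa> = indicator A"
    have \<kappa>i: "integrable m \<kappa>" unfolding \<kappa>_def using fin by (intro bi) auto
    have \<kappa>b: "\<bar>\<kappa> x\<bar> \<le> 1" for x by (simp add: \<kappa>_def indicator_def)
    have \<kappa>L: "\<kappa> \<in> L2 m" by (rule L2_bounded_integrable[OF \<kappa>i \<kappa>b])
    obtain \<sigma> where \<sigma>: "is_resolvent \<alpha> \<kappa> \<sigma>" using resolvent_exists[OF \<alpha> \<kappa>L \<kappa>b] by blast
    have \<sigma>i: "integrable m \<sigma>" by (rule resolvent_integrable[OF \<alpha> \<kappa>i \<kappa>b \<sigma>])
    have [measurable]: "\<sigma> \<in> borel_measurable m" "\<kappa> \<in> borel_measurable m" using \<sigma>i \<kappa>i by auto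
    have i1: "integrable m (\<lambda>x. \<kappa> x * \<psi> x)" by (rule bounded_test_integrable[OF \<kappa>i _ \<psi>]) simp
    have i2: "integrable m (\<lambda>x. \<sigma> x * \<psi> x)" by (rule bounded_test_integrable[OF \<sigma>i _ \<psi>]) simp
    have i3: "integrable m (\<lambda>x. \<sigma> x * q x)" by (rule bounded_test_integrable[OF \<sigma>i _ qb]) simp
    have "(\<integral>x. \<psi> x * (\<kappa> x - \<alpha> * \<sigma> x) \<partial>m) = (\<integral>x. \<sigma> x * q x \<partial>m)"
      by (rule potential_resolvent[OF vs \<psi> K \<alpha> \<kappa>i \<kappa>b \<sigma>])
    moreover have "(\<integral>x. \<psi> x * (\<kappa> x - \<alpha> * \<sigma> x) \<partial>m) = (\<integral>x. \<kappa> x * \<psi> x - \<alpha> * (\<sigma> x * \<psi> x) \<partial>m)"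
      by (rule Bochner_Integration.integral_cong) (auto simp: algebra_simps)
    moreover have "\<dots> = (\<integral>x. \<kappa> x * \<psi> x \<partial>m) - \<alpha> * (\<integral>x. \<sigma> x * \<psi> x \<partial>m)" using i1 i2 by simp
    moreover have "(\<integral>x. \<sigma> x * b x \<partial>m) = (\<integral>x. \<sigma> x * q x + \<alpha> * (\<sigma> x * \<psi> x) \<partial>m)"
      by (rule Bochner_Integration.integral_cong) (auto simp: b_def algebra_simps)
    moreover have "\<dots> = (\<integral>x. \<sigma> x * q x \<partial>m) + \<alpha> * (\<integral>x. \<sigma> x * \<psi> x \<partial>m)" using i2 i3 by simp
    ultimately have dual: "(\<integral>x. \<kappa> x * \<psi> x \<partial>m) = (\<integral>x. \<sigma> x * b x \<partial>m)" by simp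
    have lim1: "(\<lambda>n. \<integral>x. \<sigma> x * bn n x \<partial>m) \<longlonglongrightarrow> (\<integral>x. \<sigma> x * b x \<partial>m)"
    proof (rule integral_dominated_convergence)
      show "integrable m (\<lambda>x. \<bar>\<sigma> x\<bar> * B)" using \<sigma>i by simp
      show "AE x in m. norm (\<sigma> x * bn n x) \<le> \<bar>\<sigma> x\<bar> * B" for n
        using bnb by (auto simp: abs_mult intro!: AE_I2 mult_left_mono)
      show "AE x in m. (\<lambda>n. \<sigma> x * bn n x) \<longlonglongrightarrow> \<sigma> x * b x"
        by (intro AE_I2 tendsto_intros bnlim)
    qed measurable
    have swap: "(\<integral>x. \<sigma> x * bn n x \<partial>m) = (\<integral>x. \<kappa> x * \<tau> n x \<partial>m)" for n
      using resolvent_sym[OF \<kappa>L bnL \<sigma> \<tau>, of n] by (simp add: l2_inner_def)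
    have lim2: "(\<lambda>n. \<integral>x. \<kappa> x * \<tau> n x \<partial>m) \<longlonglongrightarrow> (\<integral>x. \<kappa> x * \<eta> x \<partial>m)"
    proof (rule integral_dominated_convergence)
      show "integrable m (\<lambda>x. \<bar>\<kappa> x\<bar> * (B / \<alpha>))" using \<kappa>i by simp
      show "AE x in m. norm (\<kappa> x * \<tau> n x) \<le> \<bar>\<kappa> x\<bar> * (B / \<alpha>)" for n
        using \<tau>B[of n] by eventually_elim (auto simp: abs_mult simp del: times_divide_eq_right intro!: mult_left_mono)
      show "AE x in m. (\<lambda>n. \<kappa> x * \<tau> n x) \<longlonglongrightarrow> \<kappa> x * \<eta> x"
        using \<tau>lim by eventually_elim (intro tendsto_intros)
    qed measurable
    have "(\<integral>x. \<sigma> x * b x \<partial>m) = (\<integral>x. \<kappa> x * \<eta> x \<partial>m)"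
      by (rule LIMSEQ_unique[OF lim1[unfolded swap] lim2])
    with dual show ?thesis by (simp add: \<kappa>_def mult.commute)
  qed
  \<comment> \<open>adding a constant reduces the comparison of \<open>\<eta>\<close> and \<open>\<psi>\<close> to nonnegative functions\<close>
  define C where "C = K + B / \<alpha>"
  have pos: "0 \<le> \<psi> x + C" "0 \<le> \<eta> x + C" for x
  proof -
    have "0 \<le> B / \<alpha>" using B0 \<alpha> by simp
    then show "0 \<le> \<psi> x + C" "0 \<le> \<eta> x + C" using \<psi>[of x] \<eta>B[of x] K unfolding C_def by linarith+
  qed
  have "AE x in m. ennreal (\<eta> x + C) = ennreal (\<psi> x + C)"
  proof (rule AE_eq_nn_integral_finite_sets)
    fix A assume A [measurable]: "A \<in> sets m" and fin: "emeasure m A < \<infinity>"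
    have \<kappa>i: "integrable m (indicator A :: 'a \<Rightarrow> real)" using fin by (intro bi) auto
    have i: "(\<integral>\<^sup>+x. ennreal (y x + C) * indicator A x \<partial>m)
         = ennreal ((\<integral>x. y x * indicator A x \<partial>m) + (\<integral>x. C * indicator A x \<partial>m))"
      if [measurable]: "y \<in> borel_measurable m" and y: "\<And>x. \<bar>y x\<bar> \<le> K'" "\<And>x. 0 \<le> y x + C" for y K'
    proof -
      have iy: "integrable m (\<lambda>x. indicator A x * y x)" by (rule bounded_test_integrable[OF \<kappa>i _ y(1)]) simp
      have iC: "integrable m (\<lambda>x. C * indicator A x)" using \<kappa>i by simp
      have "(\<integral>\<^sup>+x. ennreal (y x + C) * indicator A x \<partial>m) = (\<integral>\<^sup>+x. ennreal (indicator A x * y x + C * indicator A x) \<partial>m)"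
        by (intro nn_integral_cong) (auto simp: indicator_def)
      also have "\<dots> = ennreal (\<integral>x. indicator A x * y x + C * indicator A x \<partial>m)"
        using iy iC y(2) by (intro nn_integral_eq_integral) (auto simp: indicator_def)
      also have "(\<integral>x. indicator A x * y x + C * indicator A x \<partial>m) = (\<integral>x. indicator A x * y x \<partial>m) + (\<integral>x. C * indicator A x \<partial>m)"
        using iy iC by (rule Bochner_Integration.integral_add)
      finally show ?thesis by (simp add: mult.commute)
    qed
    show "(\<integral>\<^sup>+x. ennreal (\<eta> x + C) * indicator A x \<partial>m) = (\<integral>\<^sup>+x. ennreal (\<psi> x + C) * indicator A x \<partial>m)"
      using i[OF _ \<eta>B pos(2)] i[OF _ \<psi> pos(1)] test[OF A fin] by simp
  qed measurable
  then have "AE x in m. \<eta> x = \<psi> x"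
  proof eventually_elim
    case (elim x)
    then show ?case using pos[of x] by (simp add: ennreal_inj)
  qed
  then show ?thesis by (simp add: \<eta>_def b_def)
qed

text \<open>The difference \<open>w\<close> need not be integrable here, so only densities \<open>q\<close> carried by a set where both
  solutions are bounded may be tested: with \<open>\<rho> j\<close> supported in \<open>A j\<close>, the truncations of \<open>u\<close> and \<open>v\<close> at
  levels above \<open>j\<close> can be replaced by \<open>u\<close> and \<open>v\<close>. Such densities need not be continuous, and it is the
  strong Feller property that makes their potentials continuous.\<close>

lemma uniqueness_strong_feller:
  assumes \<alpha>: "\<alpha> > 0" and feller: "resolvent X P \<alpha> ` bounded_borel \<subseteq> bcontfun"
  shows "AE x in m. u x = v x"
proof (rule w_zero_of_truncation)
  define \<phi> where "\<phi> = truncation 1 w"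
  have \<phi>b: "\<bar>\<phi> x\<bar> \<le> 1" for x by (simp add: \<phi>_def truncation_bound)
  have [measurable]: "\<phi> \<in> borel_measurable m" unfolding \<phi>_def by measurable
  have spm: "space m = UNIV" using sets_eq_imp_space_eq[OF sets_m] by simp
  obtain p0 :: "'a \<Rightarrow> ennreal" where p0 [measurable]: "p0 \<in> borel_measurable m" and
    p0i: "integral\<^sup>N m p0 \<noteq> \<infinity>" and p0b: "\<And>x. 0 < p0 x \<and> p0 x < \<infinity>"
    using Ex_finite_integrable_function spm by auto
  define p1 where "p1 = (\<lambda>x. min (g x) (enn2real (p0 x)))"
  have [measurable]: "p1 \<in> borel_measurable m" unfolding p1_def by measurable
  have p1: "0 < p1 x" "p1 x \<le> g x" for x
    using p0b[of x] g_pos[of x] by (auto simp: p1_def enn2real_positive_iff)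
  have p1i: "integrable m p1"
  proof (rule integrableI_bounded)
    have "(\<integral>\<^sup>+x. ennreal (norm (p1 x)) \<partial>m) \<le> integral\<^sup>N m p0"
    proof (rule nn_integral_mono)
      fix x
      have "ennreal (norm (p1 x)) \<le> ennreal (enn2real (p0 x))"
        using p1(1)[of x] by (intro ennreal_leI) (auto simp: p1_def)
      also have "\<dots> = p0 x" using p0b[of x] by simp
      finally show "ennreal (norm (p1 x)) \<le> p0 x" .
    qed
    then show "(\<integral>\<^sup>+x. ennreal (norm (p1 x)) \<partial>m) < \<infinity>" using p0i by (simp add: top.not_eq_extremum le_less_trans)
  qed simp
  define A where "A = (\<lambda>j::nat. {x \<in> space m. \<bar>u x\<bar> \<le> real j \<and> \<bar>v x\<bar> \<le> real j})"
  have [measurable]: "A j \<in> sets m" for j unfolding A_def by measurable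
  define \<rho> where "\<rho> = (\<lambda>j x. p1 x * indicator (A j) x)"
  have \<rho>m [measurable]: "\<rho> j \<in> borel_measurable m" for j unfolding \<rho>_def by measurable
  have \<rho>: "0 \<le> \<rho> j x" "\<rho> j x \<le> g x" "\<rho> j x \<le> 1" for j x
    using p1[of x] g_le_1[of x] g_pos[of x] by (auto simp: \<rho>_def indicator_def less_imp_le)
  have \<rho>i: "integrable m (\<rho> j)" for j
    by (rule Bochner_Integration.integrable_bound[OF p1i]) (use p1(1) in \<open>auto simp: \<rho>_def indicator_def\<close>)
  have "\<exists>vs \<psi>. potential_seq vs (\<lambda>x. real (Suc j) * (\<rho> j x * (\<phi> x - \<psi> x))) \<psi> \<and> (\<forall>x. \<bar>\<psi> x\<bar> \<le> 1)" for j
  proof -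
    obtain vs \<psi> where "potential_seq vs (\<lambda>x. real (Suc j) * (\<rho> j x * (\<phi> x - \<psi> x))) \<psi>" "\<And>x. \<bar>\<psi> x\<bar> \<le> 1"
      by (rule weighted_potential_exists[OF \<rho>m \<rho>(1) \<rho>(2) \<rho>i, of "real (Suc j)" 1 \<phi>]) (use \<phi>b in auto)
    then show ?thesis by blast
  qed
  then obtain vs \<psi> where vs: "\<And>j. potential_seq (vs j) (\<lambda>x. real (Suc j) * (\<rho> j x * (\<phi> x - \<psi> j x))) (\<psi> j)"
    and \<psi>: "\<And>j x. \<bar>\<psi> j x\<bar> \<le> 1" by metis
  define q where "q = (\<lambda>j x. real (Suc j) * (\<rho> j x * (\<phi> x - \<psi> j x)))"
  have vsq: "potential_seq (vs j) (q j) (\<psi> j)" for j using vs by (simp add: q_def)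
  have \<psi>m [measurable]: "\<psi> j \<in> borel_measurable m" and qm [measurable]: "q j \<in> borel_measurable m" for j
    using vsq[of j] by (auto simp: potential_seq_def finite_energy_def)
  have qb: "\<bar>q j x\<bar> \<le> real (Suc j) * 2" for j x
  proof -
    have "\<bar>\<phi> x - \<psi> j x\<bar> \<le> 2" using \<phi>b[of x] \<psi>[of j x] by linarith
    then have "\<rho> j x * \<bar>\<phi> x - \<psi> j x\<bar> \<le> 1 * 2" using \<rho>[where j=j and x=x] by (intro mult_mono) auto
    from mult_left_mono[OF this, of "real (Suc j)"] show ?thesis
      using \<rho>(1)[of j x] by (simp add: q_def abs_mult)
  qed
  have qi: "integrable m (q j)" for j
  proof -
    have "\<bar>\<phi> x - \<psi> j x\<bar> \<le> 2" for x using \<phi>b[of x] \<psi>[of j x] by linarith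
    from bounded_test_integrable[OF \<rho>i[of j] _ this] show ?thesis by (simp add: q_def)
  qed
  have q0: "q j x = 0" if "x \<notin> A j" for j x using that by (simp add: q_def \<rho>_def)
  have wq: "integrable m (\<lambda>x. w x * q j x)" "(\<integral>x. w x * q j x \<partial>m) = (\<integral>x. G x * \<psi> j x \<partial>m)" for j
  proof -
    define \<eta> where "\<eta> = resolvent X P \<alpha> (\<lambda>x. q j x + \<alpha> * \<psi> j x)"
    have "(\<lambda>x. q j x + \<alpha> * \<psi> j x) \<in> bounded_borel"
    proof -
      have "\<bar>q j x + \<alpha> * \<psi> j x\<bar> \<le> real (Suc j) * 2 + \<alpha>" for x
      proof -
        have "\<bar>\<alpha> * \<psi> j x\<bar> \<le> \<alpha>" using mult_left_mono[OF \<psi>[of j x], of \<alpha>] \<alpha> by (simp add: abs_mult)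
        then show ?thesis using qb[of j x] by linarith
      qed
      moreover have "(\<lambda>x. q j x + \<alpha> * \<psi> j x) \<in> borel_measurable borel"
        unfolding borel_measurable_m[symmetric] by measurable
      ultimately show ?thesis by (auto simp: bounded_borel_def bounded_iff)
    qed
    then have \<eta>c: "\<eta> \<in> bcontfun" using feller by (auto simp: \<eta>_def)
    then have \<eta>m [measurable]: "\<eta> \<in> borel_measurable m"
      using borel_of_bcontfun(1) by (simp add: borel_measurable_m)
    have ae: "AE x in m. \<eta> x = \<psi> j x"
      unfolding \<eta>_def
      by (rule potential_eq_process_resolvent[OF \<alpha> vsq \<psi> _ qb]) (use \<eta>m in \<open>auto simp: \<eta>_def\<close>)
    have app: "approximating_seq m D \<E> (vs j) \<eta>"
    proof -
      have "AE x in m. (\<lambda>n. vs j n x) \<longlonglongrightarrow> \<psi> j x"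
        using vsq[of j] by (auto simp: potential_seq_def approximating_seq_iff)
      then have "AE x in m. (\<lambda>n. vs j n x) \<longlonglongrightarrow> \<eta> x" using ae by eventually_elim simp
      then show ?thesis using vsq[of j] by (auto simp: potential_seq_def approximating_seq_iff)
    qed
    have pot: "potential_seq (vs j) (q j) \<eta>" using vsq[of j] app by (simp add: potential_seq_def)
    have \<eta>e: "\<eta> \<in> ext_space m D \<E>" using app by (auto simp: ext_space_def)
    have tr: "truncation n y x * q j x = y x * q j x"
      if "real j \<le> n" "\<And>x. x \<in> A j \<Longrightarrow> \<bar>y x\<bar> \<le> real j" for n y x
    proof (cases "x \<in> A j")
      case True
      then have "truncation n y x = y x" using that by (intro truncation_eq) (meson order_trans)
      then show ?thesis by simp
    qed (simp add: q0)
    have uA: "x \<in> A j \<Longrightarrow> \<bar>u x\<bar> \<le> real j" and vA: "x \<in> A j \<Longrightarrow> \<bar>v x\<bar> \<le> real j" for x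
      by (auto simp: A_def)
    have val: "integrable m (\<lambda>x. u x * q j x)" "ext_form m D \<E> (truncation (real n) u) \<eta> = (\<integral>x. u x * q j x \<partial>m)"
        "integrable m (\<lambda>x. v x * q j x)" "ext_form m D \<E> (truncation (real n) v) \<eta> = (\<integral>x. v x * q j x \<partial>m)"
      if n: "Suc j \<le> n" for n
    proof -
      have n0: "0 < real n" and jn: "real j \<le> real n" using n by auto
      obtain us where us: "approximating_seq m D \<E> us (truncation (real n) u)" using truncation_approx[OF n0] .
      obtain ws where ws: "approximating_seq m D \<E> ws (truncation (real n) v)" using truncation_approx_v[OF n0] .
      have eu: "(\<lambda>x. truncation (real n) u x * q j x) = (\<lambda>x. u x * q j x)"
        using tr[where y = u, OF jn uA] by (intro ext)
      have ev: "(\<lambda>x. truncation (real n) v x * q j x) = (\<lambda>x. v x * q j x)"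
        using tr[where y = v, OF jn vA] by (intro ext)
      show "integrable m (\<lambda>x. u x * q j x)" "ext_form m D \<E> (truncation (real n) u) \<eta> = (\<integral>x. u x * q j x \<partial>m)"
        using potential_ext_form[OF pot us] unfolding eu by auto
      show "integrable m (\<lambda>x. v x * q j x)" "ext_form m D \<E> (truncation (real n) v) \<eta> = (\<integral>x. v x * q j x \<partial>m)"
        using potential_ext_form[OF pot ws] unfolding ev by auto
    qed
    have "(\<integral>x. u x * q j x \<partial>m) - (\<integral>x. v x * q j x \<partial>m) = (\<integral>x. G x * \<eta> x \<partial>m)"
    proof (rule difference_equation[OF \<eta>e \<eta>c])
      have "\<forall>\<^sub>F n in sequentially. ext_form m D \<E> (truncation (real n) u) \<eta> - ext_form m D \<E> (truncation (real n) v) \<eta>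
          = (\<integral>x. u x * q j x \<partial>m) - (\<integral>x. v x * q j x \<partial>m)"
        by (rule eventually_sequentiallyI[of "Suc j"]) (simp add: val)
      then show "(\<lambda>n. ext_form m D \<E> (truncation (real n) u) \<eta> - ext_form m D \<E> (truncation (real n) v) \<eta>)
          \<longlonglongrightarrow> (\<integral>x. u x * q j x \<partial>m) - (\<integral>x. v x * q j x \<partial>m)"
        by (rule tendsto_eventually)
    qed
    moreover have "(\<integral>x. G x * \<eta> x \<partial>m) = (\<integral>x. G x * \<psi> j x \<partial>m)"
    proof (rule integral_cong_AE)
      have [measurable]: "G \<in> borel_measurable m" using G_integrable by auto
      show "(\<lambda>x. G x * \<eta> x) \<in> borel_measurable m" "(\<lambda>x. G x * \<psi> j x) \<in> borel_measurable m" by measurable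
      show "AE x in m. G x * \<eta> x = G x * \<psi> j x" using ae by eventually_elim simp
    qed
    moreover have "(\<lambda>x. w x * q j x) = (\<lambda>x. u x * q j x - v x * q j x)" by (simp add: w_def left_diff_distrib)
    ultimately show "integrable m (\<lambda>x. w x * q j x)" "(\<integral>x. w x * q j x \<partial>m) = (\<integral>x. G x * \<psi> j x \<partial>m)"
      using val(1,3)[of "Suc j"] by auto
  qed
  have int: "integrable m (\<lambda>x. truncation 1 w x * q j x)" "integrable m (\<lambda>x. \<psi> j x * q j x)" for j
    using bounded_test_integrable[where \<eta> = \<phi>, OF qi[of j] _ \<phi>b]
      bounded_test_integrable[where \<eta> = "\<psi> j", OF qi[of j] _ \<psi>[of j]]
    by (auto simp: \<phi>_def mult.commute)
  note energy = potential_energy[OF vsq]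
  show "AE x in m. truncation 1 w x = 0"
    unfolding \<phi>_def[symmetric]
  proof (rule vanishing_criterion[where g = g and p = p1 and A = A and \<psi> = \<psi> and K = 1 and G = G and c = c])
    show "G x * \<phi> x \<le> 0" for x unfolding \<phi>_def by (rule G_sign) simp
    show "incseq A" by (auto simp: incseq_def A_def)
    show "(\<Union>j. A j) = space m"
    proof -
      have "x \<in> (\<Union>j. A j)" for x
      proof -
        obtain j where "max \<bar>u x\<bar> \<bar>v x\<bar> \<le> real j" using real_arch_simple by blast
        then have "x \<in> A j" by (simp add: A_def spm)
        then show ?thesis by blast
      qed
      then show ?thesis by (auto simp: spm)
    qed
    fix j
    have e1: "(\<integral>x. \<psi> j x * q j x \<partial>m) \<le> (\<integral>x. w x * q j x \<partial>m)"
      and e2: "(\<integral>\<^sup>+x. ennreal (\<rho> j x * (\<phi> x - \<psi> j x)\<^sup>2) \<partial>m) \<le> ennreal ((\<integral>x. w x * q j x \<partial>m) / real (Suc j))"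
      using truncation_estimate[of "real (Suc j)" "\<rho> j" "\<psi> j" 1 m w] \<psi> \<rho>(1) int[of j] wq(1)[of j] energy(1)[of j]
      unfolding q_def \<phi>_def by auto
    show "(\<integral>\<^sup>+x. ennreal (p1 x * indicator (A j) x * (\<phi> x - \<psi> j x)\<^sup>2) \<partial>m) \<le> ennreal ((\<integral>x. G x * \<psi> j x \<partial>m) / real (Suc j))"
      using e2 unfolding wq \<rho>_def .
    have "(\<integral>\<^sup>+x. ennreal \<bar>\<psi> j x * g x\<bar> \<partial>m) \<le> ennreal (c * sqrt (\<integral>x. \<psi> j x * q j x \<partial>m))" by (rule energy(2))
    also have "\<dots> \<le> ennreal (c * sqrt (\<integral>x. G x * \<psi> j x \<partial>m))"
      using e1 c_pos unfolding wq by (intro ennreal_leI mult_left_mono real_sqrt_le_mono) auto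
    finally show "(\<integral>\<^sup>+x. ennreal \<bar>\<psi> j x * g x\<bar> \<partial>m) \<le> ennreal (c * sqrt (\<integral>x. G x * \<psi> j x \<partial>m))" .
  qed (auto simp: g_pos p1 \<psi> G_integrable c_pos)
qed

end

theorem theorem4p13:
  fixes m :: "'a::{metric_space, second_countable_topology} measure"
    and D :: "('a \<Rightarrow> real) set"
    and \<E> :: "('a \<Rightarrow> real) \<Rightarrow> ('a \<Rightarrow> real) \<Rightarrow> real"
    and M :: "'w measure"
    and F :: "ennreal \<Rightarrow> 'w measure"
    and X :: "ennreal \<Rightarrow> 'w \<Rightarrow> 'a option"
    and P :: "'a option \<Rightarrow> 'w measure"
    and \<mu> :: "'a set \<Rightarrow> real"
    and f :: "'a \<Rightarrow> real \<Rightarrow> real"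
  assumes "locally_compact_space (euclidean :: 'a topology)"
    and "radon_measure m" and "full_support m"
    and "symmetric_dirichlet_form m D \<E>"
    and "regular_form m D \<E>" and "transient_form m D \<E>"
    and "hunt_process M F X P"
    and "associated_process m D \<E> X P"
    and "absolute_continuity m X P"
    and "\<mu> \<in> bounded_signed_measures"
    and "(\<lambda>(x, y). f x y) \<in> borel_measurable borel"
    and "\<And>x. antimono (f x)"
  shows "((\<exists>\<alpha>>0. resolvent X P \<alpha> ` bcontfun \<subseteq> bcontfun) \<longrightarrow>
           (\<forall>u v. renormalized_solution m D \<E> f \<mu> u \<and> integrable m u \<and>
                  renormalized_solution m D \<E> f \<mu> v \<and> integrable m v \<longrightarrow>
                  (AE x in m. u x = v x)))
       \<and> ((\<exists>\<alpha>>0. resolvent X P \<alpha> ` bounded_borel \<subseteq> bcontfun) \<longrightarrow>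
           (\<forall>u v. renormalized_solution m D \<E> f \<mu> u \<and> renormalized_solution m D \<E> f \<mu> v \<longrightarrow>
                  (AE x in m. u x = v x)))"
proof -
  have sets_m: "sets m = sets borel" using assms(2) by (simp add: radon_measure_def)
  obtain p :: "real \<Rightarrow> 'a \<Rightarrow> 'a \<Rightarrow> ennreal" where
    p1: "(\<lambda>(t, x, y). p t x y) \<in> borel_measurable borel" and
    p2: "\<forall>t>0. \<forall>x. \<forall>h :: 'a \<Rightarrow> ennreal. h \<in> borel_measurable borel \<longrightarrow>
           (\<integral>\<^sup>+\<omega>. zero_ext h (X (ennreal t) \<omega>) \<partial>P (Some x)) = (\<integral>\<^sup>+y. h y * p t x y \<partial>m)"
    using assms(9) unfolding absolute_continuity_def by (elim exE conjE) (rule that)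
  note p = p1 p2[rule_format]
  obtain g0 c where g0 [measurable]: "g0 \<in> borel_measurable m" and c: "c > 0" and g0_pos: "\<And>x. g0 x > 0"
    and tr: "\<And>u. u \<in> D \<Longrightarrow> (\<integral>\<^sup>+x. ennreal (\<bar>u x\<bar> * g0 x) \<partial>m) \<le> ennreal (c * sqrt (\<E> u u))"
    using assms(6) unfolding transient_form_def by blast
  \<comment> \<open>decreasing the reference function keeps the transience inequality\<close>
  define g where "g = (\<lambda>x. min (g0 x) 1)"
  have setting: "uniqueness_setting m D \<E> g c M F X P p f \<mu> u v"
    if uv: "renormalized_solution m D \<E> f \<mu> u" "renormalized_solution m D \<E> f \<mu> v" for u v
  proof (intro radon_sigma_finite[OF assms(1,2)] uniqueness_setting.intro transient_dirichlet_space.intro process_dirichlet_space.intro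
      dirichlet_space.intro dirichlet_space_axioms.intro transient_dirichlet_space_axioms.intro
      process_dirichlet_space_axioms.intro uniqueness_setting_axioms.intro hunt.intro)
    show "g \<in> borel_measurable m" unfolding g_def by measurable
    show "0 < g x" "g x \<le> 1" for x using g0_pos[of x] by (auto simp: g_def)
    fix y assume y: "y \<in> D"
    have "(\<integral>\<^sup>+x. ennreal \<bar>y x * g x\<bar> \<partial>m) \<le> (\<integral>\<^sup>+x. ennreal (\<bar>y x\<bar> * g0 x) \<partial>m)"
      using g0_pos by (intro nn_integral_mono ennreal_leI)
        (auto simp: g_def abs_mult less_imp_le intro!: mult_left_mono)
    also have "\<dots> \<le> ennreal (c * sqrt (\<E> y y))" by (rule tr[OF y])
    finally show "(\<integral>\<^sup>+x. ennreal \<bar>y x * g x\<bar> \<partial>m) \<le> ennreal (c * sqrt (\<E> y y))" .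
  qed (use assms sets_m p c uv in auto)
  show ?thesis
  proof (intro conjI impI allI)
    fix u v
    assume "\<exists>\<alpha>>0. resolvent X P \<alpha> ` bcontfun \<subseteq> bcontfun"
      and uv: "renormalized_solution m D \<E> f \<mu> u \<and> integrable m u \<and>
                  renormalized_solution m D \<E> f \<mu> v \<and> integrable m v"
    then obtain \<alpha> where \<alpha>: "\<alpha> > 0" "resolvent X P \<alpha> ` bcontfun \<subseteq> bcontfun" by blast
    interpret uniqueness_setting m D \<E> g c M F X P p f \<mu> u v using uv by (intro setting) auto
    show "AE x in m. u x = v x" using uniqueness_integrable[OF \<alpha>] uv by blast
  next
    fix u v
    assume "\<exists>\<alpha>>0. resolvent X P \<alpha> ` bounded_borel \<subseteq> bcontfun"
      and uv: "renormalized_solution m D \<E> f \<mu> u \<and> renormalized_solution m D \<E> f \<mu> v"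
    then obtain \<alpha> where \<alpha>: "\<alpha> > 0" "resolvent X P \<alpha> ` bounded_borel \<subseteq> bcontfun" by blast
    interpret uniqueness_setting m D \<E> g c M F X P p f \<mu> u v using uv by (intro setting) auto
    show "AE x in m. u x = v x" using uniqueness_strong_feller[OF \<alpha>] .
  qed
qed

end
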